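(* Let $f$ be a NET map presented by lattices $\Lambda_1\subseteq\Lambda_2=\mathbb{Z}^2$ and branched coverings $\pi_1,\pi_2\colon\mathbb{R}^2\to S^2$ with $f\circ\pi_1=\pi_2$, and let $P_2=\pi_2(\mathbb{Z}^2)$ be its postcritical set. Slopes of simple closed curves in $S^2\setminus P_2$ are computed using the standard basis vectors $e_1,e_2$ of $\mathbb{Z}^2$. Let $\mu_f$ be the slope function of $f$, and suppose that there exist slopes $s$ and $t$ such that $\mu_f(s)$ and $\mu_f(t)$ are distinct slopes. Let $\Psi\in\mathrm{Aff}(f)$, and let $\widetilde{\psi}\colon S^2\to S^2$ and $\psi\colon S^2\to S^2$ be the homeomorphisms induced by $\Psi$ via $\pi_1$ and $\pi_2$ respectively, that is, $\pi_1\circ\Psi=\widetilde{\psi}\circ\pi_1$ and $\pi_2\circ\Psi=\psi\circ\pi_2$. Let $\widetilde{\Psi}\colon\mathbb{R}^2\to\mathbb{R}^2$ be an affine isomorphism such that the homeomorphism of $S^2$ which $\widetilde{\Psi}$ induces via $\pi_2$ is isotopic to $\widetilde{\psi}$ rel $P_2$. (1) The linear part $x\mapsto Qx$ of $\widetilde{\Psi}$ can be computed as follows. Suppose that $\Psi$ takes lines with slope $s$, respectively $t$, to lines with slope $s'$, respectively $t'$. Then $Q$ is the element of $\mathrm{GL}(2,\mathbb{Z})$, unique up to multiplication by $\pm1$, whose determinant equals the determinant of (the linear part of) $\Psi$ and which takes lines with slope $\mu_f(s)$, respectively $\mu_f(t)$, to lines with slope $\mu_f(s')$, respectively $\mu_f(t')$.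 (2) The translation part of $\widetilde{\Psi}$ (which matters only modulo $2\mathbb{Z}^2$) can be computed as follows. Let $T=\{0,e_1,e_2,e_1+e_2\}$, and for $\tau\in T$ let $x_\tau=\pi_2(\tau)$, so that $P_2=\{x_0,x_{e_1},x_{e_2},x_{e_1+e_2}\}$. Then the translation term of $\widetilde{\Psi}$ is the element $\tau\in T$ for which $\Psi$ maps $\pi_1^{-1}(x_0)$ to $\pi_1^{-1}(x_\tau)$.
   Context: A Thurston map is an orientation-preserving branched covering $f\colon S^2\to S^2$ of degree at least $2$ whose postcritical set $P_f=\bigcup_{k\ge 1}f^{k}(C_f)$ is finite, where $C_f$ is the set of critical points. A nearly Euclidean Thurston (NET) map is a Thurston map each of whose critical points is simple (local degree $2$) and whose postcritical set has exactly four points. Presentations. For every NET map $f$ the set $P_1$ of noncritical points in $f^{-1}(P_f)$ has exactly four elements, and there exist lattices $\Lambda_1\subseteq\Lambda_2$ in $\mathbb{R}^2$ (one may take $\Lambda_2=\mathbb{Z}^2$) and orientation-preserving branched coverings $\pi_1,\pi_2\colon\mathbb{R}^2\to S^2$ with $f\circ\pi_1=\pi_2$ such that $\pi_i$ is a normal covering with deck group $\Gamma_i=\{x\mapsto 2\lambda\pm x:\lambda\in\Lambda_i\}$ for $i=1,2$, $\pi_1(\Lambda_1)=P_1$ and $\pi_2(\Lambda_2)=P_f=:P_2$. $\mathrm{Aff}(f)$ is the group of all affine isomorphisms $\Psi\colon\mathbb{R}^2\to\mathbb{R}^2$ (not necessarily orientation-preserving) such that $\Psi(\Lambda_2)=\Lambda_2$,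 $\Psi(\Lambda_1)=\Lambda_1$ and $\Psi(\Delta)=\Delta$, where $\Delta=\pi_1^{-1}(P_2)$. Each such $\Psi$ induces homeomorphisms $\widetilde\psi,\psi$ of $(S^2,P_2)$ as in the claim and $\psi\circ f=f\circ\widetilde{\psi}$. Slopes. Homotopy classes in $S^2\setminus P_2$ of unoriented simple closed curves which are essential and nonperipheral correspond bijectively to $\overline{\mathbb{Q}}=\mathbb{Q}\cup\{\frac10\}$: the class of slope $r$ is represented by the $\pi_2$-image of a straight line of slope $r$ in $\mathbb{R}^2$ avoiding $\mathbb{Z}^2$. The slope function $\mu_f\colon\overline{\mathbb{Q}}\to\overline{\mathbb{Q}}\cup\{\odot\}$ is defined as follows: if $\gamma$ has slope $r$ and some connected component of $f^{-1}(\gamma)$ is essential and nonperipheral in $S^2\setminus P_2$, then $\mu_f(r)$ is the slope of that component (all such components have the same slope); otherwise $\mu_f(r)=\odot$. Here "$\mu_f(r)$ is a slope" means $\mu_f(r)\neq\odot$. *)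

theory Defs
  imports "HOL-Complex_Analysis.Complex_Analysis"
begin

section \<open>Oriented charts on the plane and on the sphere\<close>

abbreviation S2 :: "(real^3) set" where
  "S2 \<equiv> sphere 0 1"

text \<open>
  Orientations of the two surfaces are given by a parametrization by the complex plane.
  The one for the sphere is inverse stereographic projection, which misses the north pole; as an
  orientation is locally constant, a chart around the pole is oriented by its behaviour
  off the pole.
\<close>

definition plane_param :: "complex \<Rightarrow> real^2" where
  "plane_param z = vector [Re z, Im z]"

definition sphere_param :: "complex \<Rightarrow> real^3" where
  "sphere_param z = (1 / (1 + (cmod z)\<^sup>2)) *\<^sub>R vector [2 * Re z, 2 * Im z, (cmod z)\<^sup>2 - 1]"

definition orientation_preserving_on :: "complex set \<Rightarrow> (complex \<Rightarrow> complex) \<Rightarrow> bool" where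
  "orientation_preserving_on W h \<longleftrightarrow>
     (\<forall>z\<in>W. \<forall>\<^sub>F r in at_right 0. winding_number (h \<circ> circlepath z r) (h z) = 1)"

definition oriented_chart ::
  "(complex \<Rightarrow> 'a::topological_space) \<Rightarrow> 'a set \<Rightarrow> 'a set \<Rightarrow> ('a \<Rightarrow> complex) \<Rightarrow> bool" where
  "oriented_chart e X U \<phi> \<longleftrightarrow>
     openin (top_of_set X) U \<and> (\<exists>\<phi>'. homeomorphism U (ball 0 1) \<phi> \<phi>') \<and>
     orientation_preserving_on (e -` U) (\<phi> \<circ> e)"


section \<open>Branched coverings\<close>

definition oriented_branched_covering ::
  "(complex \<Rightarrow> 'a::topological_space) \<Rightarrow> 'a set \<Rightarrow>
   (complex \<Rightarrow> 'b::topological_space) \<Rightarrow> 'b set \<Rightarrow> ('a \<Rightarrow> 'b) \<Rightarrow> bool" where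
  "oriented_branched_covering e X e' Y f \<longleftrightarrow>
     continuous_on X f \<and> f ` X = Y \<and>
     (\<forall>y\<in>Y. \<exists>V \<psi> \<U>. oriented_chart e' Y V \<psi> \<and> y \<in> V \<and> \<psi> y = 0 \<and>
        pairwise disjnt \<U> \<and> \<Union>\<U> = {x\<in>X. f x \<in> V} \<and>
        (\<forall>U\<in>\<U>. \<exists>\<phi> d. oriented_chart e X U \<phi> \<and> d \<ge> (1::nat) \<and>
           (\<forall>x\<in>U. \<psi> (f x) = \<phi> x ^ d)))"

definition local_degree :: "(real^3 \<Rightarrow> real^3) \<Rightarrow> real^3 \<Rightarrow> nat" where
  "local_degree f x = (THE d. \<exists>U V \<phi> \<psi>.
     oriented_chart sphere_param S2 U \<phi> \<and> x \<in> U \<and> \<phi> x = 0 \<and>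
     oriented_chart sphere_param S2 V \<psi> \<and> f ` U \<subseteq> V \<and> \<psi> (f x) = 0 \<and>
     (\<forall>u\<in>U. \<psi> (f u) = \<phi> u ^ d))"

definition has_degree :: "(real^3 \<Rightarrow> real^3) \<Rightarrow> nat \<Rightarrow> bool" where
  "has_degree f d \<longleftrightarrow>
     (\<forall>y\<in>S2. finite {x\<in>S2. f x = y} \<and> (\<Sum>x\<in>{x\<in>S2. f x = y}. local_degree f x) = d)"

definition critical_points :: "(real^3 \<Rightarrow> real^3) \<Rightarrow> (real^3) set" where
  "critical_points f = {x\<in>S2. local_degree f x > 1}"

definition postcritical_set :: "(real^3 \<Rightarrow> real^3) \<Rightarrow> (real^3) set" where
  "postcritical_set f = (\<Union>k\<in>{1..}. (f ^^ k) ` critical_points f)"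

definition Thurston_map :: "(real^3 \<Rightarrow> real^3) \<Rightarrow> bool" where
  "Thurston_map f \<longleftrightarrow>
     oriented_branched_covering sphere_param S2 sphere_param S2 f \<and>
     (\<exists>d\<ge>2. has_degree f d) \<and> finite (postcritical_set f)"

definition NET_map :: "(real^3 \<Rightarrow> real^3) \<Rightarrow> bool" where
  "NET_map f \<longleftrightarrow> Thurston_map f \<and>
     (\<forall>x\<in>critical_points f. local_degree f x = 2) \<and> card (postcritical_set f) = 4"


section \<open>Presentations of NET maps\<close>

definition lattice_in_plane :: "(real^2) set \<Rightarrow> bool" where
  "lattice_in_plane \<Lambda> \<longleftrightarrow> (\<exists>u v. u \<noteq> v \<and> independent {u, v} \<and>
     \<Lambda> = {of_int a *\<^sub>R u + of_int b *\<^sub>R v | a b :: int. True})"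

definition Z2 :: "(real^2) set" where
  "Z2 = {x. \<forall>i. x $ i \<in> \<int>}"

definition Gamma :: "(real^2) set \<Rightarrow> (real^2 \<Rightarrow> real^2) set" where
  "Gamma \<Lambda> = {\<lambda>x. 2 *\<^sub>R l + x | l. l \<in> \<Lambda>} \<union> {\<lambda>x. 2 *\<^sub>R l - x | l. l \<in> \<Lambda>}"

definition deck_group :: "(real^2 \<Rightarrow> real^3) \<Rightarrow> (real^2 \<Rightarrow> real^2) set" where
  "deck_group \<pi> = {\<gamma>. (\<exists>\<gamma>'. homeomorphism UNIV UNIV \<gamma> \<gamma>') \<and> \<pi> \<circ> \<gamma> = \<pi>}"

definition normal_covering :: "(real^2 \<Rightarrow> real^3) \<Rightarrow> bool" where
  "normal_covering \<pi> \<longleftrightarrow> (\<forall>x y. \<pi> x = \<pi> y \<longrightarrow> (\<exists>\<gamma>\<in>deck_group \<pi>. \<gamma> x = y))"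

definition NET_presentation ::
  "(real^3 \<Rightarrow> real^3) \<Rightarrow> (real^2) set \<Rightarrow> (real^2) set \<Rightarrow>
   (real^2 \<Rightarrow> real^3) \<Rightarrow> (real^2 \<Rightarrow> real^3) \<Rightarrow> bool" where
  "NET_presentation f \<Lambda>1 \<Lambda>2 \<pi>1 \<pi>2 \<longleftrightarrow>
     lattice_in_plane \<Lambda>1 \<and> lattice_in_plane \<Lambda>2 \<and> \<Lambda>1 \<subseteq> \<Lambda>2 \<and>
     oriented_branched_covering plane_param UNIV sphere_param S2 \<pi>1 \<and>
     oriented_branched_covering plane_param UNIV sphere_param S2 \<pi>2 \<and>
     f \<circ> \<pi>1 = \<pi>2 \<and>
     normal_covering \<pi>1 \<and> deck_group \<pi>1 = Gamma \<Lambda>1 \<and>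
     normal_covering \<pi>2 \<and> deck_group \<pi>2 = Gamma \<Lambda>2 \<and>
     \<pi>1 ` \<Lambda>1 = {x\<in>S2. f x \<in> postcritical_set f \<and> x \<notin> critical_points f} \<and>
     \<pi>2 ` \<Lambda>2 = postcritical_set f"


section \<open>Affine maps\<close>

definition linear_part :: "(real^2 \<Rightarrow> real^2) \<Rightarrow> real^2^2" where
  "linear_part F = matrix (\<lambda>x. F x - F 0)"

definition affine_iso :: "(real^2 \<Rightarrow> real^2) \<Rightarrow> bool" where
  "affine_iso F \<longleftrightarrow> (\<exists>A b. invertible A \<and> F = (\<lambda>x. A *v x + b))"

definition Aff ::
  "(real^3 \<Rightarrow> real^3) \<Rightarrow> (real^2) set \<Rightarrow> (real^2) set \<Rightarrow> (real^2 \<Rightarrow> real^3) \<Rightarrow>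
   (real^2 \<Rightarrow> real^2) set" where
  "Aff f \<Lambda>1 \<Lambda>2 \<pi>1 = {F. affine_iso F \<and> F ` \<Lambda>2 = \<Lambda>2 \<and> F ` \<Lambda>1 = \<Lambda>1 \<and>
     F ` (\<pi>1 -` postcritical_set f) = \<pi>1 -` postcritical_set f}"

definition integer_matrix :: "real^2^2 \<Rightarrow> bool" where
  "integer_matrix A \<longleftrightarrow> (\<forall>i j. A $ i $ j \<in> \<int>)"

definition GL2Z :: "(real^2^2) set" where
  "GL2Z = {A. integer_matrix A \<and>
     (\<exists>B. integer_matrix B \<and> A ** B = mat 1 \<and> B ** A = mat 1)}"

definition isotopic_rel ::
  "'a::topological_space set \<Rightarrow> 'a set \<Rightarrow> ('a \<Rightarrow> 'a) \<Rightarrow> ('a \<Rightarrow> 'a) \<Rightarrow> bool" where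
  "isotopic_rel X P g h \<longleftrightarrow> (\<exists>H :: real \<times> 'a \<Rightarrow> 'a.
     continuous_on ({0..1} \<times> X) H \<and>
     (\<forall>x\<in>X. H (0, x) = g x \<and> H (1, x) = h x) \<and>
     (\<forall>t\<in>{0..1}. \<exists>k. homeomorphism X X (\<lambda>x. H (t, x)) k) \<and>
     (\<forall>t\<in>{0..1}. \<forall>p\<in>P. H (t, p) = g p))"


section \<open>Slopes\<close>

datatype slope = Slope rat | Infinite_Slope

text \<open>The slope \<open>p / q\<close> in lowest terms has the primitive direction vector \<open>(q, p)\<close>.\<close>

fun slope_dir :: "slope \<Rightarrow> real^2" where
  "slope_dir (Slope r) =
     vector [of_int (snd (quotient_of r)), of_int (fst (quotient_of r))]"
| "slope_dir Infinite_Slope = vector [0, 1]"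

definition line_through :: "real^2 \<Rightarrow> slope \<Rightarrow> (real^2) set" where
  "line_through p r = {p + c *\<^sub>R slope_dir r | c. True}"

definition takes_slope_to :: "(real^2 \<Rightarrow> real^2) \<Rightarrow> slope \<Rightarrow> slope \<Rightarrow> bool" where
  "takes_slope_to F r r' \<longleftrightarrow> (\<forall>p. \<exists>p'. F ` line_through p r = line_through p' r')"

definition simple_closed_curve_in :: "(real^3) set \<Rightarrow> (real \<Rightarrow> real^3) \<Rightarrow> bool" where
  "simple_closed_curve_in S \<gamma> \<longleftrightarrow>
     simple_path \<gamma> \<and> pathfinish \<gamma> = pathstart \<gamma> \<and> path_image \<gamma> \<subseteq> S"

definition unoriented_homotopic ::
  "(real^3) set \<Rightarrow> (real \<Rightarrow> real^3) \<Rightarrow> (real \<Rightarrow> real^3) \<Rightarrow> bool" where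
  "unoriented_homotopic S \<gamma> \<delta> \<longleftrightarrow>
     homotopic_loops S \<gamma> \<delta> \<or> homotopic_loops S \<gamma> (reversepath \<delta>)"

definition essential :: "(real^3) set \<Rightarrow> (real \<Rightarrow> real^3) \<Rightarrow> bool" where
  "essential P \<gamma> \<longleftrightarrow> (\<forall>a. \<not> homotopic_loops (S2 - P) \<gamma> (\<lambda>t. a))"

text \<open>Peripheral: homotopic into arbitrarily small neighbourhoods of a puncture.\<close>

definition peripheral :: "(real^3) set \<Rightarrow> (real \<Rightarrow> real^3) \<Rightarrow> bool" where
  "peripheral P \<gamma> \<longleftrightarrow> (\<exists>p\<in>P. \<forall>W. open W \<and> p \<in> W \<longrightarrow>
     (\<exists>\<delta>. path_image \<delta> \<subseteq> W \<and> homotopic_loops (S2 - P) \<gamma> \<delta>))"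

text \<open>
  The \<open>\<pi>2\<close>-image of the line through \<open>p\<close> of slope \<open>r\<close>, as a loop.  The direction vector is
  primitive in the lattice \<open>Z2\<close> and \<open>\<pi>2\<close> is invariant under translation by twice
  that lattice, so if the line avoids \<open>Z2\<close>, one period is twice the direction vector.
\<close>

definition line_loop :: "(real^2 \<Rightarrow> real^3) \<Rightarrow> real^2 \<Rightarrow> slope \<Rightarrow> real \<Rightarrow> real^3" where
  "line_loop \<pi>2 p r = (\<lambda>t. \<pi>2 (p + (2 * t) *\<^sub>R slope_dir r))"

definition has_slope ::
  "(real^3) set \<Rightarrow> (real^2 \<Rightarrow> real^3) \<Rightarrow> (real \<Rightarrow> real^3) \<Rightarrow> slope \<Rightarrow> bool" where
  "has_slope P \<pi>2 \<gamma> r \<longleftrightarrow> simple_closed_curve_in (S2 - P) \<gamma> \<and>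
     (\<exists>p. line_through p r \<inter> Z2 = {} \<and> unoriented_homotopic (S2 - P) \<gamma> (line_loop \<pi>2 p r))"

definition pullback_slope ::
  "(real^3 \<Rightarrow> real^3) \<Rightarrow> (real^2 \<Rightarrow> real^3) \<Rightarrow> slope \<Rightarrow> slope \<Rightarrow> bool" where
  "pullback_slope f \<pi>2 r r' \<longleftrightarrow> (\<exists>\<gamma> \<delta>.
     has_slope (postcritical_set f) \<pi>2 \<gamma> r \<and>
     simple_closed_curve_in (S2 - postcritical_set f) \<delta> \<and>
     path_image \<delta> \<in> components {x\<in>S2. f x \<in> path_image \<gamma>} \<and>
     essential (postcritical_set f) \<delta> \<and> \<not> peripheral (postcritical_set f) \<delta> \<and>
     has_slope (postcritical_set f) \<pi>2 \<delta> r')"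

text \<open>
  The value \<open>None\<close> plays the role of the symbol for ``not a slope''.  Every
  essential nonperipheral curve has exactly one slope, so the slope \<open>r'\<close> of an essential
  nonperipheral component exists as soon as there is such a component, and it does
  not depend on the choices of the curve and of the component.
\<close>

definition slope_function ::
  "(real^3 \<Rightarrow> real^3) \<Rightarrow> (real^2 \<Rightarrow> real^3) \<Rightarrow> slope \<Rightarrow> slope option" where
  "slope_function f \<pi>2 r =
     (if \<exists>r'. pullback_slope f \<pi>2 r r' then Some (THE r'. pullback_slope f \<pi>2 r r') else None)"

definition e1 :: "real^2" where "e1 = axis 1 1"
definition e2 :: "real^2" where "e2 = axis 2 1"

end

(* The quotient maps pi1 and pi2 are coverings away from the lattices, so curves and homotopies
   in the marked sphere lift to the punctured plane, where the displacement of a periodic lift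
   records the slope of a loop.

   If a component delta of the preimage of a curve of slope s is essential, lifting through pi1
   makes it homotopic to the pi1-image of a straight segment of slope s.  For two such segments
   the lifts through pi2 are periodic curves in the plane.  If their displacements were not
   parallel, the curves would meet (Brouwer), and by uniqueness of lifts they would then be
   reparametrizations of each other.  Hence the pulled back slope is unique, and since the
   homeomorphisms induced by Psi carry preimages of curves to preimages of curves, the slope
   function is equivariant: the linear part Q of the lift of the isotoped homeomorphism takes
   mu(s) to mu(s') and mu(t) to mu(t').  Two slopes determine Q up to the signs of the images of
   two primitive vectors, and the determinant leaves only a common sign.

   The determinants of Psi and of the lift agree because the isotopy lifts to the punctured plane
   through injective maps, so that winding numbers of images of small circles do not change. *)
theory Submission
  imports Defs
begin

section \<open>The quotient maps as coverings away from the lattices\<close>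

text \<open>The maps \<open>\<pi>1\<close>, \<open>\<pi>2\<close> and the isotopy are only
  topological, so neither slopes nor orientations can be read off from derivatives; both are read
  off from lifts to the plane. Since \<open>f \<circ> \<pi>1 = \<pi>2\<close>, the map
  \<open>f\<close> lifts to the identity of the plane, and the obstacle is that one affine map acts
  through \<open>\<pi>1\<close> and the other through \<open>\<pi>2\<close>. For slopes the two are
  compared by lifting the \<open>\<pi>1\<close>-image of a line through \<open>\<pi>2\<close>; for
  orientations by lifting a small disc in the same way. The winding number of such a disc need not
  be computed: it suffices that it is nonzero and does not change when the disc is moved. The
  translation term needs no lifted homotopy. An isotopy rel the marked points does not move
  \<open>\<psi>' (\<pi>2 0)\<close>, which is \<open>\<pi>2\<close> of the translation term, and on
  the lattice the fibres of \<open>\<pi>2\<close> are the classes modulo twice the lattice.\<close>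

lemma Z2_diff: "x \<in> Z2 \<Longrightarrow> y \<in> Z2 \<Longrightarrow> x - y \<in> Z2"
  and Z2_add: "x \<in> Z2 \<Longrightarrow> y \<in> Z2 \<Longrightarrow> x + y \<in> Z2"
  and Z2_minus: "x \<in> Z2 \<Longrightarrow> - x \<in> Z2"
  and Z2_zero: "0 \<in> Z2"
  by (auto simp: Z2_def)

lemma Z2_scaleR_int: "x \<in> Z2 \<Longrightarrow> c \<in> \<int> \<Longrightarrow> c *\<^sub>R x \<in> Z2"
  by (auto simp: Z2_def)

lemma Z2_norm_less_1:
  assumes "x \<in> Z2" "norm x < 1"
  shows "x = 0"
proof -
  have "x $ i = 0" for i
  proof -
    have "\<bar>x $ i\<bar> < 1" using component_le_norm_cart[of x i] assms(2) by linarith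
    moreover have "x $ i \<in> \<int>" using assms(1) by (auto simp: Z2_def)
    ultimately show ?thesis using Ints_nonzero_abs_less1 by blast
  qed
  then show ?thesis by (simp add: vec_eq_iff)
qed

lemma closed_subset_Z2:
  assumes "L \<subseteq> Z2"
  shows "closed L"
proof (rule discrete_imp_closed[of 1])
  show "\<forall>x\<in>L. \<forall>y\<in>L. dist y x < 1 \<longrightarrow> y = x"
    using assms Z2_diff Z2_norm_less_1 by (metis dist_norm right_minus_eq subsetD)
qed simp

lemma countable_Z2: "countable Z2"
proof -
  have "Z2 \<subseteq> (\<lambda>(a, b). vector [of_int a, of_int b]) ` (UNIV :: (int \<times> int) set)"
  proof
    fix x :: "real^2"
    assume "x \<in> Z2"
    then have "x $ 1 \<in> \<int>" "x $ 2 \<in> \<int>" by (auto simp: Z2_def)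
    then obtain a b where "x $ 1 = of_int a" "x $ 2 = of_int b" by (auto elim!: Ints_cases)
    then have "x = vector [of_int a, of_int b]" by (simp add: vec_eq_iff forall_2)
    then show "x \<in> (\<lambda>(a, b). vector [of_int a, of_int b]) ` (UNIV :: (int \<times> int) set)"
      by (intro image_eqI[of _ _ "(a, b)"]) auto
  qed
  then show ?thesis by (rule countable_subset) auto
qed

lemma lattice_in_plane_diff:
  assumes "lattice_in_plane L" "x \<in> L" "y \<in> L"
  shows "x - y \<in> L"
proof -
  obtain u v where L: "L = {of_int a *\<^sub>R u + of_int b *\<^sub>R v | a b :: int. True}"
    using assms(1) by (auto simp: lattice_in_plane_def)
  obtain a b c d where "x = of_int a *\<^sub>R u + of_int b *\<^sub>R v" "y = of_int c *\<^sub>R u + of_int d *\<^sub>R v"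
    using assms L by auto
  then have "x - y = of_int (a - c) *\<^sub>R u + of_int (b - d) *\<^sub>R v"
    by (simp add: algebra_simps)
  then show ?thesis using L by blast
qed

lemma lattice_in_plane_zero:
  assumes "lattice_in_plane L"
  shows "0 \<in> L"
proof -
  obtain u v where L: "L = {of_int a *\<^sub>R u + of_int b *\<^sub>R v | a b :: int. True}"
    using assms(1) by (auto simp: lattice_in_plane_def)
  have "0 = of_int 0 *\<^sub>R u + of_int 0 *\<^sub>R v" by simp
  then show ?thesis unfolding L by blast
qed

text \<open>The fibres are the orbits of the translations by \<open>2 *\<^sub>R l\<close> and of the
  half turns about the points of \<open>L\<close>, so the sphere appears as a pillowcase whose cone
  points are the images of \<open>L\<close>. The inclusion in \<open>Z2\<close> gives nonzero
  elements of \<open>L\<close> norm at least 1, which is the source of the numerical radii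
  below.\<close>

locale orbifold_cover =
  fixes L :: "(real^2) set" and p :: "real^2 \<Rightarrow> real^3"
  assumes L_zero: "0 \<in> L"
    and L_diff: "x \<in> L \<Longrightarrow> y \<in> L \<Longrightarrow> x - y \<in> L"
    and L_Z2: "L \<subseteq> Z2"
    and continuous: "continuous_on UNIV p"
    and surj: "range p = S2"
    and eq_iff: "p x = p y \<longleftrightarrow> (\<exists>l\<in>L. y = 2 *\<^sub>R l + x \<or> y = 2 *\<^sub>R l - x)"
begin

lemma L_minus: "x \<in> L \<Longrightarrow> - x \<in> L"
  using L_diff[OF L_zero] by simp

lemma L_add: "x \<in> L \<Longrightarrow> y \<in> L \<Longrightarrow> x + y \<in> L"
  using L_diff[of x "- y"] L_minus by simp

lemma image_L_iff: "p x \<in> p ` L \<longleftrightarrow> x \<in> L"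
proof
  assume "p x \<in> p ` L"
  then obtain y where "y \<in> L" "p y = p x" by auto
  then obtain l where l: "l \<in> L" "x = 2 *\<^sub>R l + y \<or> x = 2 *\<^sub>R l - y"
    using eq_iff by auto
  then have "x = l + (l + y) \<or> x = l + (l - y)" by (simp add: scaleR_2)
  then show "x \<in> L" using l(1) \<open>y \<in> L\<close> L_add L_diff by blast
qed auto

lemma translate: "l \<in> L \<Longrightarrow> p (x + 2 *\<^sub>R l) = p x"
  using eq_iff[of x "x + 2 *\<^sub>R l"] by (metis add.commute)

lemma reflect: "l \<in> L \<Longrightarrow> p (2 *\<^sub>R l - x) = p x"
  using eq_iff[of x] by metis

text \<open>Both kinds of deck transformation are written with one sign \<open>\<epsilon>\<close>,
  so that later arguments can treat translations and half turns together.\<close>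

lemma fibre_cases:
  assumes "p x = p y"
  obtains \<epsilon> l where "l \<in> L" "\<epsilon> = 1 \<or> \<epsilon> = - 1" "y = \<epsilon> *\<^sub>R x + 2 *\<^sub>R l"
proof -
  obtain l where "l \<in> L" "y = 2 *\<^sub>R l + x \<or> y = 2 *\<^sub>R l - x"
    using assms eq_iff by auto
  then show ?thesis using that[of l 1] that[of l "-1"] by (auto simp: add.commute)
qed

lemma same_deck:
  assumes "l \<in> L" "\<epsilon> = 1 \<or> \<epsilon> = - 1"
  shows "p (\<epsilon> *\<^sub>R x + 2 *\<^sub>R l) = p x"
  using assms translate[of l x] reflect[of l x] by (auto simp: add.commute)

lemma locally_injective:
  assumes "x \<notin> L"
  obtains r where "r > 0" "inj_on p (ball x r)"
proof -
  have "open (- L)" using closed_subset_Z2[OF L_Z2] by blast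
  then obtain e where e: "e > 0" "ball x e \<subseteq> - L" using assms openE[of "- L" x] by blast
  \<comment> \<open>The bound \<open>1\<close> excludes translations, since
    \<open>norm (2 *\<^sub>R l) < 2\<close> forces \<open>l = 0\<close>; the bound \<open>e\<close>
    excludes half turns, whose centre \<open>l\<close> would lie within \<open>r\<close> of
    \<open>x\<close>.\<close>
  define r where "r = min e 1"
  have r: "r > 0" "r \<le> e" "r \<le> 1" using e by (auto simp: r_def)
  have "u = v" if u: "u \<in> ball x r" and v: "v \<in> ball x r" and eq: "p u = p v" for u v
  proof -
    obtain l where l: "l \<in> L" "v = 2 *\<^sub>R l + u \<or> v = 2 *\<^sub>R l - u"
      using eq eq_iff by auto
    have un: "norm (u - x) < r" "norm (v - x) < r"
      using u v by (simp_all add: dist_norm norm_minus_commute)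
    from l(2) show ?thesis
    proof
      assume "v = 2 *\<^sub>R l + u"
      then have "2 *\<^sub>R l = (v - x) - (u - x)" by simp
      then have "norm (2 *\<^sub>R l) < 2 * r"
        using un norm_triangle_ineq4[of "v - x" "u - x"] by simp
      then have "norm l < 1" using r by simp
      then have "l = 0" using l(1) L_Z2 Z2_norm_less_1 by blast
      then show ?thesis using \<open>v = 2 *\<^sub>R l + u\<close> by simp
    next
      assume "v = 2 *\<^sub>R l - u"
      then have "2 *\<^sub>R (l - x) = (v - x) + (u - x)" by (simp add: scaleR_2)
      then have "norm (2 *\<^sub>R (l - x)) < 2 * r"
        using un norm_triangle_ineq[of "v - x" "u - x"] by simp
      then have "l \<in> ball x e" using r by (simp add: dist_norm norm_minus_commute)
      then show ?thesis using e l(1) by blast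
    qed
  qed
  then show ?thesis using that[of r] r by (auto simp: inj_on_def)
qed

text \<open>The half turn about \<open>l\<close> swaps \<open>l + h\<close> and
  \<open>l - h\<close>. Together with \<open>locally_injective\<close> this recognizes
  \<open>L\<close> from the local behaviour of \<open>p\<close> alone.\<close>

lemma not_locally_injective:
  assumes "l \<in> L" "open U" "l \<in> U"
  shows "\<not> inj_on p U"
proof
  assume inj: "inj_on p U"
  obtain e where e: "e > 0" "cball l e \<subseteq> U" using assms open_contains_cball by blast
  define h :: "real^2" where "h = e *\<^sub>R e1"
  have h: "norm h = e" using e by (simp add: h_def e1_def)
  have "l + h \<in> U" "l - h \<in> U" using e h by (auto simp: dist_norm)
  moreover have "p (l + h) = p (l - h)"
    using reflect[OF assms(1), of "l - h"] by (simp add: scaleR_2 algebra_simps)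
  ultimately have "l + h = l - h" using inj by (auto simp: inj_on_def)
  then have "2 *\<^sub>R h = 0" by (simp add: scaleR_2)
  then show False using h e by auto
qed

text \<open>In charts \<open>p\<close> is a power map of degree \<open>d\<close>. Over a point
  outside the image of \<open>L\<close> every chart is centred at a point outside \<open>L\<close>,
  where \<open>p\<close> is locally injective, and this forces \<open>d = 1\<close> on each
  sheet.\<close>

lemma covering_if_branched:
  assumes obc: "oriented_branched_covering plane_param UNIV sphere_param S2 p"
  shows "covering_space (- L) p (S2 - p ` L)"
proof
  show "continuous_on (- L) p" using continuous continuous_on_subset by blast
  show "p ` (- L) = S2 - p ` L"
  proof (intro equalityI subsetI)
    show "y \<in> S2 - p ` L" if "y \<in> p ` (- L)" for y
      using that surj image_L_iff by (metis ComplD DiffI imageE rangeI)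
    show "y \<in> p ` (- L)" if "y \<in> S2 - p ` L" for y
    proof -
      have "y \<in> range p" using that unfolding surj by (rule DiffD1)
      then obtain x where "y = p x" by (rule rangeE)
      then show ?thesis using that image_L_iff by auto
    qed
  qed
next
  fix y assume y: "y \<in> S2 - p ` L"
  then obtain V \<psi> \<U> where V: "oriented_chart sphere_param S2 V \<psi>" "y \<in> V" "\<psi> y = 0"
    and \<U>: "pairwise disjnt \<U>" "\<Union>\<U> = {x \<in> UNIV. p x \<in> V}"
    and ch: "\<forall>U\<in>\<U>. \<exists>\<phi> d. oriented_chart plane_param UNIV U \<phi> \<and> d \<ge> (1::nat) \<and>
           (\<forall>x\<in>U. \<psi> (p x) = \<phi> x ^ d)"
  proof -
    have "y \<in> S2" using y by blast
    with obc have "\<exists>V \<psi> \<U>. oriented_chart sphere_param S2 V \<psi> \<and> y \<in> V \<and> \<psi> y = 0 \<and>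
        pairwise disjnt \<U> \<and> \<Union>\<U> = {x\<in>UNIV. p x \<in> V} \<and>
        (\<forall>U\<in>\<U>. \<exists>\<phi> d. oriented_chart plane_param UNIV U \<phi> \<and> d \<ge> (1::nat) \<and>
           (\<forall>x\<in>U. \<psi> (p x) = \<phi> x ^ d))"
      unfolding oriented_branched_covering_def by (elim conjE) (drule (1) bspec)
    then show ?thesis by (elim exE conjE) (rule that)
  qed
  obtain \<psi>' where \<psi>: "homeomorphism V (ball 0 1) \<psi> \<psi>'" and oV: "openin (top_of_set S2) V"
    using V(1) unfolding oriented_chart_def by (elim conjE exE) (rule that)
  have inj\<psi>: "u = v" if "u \<in> V" "v \<in> V" "\<psi> u = \<psi> v" for u v
    using homeomorphism_apply1[OF \<psi>] that by metis
  have main: "open U \<and> (\<exists>q. homeomorphism U V p q)" if U: "U \<in> \<U>" for U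
  proof -
    obtain \<phi> d where \<phi>: "oriented_chart plane_param UNIV U \<phi>" and d: "d \<ge> (1::nat)"
      and eq: "\<And>x. x \<in> U \<Longrightarrow> \<psi> (p x) = \<phi> x ^ d"
      using bspec[OF ch U] by blast
    obtain \<phi>' where \<phi>': "homeomorphism U (ball 0 1) \<phi> \<phi>'" and oU: "open U"
      using \<phi> unfolding oriented_chart_def by (auto elim!: conjE exE)
    have pU: "p x \<in> V" if "x \<in> U" for x using \<U>(2) U that by blast
    have inU: "\<phi>' z \<in> U" "\<phi> (\<phi>' z) = z" if "norm z < 1" for z
      using \<phi>' that by (auto simp: homeomorphism_def)
    define x0 where "x0 = \<phi>' 0"
    have x0: "x0 \<in> U" "\<phi> x0 = 0" using inU[of 0] by (auto simp: x0_def)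
    have "p x0 = y"
      using inj\<psi>[OF pU[OF x0(1)] V(2)] eq[OF x0(1)] x0(2) V(3) d by (simp add: power_0_left)
    then have "x0 \<notin> L" using y by auto
    then obtain r where r: "r > 0" "inj_on p (ball x0 r)" by (rule locally_injective)
    have "isCont \<phi>' 0"
      using \<phi>' by (simp add: homeomorphism_def continuous_on_eq_continuous_at)
    then obtain s where s: "s > 0" "\<And>z. norm z < s \<Longrightarrow> \<phi>' z \<in> ball x0 r"
      using r(1) unfolding continuous_at_eps_delta x0_def
      by (auto simp: dist_norm norm_minus_commute)
    \<comment> \<open>For \<open>d \<ge> 2\<close> the points with chart values \<open>t\<close> and \<open>t\<close> times a root of unity collide.\<close>
    have "d = 1"
    proof (rule ccontr)
      assume "d \<noteq> 1"
      then have d2: "d \<ge> 2" using d by simp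
      define w where "w = cis (2 * pi / d)"
      have w: "w ^ d = 1" "norm w = 1" using d by (auto simp: w_def Complex.DeMoivre)
      have "w \<noteq> 1"
      proof
        assume "w = 1"
        then have "cos (2 * pi / d) = 1" unfolding w_def by (simp add: complex_eq_iff)
        then obtain k :: int where "2 * pi / d = of_int k * 2 * pi" 
          using cos_one_2pi_int by auto
        then have "1 = of_int k * real d" using d by (simp add: field_simps)
        then have "1 = k * int d" by (metis of_int_1 of_int_eq_iff of_int_mult of_int_of_nat_eq)
        then have "int d dvd 1" by (metis dvd_triv_right)
        then show False using d2 by simp
      qed
      \<comment> \<open>Nonzero, inside the unit disc on which \<open>\<phi>'\<close> is defined,
        and so small that \<open>\<phi>'\<close> stays in the ball where \<open>p\<close> is
        injective; \<open>t * w\<close> has the same modulus.\<close>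
      define t :: complex where "t = of_real (min s 1 / 2)"
      have t: "norm t < s" "norm t < 1" "t \<noteq> 0" using s by (auto simp: t_def)
      have tw: "norm (t * w) < s" "norm (t * w) < 1" using t w by (simp_all add: norm_mult)
      have "\<psi> (p (\<phi>' t)) = \<psi> (p (\<phi>' (t * w)))"
        using eq inU t tw w by (simp add: power_mult_distrib)
      then have "p (\<phi>' t) = p (\<phi>' (t * w))"
        by (rule inj\<psi>[OF pU[OF inU(1)[OF t(2)]] pU[OF inU(1)[OF tw(2)]]])
      then have "\<phi>' t = \<phi>' (t * w)"
        by (rule inj_onD[OF r(2) _ s(2)[OF t(1)] s(2)[OF tw(1)]])
      then have "t = t * w" using inU(2)[OF t(2)] inU(2)[OF tw(2)] by simp
      then show False using t \<open>w \<noteq> 1\<close> by simp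
    qed
    then have eq1: "\<psi> (p x) = \<phi> x" if "x \<in> U" for x using eq that by simp
    have peq: "p x = (\<psi>' \<circ> \<phi>) x" if "x \<in> U" for x
      using eq1[OF that] homeomorphism_apply1[OF \<psi> pU[OF that]] by simp
    have "homeomorphism U V p (\<phi>' \<circ> \<psi>)"
      using homeomorphism_compose[OF \<phi>' homeomorphism_symD[OF \<psi>]] refl refl peq refl
      by (rule homeomorphism_cong)
    then show ?thesis using oU by blast
  qed
  \<comment> \<open>A point of \<open>L\<close> over \<open>V\<close> would lie in an open sheet on
    which \<open>p\<close> is injective.\<close>
  have VL: "V \<subseteq> S2 - p ` L"
  proof
    fix z assume z: "z \<in> V"
    have "z \<notin> p ` L"
    proof
      assume "z \<in> p ` L"
      then obtain l where l: "l \<in> L" "p l = z" by auto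
      then obtain U where U: "U \<in> \<U>" "l \<in> U" using \<U>(2) z by blast
      obtain q where "open U" "homeomorphism U V p q" using main[OF U(1)] by blast
      then show False
        using not_locally_injective[OF l(1) _ U(2)] homeomorphism_apply1 by (metis inj_on_inverseI)
    qed
    then show "z \<in> S2 - p ` L" using z oV openin_imp_subset by blast
  qed
  show "\<exists>T. y \<in> T \<and> openin (top_of_set (S2 - p ` L)) T \<and>
            (\<exists>v. \<Union>v = - L \<inter> p -` T \<and> (\<forall>u\<in>v. openin (top_of_set (- L)) u) \<and>
                 pairwise disjnt v \<and> (\<forall>u\<in>v. \<exists>q. homeomorphism u T p q))"
  proof (intro exI[of _ V] exI[of _ \<U>] conjI ballI)
    show "openin (top_of_set (S2 - p ` L)) V"
      using oV VL openin_subset_trans by blast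
    show UL: "\<Union>\<U> = - L \<inter> p -` V" using \<U>(2) VL image_L_iff by auto
    show "openin (top_of_set (- L)) u" if "u \<in> \<U>" for u
      using main[OF that] UL that by (intro open_subset) auto
    show "\<exists>q. homeomorphism u V p q" if "u \<in> \<U>" for u
      using main[OF that] by blast
  qed (fact V(2) \<U>(1))+
qed

end

locale orbifold_covering = orbifold_cover +
  assumes covering: "covering_space (- L) p (S2 - p ` L)"

lemma orbifold_coveringI:
  assumes "lattice_in_plane L" "L \<subseteq> Z2"
    and "oriented_branched_covering plane_param UNIV sphere_param S2 p"
    and "normal_covering p" "deck_group p = Gamma L"
  shows "orbifold_covering L p"
proof -
  interpret orbifold_cover L p
  proof
    show "0 \<in> L" using assms(1) lattice_in_plane_zero by blast
    show "x - y \<in> L" if "x \<in> L" "y \<in> L" for x y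
      using assms(1) that lattice_in_plane_diff by blast
    show "continuous_on UNIV p" "range p = S2"
      using assms(3) by (auto simp: oriented_branched_covering_def)
    show "p x = p y \<longleftrightarrow> (\<exists>l\<in>L. y = 2 *\<^sub>R l + x \<or> y = 2 *\<^sub>R l - x)" for x y
    proof
      assume "p x = p y"
      then obtain g where "g \<in> Gamma L" "g x = y"
        using assms(4,5) unfolding normal_covering_def by blast
      then show "\<exists>l\<in>L. y = 2 *\<^sub>R l + x \<or> y = 2 *\<^sub>R l - x" by (auto simp: Gamma_def)
    next
      assume "\<exists>l\<in>L. y = 2 *\<^sub>R l + x \<or> y = 2 *\<^sub>R l - x"
      then obtain g where "g \<in> Gamma L" "g x = y" unfolding Gamma_def by blast
      then have "p \<circ> g = p" using assms(5) by (auto simp: deck_group_def)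
      then show "p x = p y" using \<open>g x = y\<close> by (metis comp_apply)
    qed
  qed (fact assms(2))
  show ?thesis using covering_if_branched[OF assms(3)] by unfold_locales
qed

section \<open>Lifting homotopies of loops\<close>

lemma Arg2pi_cis_frac: "Arg2pi (cis (2 * pi * t)) / (2 * pi) = frac t"
proof -
  have t: "t = frac t + of_int \<lfloor>t\<rfloor>" by (simp add: frac_def)
  have "cis (2 * pi * t) = cis (2 * pi * frac t) * cis (2 * pi * of_int \<lfloor>t\<rfloor>)"
    by (subst t) (simp add: cis_mult algebra_simps del: t)
  also have "cis (2 * pi * of_int \<lfloor>t\<rfloor>) = 1" by (rule cis_multiple_2pi) simp
  finally have "cis (2 * pi * t) = exp (\<i> * of_real (2 * pi * frac t))"
    by (simp add: cis_conv_exp)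
  moreover have "2 * pi * frac t < 2 * pi" using frac_lt_1[of t] by simp
  ultimately have "Arg2pi (cis (2 * pi * t)) = 2 * pi * frac t"
    by (intro Arg2pi_unique[of 1]) auto
  then show ?thesis by simp
qed

text \<open>A homotopy of loops factors through the circle; composing with \<open>cis\<close>
  unrolls it to the whole real line, so that a lift can be compared at \<open>t\<close> and
  \<open>t + 1\<close>.\<close>

lemma homotopic_loops_periodic:
  assumes "homotopic_loops S \<alpha> \<beta>"
  obtains h :: "real \<times> real \<Rightarrow> 'a::topological_space"
  where "continuous_on ({0..1} \<times> UNIV) h" "h \<in> {0..1} \<times> UNIV \<rightarrow> S"
    "\<And>t. h (0, t) = \<alpha> (frac t)" "\<And>t. h (1, t) = \<beta> (frac t)" "\<And>u t. h (u, t + 1) = h (u, t)"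
proof -
  obtain H :: "real \<times> complex \<Rightarrow> 'a" where H: "continuous_on ({0..1} \<times> sphere 0 1) H"
    "H \<in> {0..1} \<times> sphere 0 1 \<rightarrow> S"
    and H01: "\<And>z. H (0, z) = \<alpha> (Arg2pi z / (2 * pi))" "\<And>z. H (1, z) = \<beta> (Arg2pi z / (2 * pi))"
    using homotopic_loops_imp_homotopic_circlemaps[OF assms]
    unfolding homotopic_with_def by (auto simp: Pi_iff)
  define h where "h = (\<lambda>(u, t). H (u, cis (2 * pi * t)))"
  have "continuous_on ({0..1} \<times> UNIV) h"
    unfolding h_def case_prod_unfold
    by (intro continuous_on_compose2[OF H(1)] continuous_intros) auto
  moreover have "h \<in> {0..1} \<times> UNIV \<rightarrow> S" using H(2) by (auto simp: h_def Pi_iff)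
  moreover have "cis (2 * pi * (t + 1)) = cis (2 * pi * t)" for t
    by (simp add: distrib_left cis_mult[symmetric] cis_multiple_2pi)
  ultimately show ?thesis using that[of h] by (simp add: h_def H01 Arg2pi_cis_frac)
qed

text \<open>The inverse \<open>g\<close> assigns a phase continuously to the points of a simple
  closed curve. A continuous injection of a compact space into a Hausdorff space is a homeomorphism
  onto its image.\<close>

lemma loop_circle_homeomorphism:
  fixes \<gamma> :: "real \<Rightarrow> 'a::t2_space"
  assumes "simple_path \<gamma>" "pathfinish \<gamma> = pathstart \<gamma>"
  obtains g where "homeomorphism (sphere 0 1) (path_image \<gamma>) (\<lambda>z. \<gamma> (Arg2pi z / (2 * pi))) g"
proof -
  let ?c = "\<lambda>z. \<gamma> (Arg2pi z / (2 * pi))"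
  have A: "0 \<le> Arg2pi z / (2 * pi)" "Arg2pi z / (2 * pi) < 1" for z
    using Arg2pi[of z] by simp_all
  \<comment> \<open>The constant homotopy serves to get continuity of the circle map, which is an
    end of a homotopy of circle maps.\<close>
  have "homotopic_loops (path_image \<gamma>) \<gamma> \<gamma>"
    by (simp add: assms homotopic_loops_refl simple_path_imp_path)
  then have "continuous_on (sphere 0 1) ?c"
    using homotopic_loops_imp_homotopic_circlemaps homotopic_with_imp_continuous
    unfolding o_def by blast
  moreover have "?c ` sphere 0 1 = path_image \<gamma>"
  proof
    show "?c ` sphere 0 1 \<subseteq> path_image \<gamma>"
      using A by (force simp: path_image_def intro: less_imp_le)
    have "\<gamma> t \<in> ?c ` sphere 0 1" if t: "0 \<le> t" "t \<le> 1" for t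
    proof -
      have "\<gamma> t = \<gamma> (frac t)"
      proof (cases "t = 1")
        case True
        then show ?thesis using assms(2) by (simp add: pathfinish_def pathstart_def)
      next
        case False
        then show ?thesis using t by simp
      qed
      then show ?thesis by (intro image_eqI[of _ _ "cis (2 * pi * t)"]) (auto simp: Arg2pi_cis_frac)
    qed
    then show "path_image \<gamma> \<subseteq> ?c ` sphere 0 1" by (auto simp: path_image_def)
  qed
  moreover have "inj_on ?c (sphere 0 1)"
  proof
    fix w z :: complex
    assume w: "w \<in> sphere 0 1" and z: "z \<in> sphere 0 1" and eq: "?c w = ?c z"
    define a b where "a = Arg2pi w / (2 * pi)" and "b = Arg2pi z / (2 * pi)"
    have ab: "0 \<le> a" "a < 1" "0 \<le> b" "b < 1" using A unfolding a_def b_def by blast+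
    have "\<gamma> a = \<gamma> b" using eq by (simp add: a_def b_def)
    moreover have "loop_free \<gamma>" using assms(1) by (simp add: simple_path_def)
    moreover have "a \<in> {0..1}" "b \<in> {0..1}" using ab by auto
    ultimately have "a = b \<or> a = 0 \<and> b = 1 \<or> a = 1 \<and> b = 0"
      unfolding loop_free_def by blast
    then have "Arg2pi w / (2 * pi) = Arg2pi z / (2 * pi)" using ab by (auto simp: a_def b_def)
    then have "Arg2pi w = Arg2pi z" by simp
    then show "w = z" using w z complex_norm_eq_1_exp by (metis mem_sphere_0)
  qed
  ultimately have "\<exists>g. homeomorphism (sphere 0 1) (path_image \<gamma>) ?c g"
    by (intro homeomorphism_compact[OF compact_sphere])
  then show ?thesis by (elim exE) (rule that)
qed

context orbifold_covering
begin

lemma p_in: "x \<notin> L \<Longrightarrow> p x \<in> S2 - p ` L"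
  using surj image_L_iff by (metis DiffI rangeI)

lemma lift_unique:
  fixes g h :: "'c::topological_space \<Rightarrow> real^2"
  assumes "connected T" "a \<in> T" "x \<in> T" "g a = h a"
    and "continuous_on T g" "\<And>t. t \<in> T \<Longrightarrow> g t \<notin> L"
    and "continuous_on T h" "\<And>t. t \<in> T \<Longrightarrow> h t \<notin> L"
    and "\<And>t. t \<in> T \<Longrightarrow> p (g t) = p (h t)"
  shows "g x = h x"
proof (rule covering_space_lift_unique[OF covering, where f = "p \<circ> g" and T = T and a = a])
  show "continuous_on T (p \<circ> g)"
    by (intro continuous_on_compose assms(5) continuous_on_subset[OF continuous]) auto
  show "p \<circ> g \<in> T \<rightarrow> S2 - p ` L" using assms(6) p_in by (metis Pi_I comp_apply)
qed (use assms in auto)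

text \<open>For fixed \<open>t\<close>, the paths \<open>K (u, t + 1)\<close> and
  \<open>K (u, t) + 2 *\<^sub>R w\<close> in \<open>u\<close> lie over the same path, because the
  translation is a deck transformation, and they agree at \<open>u = 0\<close>. Thus the
  displacement over one period survives the homotopy.\<close>

lemma lift_homotopic_loops:
  assumes hl: "homotopic_loops (S2 - p ` L) \<alpha> \<beta>"
    and k: "continuous_on UNIV k" "\<And>t. k t \<notin> L" "\<And>t. p (k t) = \<alpha> (frac t)"
    and per: "\<And>t. k (t + 1) = k t + 2 *\<^sub>R w" and w: "w \<in> L"
  obtains K :: "real \<times> real \<Rightarrow> real^2"
  where "continuous_on ({0..1} \<times> UNIV) K" "\<And>u t. u \<in> {0..1} \<Longrightarrow> K (u, t) \<notin> L"
    "\<And>t. K (0, t) = k t" "\<And>u t. u \<in> {0..1} \<Longrightarrow> K (u, t + 1) = K (u, t) + 2 *\<^sub>R w"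
    "\<And>t. p (K (1, t)) = \<beta> (frac t)"
proof -
  obtain h :: "real \<times> real \<Rightarrow> real^3"
    where h: "continuous_on ({0..1} \<times> UNIV) h" "h \<in> {0..1} \<times> UNIV \<rightarrow> S2 - p ` L"
    "\<And>t. h (0, t) = \<alpha> (frac t)" "\<And>t. h (1, t) = \<beta> (frac t)" and hper: "\<And>u t. h (u, t + 1) = h (u, t)"
    using homotopic_loops_periodic[OF hl] by metis
  obtain K where K: "continuous_on ({0..1} \<times> UNIV) K" "K \<in> {0..1} \<times> UNIV \<rightarrow> - L"
    "\<And>y. K (0, y) = k y" "\<And>z. z \<in> {0..1} \<times> UNIV \<Longrightarrow> h z = p (K z)"
    using covering_space_lift_homotopy[OF covering h(1,2), of k] h(3) k by auto
  have KL: "K (u, t) \<notin> L" if "u \<in> {0..1}" for u t using K(2) that by (auto simp: Pi_iff)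
  have "K (u, t + 1) = K (u, t) + 2 *\<^sub>R w" if u: "u \<in> {0..1}" for u t
  proof (rule lift_unique[where T = "{0..1}" and a = 0 and g = "\<lambda>u. K (u, t + 1)"
        and h = "\<lambda>u. K (u, t) + 2 *\<^sub>R w"])
    show "continuous_on {0..1} (\<lambda>u. K (u, t + 1))" "continuous_on {0..1} (\<lambda>u. K (u, t) + 2 *\<^sub>R w)"
      by (intro continuous_intros continuous_on_compose2[OF K(1)]; auto)+
    show "p (K (u, t + 1)) = p (K (u, t) + 2 *\<^sub>R w)" if "u \<in> {0..1}" for u
      using K(4)[of "(u, t + 1)"] K(4)[of "(u, t)"] that translate[OF w] hper by simp
    show "K (u, t) + 2 *\<^sub>R w \<notin> L" if "u \<in> {0..1}" for u
      using KL[OF that] translate[OF w] image_L_iff by metis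
  qed (use K(3) per KL u in auto)
  then show ?thesis using that[of K] K KL h(4) by auto
qed

end

section \<open>Periodic curves in the plane and their crossings\<close>

lemma periodic_add_int:
  fixes k :: "real \<Rightarrow> 'a::real_vector"
  assumes "\<And>t. k (t + 1) = k t + w"
  shows "k (t + of_int n) = k t + of_int n *\<^sub>R w"
proof (induction n rule: int_induct[of _ 0])
  case (step1 i)
  then show ?case using assms[of "t + of_int i"] by (simp add: algebra_simps)
next
  case (step2 i)
  then show ?case using assms[of "t + of_int i - 1"] by (simp add: algebra_simps)
qed simp

definition det2 :: "real^2 \<Rightarrow> real^2 \<Rightarrow> real" where
  "det2 v w = v $ 1 * w $ 2 - v $ 2 * w $ 1"

lemma periodic_bounded:
  fixes k :: "real \<Rightarrow> real^2"
  assumes "continuous_on UNIV k" "\<And>t. k (t + 1) = k t + w"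
  obtains M where "\<And>t. norm (k t - t *\<^sub>R w) \<le> M"
proof -
  let ?b = "\<lambda>t. k t - t *\<^sub>R w"
  have "compact (?b ` {0..1})"
    by (intro compact_continuous_image continuous_intros continuous_on_subset[OF assms(1)]) auto
  then obtain M where M: "\<And>t. t \<in> {0..1} \<Longrightarrow> norm (?b t) \<le> M"
    using compact_imp_bounded bounded_iff by (metis (no_types, lifting) imageI)
  have "norm (?b t) \<le> M" for t
  proof -
    have "k t = k (frac t) + of_int \<lfloor>t\<rfloor> *\<^sub>R w"
      using periodic_add_int[of k w "frac t" "\<lfloor>t\<rfloor>", OF assms(2)] by (simp add: frac_def)
    then have "?b t = ?b (frac t)" by (simp add: frac_def algebra_simps)
    moreover have "frac t \<in> {0..1}" using frac_lt_1[of t] by auto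
    ultimately show ?thesis using M[of "frac t"] by simp
  qed
  then show ?thesis using that by blast
qed

text \<open>
  By Cramer's rule, a common point of the two curves is a fixed point of a bounded
  continuous self-map of the plane of parameters.
\<close>

lemma periodic_curves_meet:
  fixes k1 k2 :: "real \<Rightarrow> real^2"
  assumes k1: "continuous_on UNIV k1" "\<And>t. k1 (t + 1) = k1 t + w1"
    and k2: "continuous_on UNIV k2" "\<And>t. k2 (t + 1) = k2 t + w2"
    and D: "det2 w1 w2 \<noteq> 0"
  obtains t1 t2 where "k1 t1 = k2 t2"
proof -
  obtain M1 where M1: "\<And>t. norm (k1 t - t *\<^sub>R w1) \<le> M1" using periodic_bounded[OF k1] by blast
  obtain M2 where M2: "\<And>t. norm (k2 t - t *\<^sub>R w2) \<le> M2" using periodic_bounded[OF k2] by blast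
  \<comment> \<open>The equation \<open>k1 (x $ 1) = k2 (x $ 2)\<close> amounts to
    \<open>x $ 1 *\<^sub>R w1 - x $ 2 *\<^sub>R w2 = c x\<close>, and \<open>c\<close> is bounded
    because the linear drifts are removed.\<close>
  define c where "c = (\<lambda>x :: real^2. (k2 (x $ 2) - x $ 2 *\<^sub>R w2) - (k1 (x $ 1) - x $ 1 *\<^sub>R w1))"
  \<comment> \<open>The coordinates of \<open>v\<close> with respect to the basis \<open>w1\<close>,
    \<open>- w2\<close>.\<close>
  define \<Phi> :: "real^2 \<Rightarrow> real^2" where
    "\<Phi> = (\<lambda>v. vector [det2 v w2 / det2 w1 w2, det2 v w1 / det2 w1 w2])"
  have "linear \<Phi>"
    by (rule linearI)
      (simp_all add: \<Phi>_def det2_def vec_eq_iff forall_2 algebra_simps diff_divide_distrib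
        add_divide_distrib)
  then obtain B where B: "B > 0" "\<And>v. norm (\<Phi> v) \<le> B * norm v"
    using linear_bounded_pos by blast
  have cb: "norm (c x) \<le> M1 + M2" for x
    using norm_triangle_ineq4 M1 M2 unfolding c_def by (smt (verit, best))
  have "continuous_on UNIV c"
    unfolding c_def
    by (intro continuous_intros continuous_on_compose2[OF k1(1)] continuous_on_compose2[OF k2(1)]) auto
  then have cont: "continuous_on UNIV (\<lambda>x. \<Phi> (c x))"
    using linear_continuous_on[of \<Phi>] \<open>linear \<Phi>\<close> continuous_on_compose2 linear_conv_bounded_linear
    by (metis subset_UNIV)
  define R where "R = B * (\<bar>M1\<bar> + \<bar>M2\<bar>) + 1"
  have R: "R > 0" using B by (simp add: R_def add_nonneg_pos)
  have "norm (\<Phi> (c x)) \<le> R" for x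
  proof -
    have "norm (\<Phi> (c x)) \<le> B * norm (c x)" by (rule B)
    also have "\<dots> \<le> B * (\<bar>M1\<bar> + \<bar>M2\<bar>)" using cb[of x] B by (intro mult_left_mono) auto
    finally show ?thesis by (simp add: R_def)
  qed
  then have "(\<lambda>x. \<Phi> (c x)) \<in> cball 0 R \<rightarrow> cball 0 R" by auto
  then obtain x where x: "\<Phi> (c x) = x"
    using brouwer_ball[OF R continuous_on_subset[OF cont subset_UNIV]] by blast
  have "x $ 1 = det2 (c x) w2 / det2 w1 w2" "x $ 2 = det2 (c x) w1 / det2 w1 w2"
    using x by (auto simp: \<Phi>_def vec_eq_iff forall_2)
  then have "x $ 1 * det2 w1 w2 = det2 (c x) w2" "x $ 2 * det2 w1 w2 = det2 (c x) w1"
    using D by auto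
  then have "det2 w1 w2 *\<^sub>R (x $ 1 *\<^sub>R w1 - x $ 2 *\<^sub>R w2) = det2 w1 w2 *\<^sub>R c x"
    unfolding vec_eq_iff forall_2 det2_def by (simp; algebra)
  then have "x $ 1 *\<^sub>R w1 - x $ 2 *\<^sub>R w2 = c x" using D by simp
  then have "k1 (x $ 1) = k2 (x $ 2)" by (simp add: c_def algebra_simps)
  then show ?thesis using that by blast
qed

section \<open>Primitive vectors and slopes\<close>

text \<open>Bezout coefficients take the place of a gcd: an integral change of basis carries them
  along, and they show at once that a lattice vector \<open>c *\<^sub>R v\<close> has integral
  \<open>c\<close>.\<close>

definition primitive :: "real^2 \<Rightarrow> bool" where
  "primitive v \<longleftrightarrow> v \<in> Z2 \<and> (\<exists>k\<in>\<int>. \<exists>l\<in>\<int>. k * v $ 1 + l * v $ 2 = 1)"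

lemma primitive_iff_coprime:
  "primitive (vector [of_int m, of_int n]) \<longleftrightarrow> coprime m n"
proof
  assume "primitive (vector [of_int m, of_int n])"
  then obtain k l :: int where "real_of_int k * of_int m + of_int l * of_int n = 1"
    by (auto simp: primitive_def elim!: Ints_cases)
  then have kl: "k * m + l * n = 1"
    by (metis (mono_tags, opaque_lifting) of_int_1 of_int_add of_int_eq_iff of_int_mult)
  show "coprime m n"
  proof (rule coprimeI)
    fix c assume "c dvd m" "c dvd n"
    then have "c dvd k * m + l * n" by simp
    then show "is_unit c" using kl by simp
  qed
next
  assume "coprime m n"
  then obtain k l where "k * m + l * n = 1" using bezout_int[of m n] by auto
  then have "of_int k * of_int m + of_int l * of_int n = (1 :: real)"
    by (metis of_int_1 of_int_add of_int_mult)
  then show "primitive (vector [of_int m, of_int n])"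
    unfolding primitive_def Z2_def
    by (intro conjI bexI[of _ "real_of_int k"] bexI[of _ "real_of_int l"]) (auto simp: forall_2)
qed

lemma primitive_uminus:
  assumes "primitive v"
  shows "primitive (- v)"
proof -
  obtain k l where "k \<in> \<int>" "l \<in> \<int>" "k * v $ 1 + l * v $ 2 = 1"
    using assms by (auto simp: primitive_def)
  then have "- k \<in> \<int>" "- l \<in> \<int>" "(- k) * (- v) $ 1 + (- l) * (- v) $ 2 = 1" by simp_all
  then show ?thesis using assms Z2_minus unfolding primitive_def by blast
qed

lemma primitive_slope_dir: "primitive (slope_dir r)"
proof (cases r)
  case (Slope q)
  obtain n d where "quotient_of q = (n, d)" by (cases "quotient_of q")
  then show ?thesis
    using Slope quotient_of_coprime[of q n d] primitive_iff_coprime[of d n]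
    by (simp add: coprime_commute)
next
  case Infinite_Slope
  then show ?thesis using primitive_iff_coprime[of 0 1] by simp
qed

lemma slope_dir_Z2: "slope_dir r \<in> Z2"
  using primitive_slope_dir by (auto simp: primitive_def)

lemma Z2_vector: "v \<in> Z2 \<longleftrightarrow> (\<exists>m n. v = vector [of_int m, of_int n])"
proof
  assume "v \<in> Z2"
  then have "v $ 1 \<in> \<int>" "v $ 2 \<in> \<int>" by (auto simp: Z2_def)
  then obtain m n where "v $ 1 = of_int m" "v $ 2 = of_int n" by (auto elim!: Ints_cases)
  then have "v = vector [of_int m, of_int n]" by (simp add: vec_eq_iff forall_2)
  then show "\<exists>m n. v = vector [of_int m, of_int n]" by blast
qed (auto simp: Z2_def forall_2)

text \<open>Of each pair \<open>v\<close>, \<open>- v\<close>, the vector \<open>slope_dir r\<close>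
  is the one with positive first coordinate, or \<open>vector [0, 1]\<close> on the vertical axis;
  \<open>\<epsilon>\<close> records which of the two is given.\<close>

lemma primitive_is_slope_dir:
  assumes "primitive v"
  obtains r \<epsilon> where "\<epsilon> = 1 \<or> \<epsilon> = - 1" "v = \<epsilon> *\<^sub>R slope_dir r"
proof -
  have pos: "\<exists>r. v = slope_dir r" if v: "primitive v" and m: "v $ 1 > 0" for v :: "real^2"
  proof -
    obtain m n where mn: "v = vector [of_int m, of_int n]"
      using v Z2_vector by (auto simp: primitive_def)
    then have "m > 0" using m by simp
    moreover have "coprime n m"
      using v mn primitive_iff_coprime by (simp add: coprime_commute)
    ultimately have "quotient_of (Fract n m) = (n, m)"
      by (simp add: quotient_of_Fract normalize_stable)
    then show ?thesis using mn by (intro exI[of _ "Slope (Fract n m)"]) simp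
  qed
  consider "v $ 1 > 0" | "v $ 1 < 0" | "v $ 1 = 0" by linarith
  then show ?thesis
  proof cases
    case 1
    then show ?thesis using pos[OF assms] that[of 1] by auto
  next
    case 2
    then obtain r where "- v = slope_dir r" using pos[OF primitive_uminus[OF assms]] by auto
    then have "v = (- 1) *\<^sub>R slope_dir r" by (metis scaleR_minus1_left minus_minus)
    then show ?thesis using that by blast
  next
    case 3
    then obtain n where n: "v = vector [of_int 0, of_int n]"
      using assms Z2_vector by (auto simp: primitive_def)
    then have "is_unit n" using assms primitive_iff_coprime[of 0 n] by simp
    then have "n = 1 \<or> n = - 1" by auto
    then have "v = of_int n *\<^sub>R slope_dir Infinite_Slope"
      by (simp add: n vec_eq_iff forall_2)
    then show ?thesis using that[of "of_int n" Infinite_Slope] \<open>n = 1 \<or> n = - 1\<close> by auto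
  qed
qed

lemma slope_dir_parallel:
  assumes "det2 (slope_dir r) (slope_dir r') = 0"
  shows "r = r'"
proof -
  have fin: "slope_dir (Slope q) $ 1 > 0"
    "q = q' \<longleftrightarrow> slope_dir (Slope q) $ 2 / slope_dir (Slope q) $ 1 =
       slope_dir (Slope q') $ 2 / slope_dir (Slope q') $ 1" for q q'
  proof -
    have *: "slope_dir (Slope q) $ 1 > 0 \<and>
        slope_dir (Slope q) $ 2 / slope_dir (Slope q) $ 1 = of_rat q" for q
    proof -
      obtain n d where nd: "quotient_of q = (n, d)" by (cases "quotient_of q")
      then have "q = of_int n / of_int d" "d > 0"
        using quotient_of_div quotient_of_denom_pos by auto
      then show ?thesis using nd by (simp add: of_rat_divide)
    qed
    show "slope_dir (Slope q) $ 1 > 0" using * by blast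
    show "q = q' \<longleftrightarrow> slope_dir (Slope q) $ 2 / slope_dir (Slope q) $ 1 =
       slope_dir (Slope q') $ 2 / slope_dir (Slope q') $ 1"
      using * by (metis of_rat_eq_iff)
  qed
  show ?thesis
  proof (cases r)
    case r: (Slope q)
    show ?thesis
    proof (cases r')
      case r': (Slope q')
      show ?thesis using assms fin(1)[of q] fin(1)[of q'] fin(2)[of q q']
        unfolding det2_def r r' by (simp add: field_simps del: slope_dir.simps)
    next
      case r': Infinite_Slope
      then show ?thesis using assms fin(1)[of q] r by (simp add: det2_def)
    qed
  next
    case r: Infinite_Slope
    show ?thesis
    proof (cases r')
      case r': (Slope q')
      then show ?thesis using assms fin(1)[of q'] r by (simp add: det2_def)
    qed (simp add: r)
  qed
qed

text \<open>The Bezout relation for \<open>v\<close> writes \<open>c\<close> as an integral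
  combination of the coordinates of \<open>u\<close>, so \<open>c\<close> is an integer; by symmetry
  so is \<open>1 / c\<close>.\<close>

lemma primitive_parallel:
  assumes u: "primitive u" and v: "primitive v" and uv: "u = c *\<^sub>R v"
  shows "c = 1 \<or> c = - 1"
proof -
  have int: "c \<in> \<int>" if u: "primitive u" and v: "primitive v" and uv: "u = c *\<^sub>R v" for u v c
  proof -
    obtain k l where kl: "k \<in> \<int>" "l \<in> \<int>" "k * v $ 1 + l * v $ 2 = 1"
      using v by (auto simp: primitive_def)
    have "c = c * (k * v $ 1 + l * v $ 2)" using kl by simp
    also have "\<dots> = k * u $ 1 + l * u $ 2" by (simp add: uv algebra_simps)
    also have "\<dots> \<in> \<int>" using u kl by (auto simp: primitive_def Z2_def)
    finally show ?thesis .
  qed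
  have "c \<noteq> 0" using u uv by (auto simp: primitive_def)
  then have "v = (1 / c) *\<^sub>R u" using uv by simp
  then have "1 / c \<in> \<int>" using int u v by blast
  moreover have "c \<in> \<int>" using int u v uv by blast
  ultimately obtain m n :: int where mn: "c = of_int m" "1 / c = of_int n" by (auto elim!: Ints_cases)
  then have "of_int m * of_int n = (1 :: real)"
    using \<open>c \<noteq> 0\<close> by (metis nonzero_mult_div_cancel_left times_divide_eq_right mult.right_neutral)
  then have "m * n = 1" by (metis of_int_1 of_int_eq_iff of_int_mult)
  then show ?thesis using mn by (auto simp: zmult_eq_1_iff)
qed

lemma integer_matrix_Z2: "integer_matrix A \<Longrightarrow> v \<in> Z2 \<Longrightarrow> A *v v \<in> Z2"
  by (auto simp: integer_matrix_def Z2_def matrix_vector_mult_def intro!: Ints_sum Ints_mult)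

lemma GL2Z_primitive:
  assumes "A \<in> GL2Z" "primitive v"
  shows "primitive (A *v v)"
proof -
  obtain B where A: "integer_matrix A" and B: "integer_matrix B" "B ** A = mat 1"
    using assms(1) by (auto simp: GL2Z_def)
  obtain k l where kl: "k \<in> \<int>" "l \<in> \<int>" "k * v $ 1 + l * v $ 2 = 1"
    using assms(2) by (auto simp: primitive_def)
  have vB: "v = B *v (A *v v)" by (simp add: matrix_vector_mul_assoc B)
  have v: "v $ i = B $ i $ 1 * (A *v v) $ 1 + B $ i $ 2 * (A *v v) $ 2" for i
    using arg_cong[OF vB, of "\<lambda>x. x $ i"] by (simp add: matrix_vector_mult_def[of B] sum_2)
  \<comment> \<open>The Bezout coefficients for \<open>A *v v\<close> are those for
    \<open>v\<close>, as a row vector, multiplied by the inverse matrix \<open>B\<close>.\<close>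
  have "(k * B $ 1 $ 1 + l * B $ 2 $ 1) * (A *v v) $ 1 + (k * B $ 1 $ 2 + l * B $ 2 $ 2) * (A *v v) $ 2
      = k * v $ 1 + l * v $ 2"
    by (subst v[of 1], subst v[of 2]) (simp add: algebra_simps)
  moreover have "k * B $ 1 $ 1 + l * B $ 2 $ 1 \<in> \<int>" "k * B $ 1 $ 2 + l * B $ 2 $ 2 \<in> \<int>"
    using kl B by (auto simp: integer_matrix_def)
  moreover have "A *v v \<in> Z2" using A assms(2) integer_matrix_Z2 by (auto simp: primitive_def)
  ultimately show ?thesis using kl(3) unfolding primitive_def by metis
qed

section \<open>Action of affine maps on slopes\<close>

lemma takes_slope_to_iff:
  "takes_slope_to (\<lambda>x. A *v x + b) r r' \<longleftrightarrow> (\<exists>c. c \<noteq> 0 \<and> A *v slope_dir r = c *\<^sub>R slope_dir r')"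
proof
  assume *: "takes_slope_to (\<lambda>x. A *v x + b) r r'"
  have nz: "slope_dir r \<noteq> 0" "slope_dir r' \<noteq> 0"
    using primitive_slope_dir[of r] primitive_slope_dir[of r'] by (auto simp: primitive_def)
  obtain p' where p': "(\<lambda>x. A *v x + b) ` line_through 0 r = line_through p' r'"
    using * unfolding takes_slope_to_def by blast
  have img: "\<And>c. \<exists>c'. A *v (c *\<^sub>R slope_dir r) + b = p' + c' *\<^sub>R slope_dir r'"
  proof -
    fix c
    have "A *v (c *\<^sub>R slope_dir r) + b \<in> line_through p' r'"
      unfolding p'[symmetric] by (auto simp: line_through_def)
    then show "\<exists>c'. A *v (c *\<^sub>R slope_dir r) + b = p' + c' *\<^sub>R slope_dir r'"
      by (auto simp: line_through_def)
  qed
  obtain c0 where c0: "b = p' + c0 *\<^sub>R slope_dir r'" using img[of 0] by auto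
  obtain c1 where c1: "A *v slope_dir r + b = p' + c1 *\<^sub>R slope_dir r'" using img[of 1] by auto
  have A: "A *v slope_dir r = (c1 - c0) *\<^sub>R slope_dir r'"
    using c0 c1 by (simp add: algebra_simps)
  have "c1 - c0 \<noteq> 0"
  proof
    assume "c1 - c0 = 0"
    then have "A *v (c *\<^sub>R slope_dir r) = 0" for c
      using A by (simp add: scaleR_matrix_vector_assoc[symmetric] matrix_vector_mult_scaleR)
    then have "line_through p' r' \<subseteq> {b}" unfolding p'[symmetric] by (auto simp: line_through_def)
    moreover have "p' \<in> line_through p' r'" "p' + slope_dir r' \<in> line_through p' r'"
      unfolding line_through_def by (force, metis (mono_tags, lifting) mem_Collect_eq scaleR_one)
    ultimately have "p' = b" "p' + slope_dir r' = b" by blast+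
    then show False using nz by simp
  qed
  then show "\<exists>c. c \<noteq> 0 \<and> A *v slope_dir r = c *\<^sub>R slope_dir r'" using A by blast
next
  assume "\<exists>c. c \<noteq> 0 \<and> A *v slope_dir r = c *\<^sub>R slope_dir r'"
  then obtain c where c: "c \<noteq> 0" "A *v slope_dir r = c *\<^sub>R slope_dir r'" by blast
  show "takes_slope_to (\<lambda>x. A *v x + b) r r'"
    unfolding takes_slope_to_def
  proof (intro allI exI)
    fix p
    have eq: "A *v (p + a *\<^sub>R slope_dir r) + b = (A *v p + b) + (a * c) *\<^sub>R slope_dir r'" for a
      by (simp add: matrix_vector_right_distrib matrix_vector_mult_scaleR c)
    show "(\<lambda>x. A *v x + b) ` line_through p r = line_through (A *v p + b) r'"
    proof
      show "(\<lambda>x. A *v x + b) ` line_through p r \<subseteq> line_through (A *v p + b) r'"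
        using eq by (auto simp: line_through_def)
      show "line_through (A *v p + b) r' \<subseteq> (\<lambda>x. A *v x + b) ` line_through p r"
      proof
        fix y assume "y \<in> line_through (A *v p + b) r'"
        then obtain a where "y = (A *v p + b) + a *\<^sub>R slope_dir r'" by (auto simp: line_through_def)
        then have "y = A *v (p + (a / c) *\<^sub>R slope_dir r) + b" using eq[of "a / c"] c(1) by simp
        then show "y \<in> (\<lambda>x. A *v x + b) ` line_through p r" by (auto simp: line_through_def)
      qed
    qed
  qed
qed

lemma takes_slope_to_GL2Z:
  assumes "A \<in> GL2Z"
  shows "takes_slope_to (\<lambda>x. A *v x + b) r r' \<longleftrightarrow>
    A *v slope_dir r = slope_dir r' \<or> A *v slope_dir r = - slope_dir r'"
proof -
  have "c = 1 \<or> c = - 1" if "A *v slope_dir r = c *\<^sub>R slope_dir r'" for c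
    using primitive_parallel[OF GL2Z_primitive[OF assms primitive_slope_dir] primitive_slope_dir that] .
  then have "(\<exists>c. c \<noteq> 0 \<and> A *v slope_dir r = c *\<^sub>R slope_dir r') \<longleftrightarrow>
      (\<exists>c. (c = 1 \<or> c = - 1) \<and> A *v slope_dir r = c *\<^sub>R slope_dir r')"
    by (metis zero_neq_one neg_equal_0_iff_equal)
  then show ?thesis unfolding takes_slope_to_iff by auto
qed

lemma GL2Z_slope_image:
  assumes "A \<in> GL2Z"
  obtains r' where "A *v slope_dir r = slope_dir r' \<or> A *v slope_dir r = - slope_dir r'"
proof -
  obtain r' \<epsilon> where "\<epsilon> = 1 \<or> \<epsilon> = - 1" "A *v slope_dir r = \<epsilon> *\<^sub>R slope_dir r'"
    using primitive_is_slope_dir[OF GL2Z_primitive[OF assms primitive_slope_dir[of r]]] .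
  then show ?thesis using that[of r'] by auto
qed

section \<open>Pulling back curves\<close>

context orbifold_covering
begin

lemma L_scaleR_int: "x \<in> L \<Longrightarrow> of_int n *\<^sub>R x \<in> L"
proof (induction n rule: int_induct[of _ 0])
  case (step1 i)
  then show ?case using L_add[of "of_int i *\<^sub>R x" x] by (simp add: algebra_simps)
next
  case (step2 i)
  then show ?case using L_diff[of "of_int i *\<^sub>R x" x] by (simp add: algebra_simps)
qed (simp add: L_zero)

lemma lift_line_homotopy:
  assumes hom: "homotopic_loops (S2 - p ` L) (\<lambda>t. p (q + (2 * t) *\<^sub>R w)) \<beta>"
    and w: "w \<in> L" and q: "\<And>\<tau>. q + \<tau> *\<^sub>R w \<notin> L"
  obtains K :: "real \<times> real \<Rightarrow> real^2"
  where "continuous_on ({0..1} \<times> UNIV) K" "\<And>u t. u \<in> {0..1} \<Longrightarrow> K (u, t) \<notin> L"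
    "\<And>t. K (0, t) = q + (2 * t) *\<^sub>R w" "\<And>u t. u \<in> {0..1} \<Longrightarrow> K (u, t + 1) = K (u, t) + 2 *\<^sub>R w"
    "\<And>t. p (K (1, t)) = \<beta> (frac t)"
proof -
  have per: "p (q + (2 * t) *\<^sub>R w) = p (q + (2 * frac t) *\<^sub>R w)" for t
  proof -
    have "q + (2 * t) *\<^sub>R w = (q + (2 * frac t) *\<^sub>R w) + 2 *\<^sub>R (of_int \<lfloor>t\<rfloor> *\<^sub>R w)"
      by (simp add: frac_def algebra_simps)
    then show ?thesis
      using translate[OF L_scaleR_int[OF w, of "\<lfloor>t\<rfloor>"], of "q + (2 * frac t) *\<^sub>R w"]
      by (simp only:)
  qed
  have cont: "continuous_on UNIV (\<lambda>t. q + (2 * t) *\<^sub>R w)" by (intro continuous_intros)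
  have step: "q + (2 * (t + 1)) *\<^sub>R w = q + (2 * t) *\<^sub>R w + 2 *\<^sub>R w" for t
    by (simp add: algebra_simps)
  show thesis
    by (rule lift_homotopic_loops[OF hom cont q per step w]) (rule that)
qed

end

text \<open>One point \<open>x\<close> of the plane stands both for \<open>p1 x\<close> in the
  domain of \<open>f\<close> and for \<open>p2 x\<close> in the range, and \<open>f\<close> becomes
  the identity in these coordinates.\<close>

locale orbifold_pair =
  o1: orbifold_covering L1 p1 + o2: orbifold_covering Z2 p2
  for L1 :: "(real^2) set" and p1 p2 :: "real^2 \<Rightarrow> real^3" +
  fixes f :: "real^3 \<Rightarrow> real^3"
  assumes f_p1: "f (p1 x) = p2 x"
    and f_cont: "continuous_on S2 f"
    and f_P: "f ` p2 ` Z2 \<subseteq> p2 ` Z2"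
begin

abbreviation P where "P \<equiv> p2 ` Z2"

text \<open>If \<open>p1 x\<close> were marked, then so would be \<open>f (p1 x) = p2 x\<close>,
  which puts \<open>x\<close> in \<open>Z2\<close>. Hence curves and homotopies off
  \<open>Z2\<close> can be pushed down by \<open>p1\<close> as well without meeting
  \<open>P\<close>.\<close>

lemma p1_not_in_P:
  assumes "x \<notin> Z2"
  shows "p1 x \<in> S2 - P"
proof
  show "p1 x \<in> S2" using o1.surj by blast
  show "p1 x \<notin> P"
  proof
    assume "p1 x \<in> P"
    then have "p2 x \<in> P" using f_P f_p1 by (metis imageI subsetD)
    then show False using assms o2.image_L_iff by blast
  qed
qed

text \<open>The image of \<open>\<delta>\<close> under \<open>f\<close> runs along
  \<open>\<gamma>\<close> with a continuous real phase \<open>h\<close>. A lift of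
  \<open>\<delta>\<close> through \<open>p1\<close> lies over this image through \<open>p2\<close>,
  so it is a periodic lift of \<open>\<gamma>\<close> evaluated at \<open>h\<close>. Deforming that
  lift to a line and \<open>h\<close> to a linear phase, and applying \<open>p1\<close>, gives the
  homotopy. The integer \<open>d\<close> counts the turns around \<open>\<gamma>\<close>.\<close>

lemma pullback_line:
  assumes \<gamma>: "simple_path \<gamma>" "pathfinish \<gamma> = pathstart \<gamma>"
    and hom: "homotopic_loops (S2 - P) \<gamma> (\<lambda>t. p2 (q + (2 * t) *\<^sub>R w))"
    and w: "w \<in> Z2" and q: "\<And>\<tau>. q + \<tau> *\<^sub>R w \<notin> Z2"
    and \<delta>: "path \<delta>" "pathfinish \<delta> = pathstart \<delta>" "path_image \<delta> \<subseteq> S2"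
    and f\<delta>: "\<And>t. t \<in> {0..1} \<Longrightarrow> f (\<delta> t) \<in> path_image \<gamma>"
  obtains x v d where "v = w \<or> v = - w" "\<And>\<tau>. x + \<tau> *\<^sub>R v \<notin> Z2" "of_int d *\<^sub>R v \<in> L1"
    "homotopic_loops (S2 - P) \<delta> (\<lambda>t. p1 (x + (2 * (of_int d * t)) *\<^sub>R v))"
proof -
  have \<gamma>P: "path_image \<gamma> \<subseteq> S2 - P" using hom homotopic_loops_imp_subset by blast
  obtain g where g: "homeomorphism (sphere 0 1) (path_image \<gamma>) (\<lambda>z. \<gamma> (Arg2pi z / (2 * pi))) g"
    using loop_circle_homeomorphism[OF \<gamma>] by blast
  have \<delta>S: "\<delta> t \<in> S2" if "t \<in> {0..1}" for t
    using subsetD[OF \<delta>(3)[unfolded path_image_def] imageI[OF that]] .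
  have contf\<delta>: "continuous_on {0..1} (\<lambda>t. f (\<delta> t))"
    using \<delta>(1) \<delta>S unfolding path_def by (intro continuous_on_compose2[OF f_cont]) auto
  have contz: "continuous_on {0..1} (\<lambda>t. g (f (\<delta> t)))"
    using f\<delta> homeomorphism_cont2[OF g] by (intro continuous_on_compose2[OF _ contf\<delta>]) auto
  have z1: "cmod (g (f (\<delta> t))) = 1" if "t \<in> {0..1}" for t
  proof -
    have "g (f (\<delta> t)) \<in> sphere 0 1" using homeomorphism_image2[OF g] f\<delta>[OF that] by blast
    then show ?thesis by simp
  qed
  \<comment> \<open>A continuous logarithm over the interval turns the circle-valued phase into the
    real-valued \<open>h\<close>.\<close>
  obtain l where l: "continuous_on {0..1} l" "\<And>t. t \<in> {0..1} \<Longrightarrow> g (f (\<delta> t)) = exp (l t)"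
  proof (rule continuous_logarithm_on_contractible[OF contz])
    show "contractible {0..1::real}" by (simp add: convex_imp_contractible)
    show "\<And>t. t \<in> {0..1} \<Longrightarrow> g (f (\<delta> t)) \<noteq> 0" using z1 by fastforce
  qed blast
  define h where "h = (\<lambda>t. Im (l t) / (2 * pi))"
  have conth: "continuous_on {0..1} h" unfolding h_def by (intro continuous_intros l(1)) auto
  have zh: "g (f (\<delta> t)) = cis (2 * pi * h t)" if t: "t \<in> {0..1}" for t
  proof -
    have "Re (l t) = 0" using z1[OF t] l(2)[OF t] by simp
    then have "l t = \<i> * of_real (Im (l t))" by (simp add: complex_eq_iff)
    then have "exp (l t) = cis (Im (l t))" by (metis cis_conv_exp)
    then show ?thesis using l(2)[OF t] by (simp add: h_def)
  qed
  have f\<delta>h: "f (\<delta> t) = \<gamma> (frac (h t))" if t: "t \<in> {0..1}" for t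
    using homeomorphism_apply2[OF g f\<delta>[OF t]] zh[OF t] by (simp add: Arg2pi_cis_frac)
  have \<delta>01: "\<delta> 1 = \<delta> 0" using \<delta>(2) by (simp add: pathfinish_def pathstart_def)
  define d where "d = \<lfloor>h 1\<rfloor> - \<lfloor>h 0\<rfloor>"
  have "frac (h 1) = frac (h 0)"
    using zh[of 0] zh[of 1] \<delta>01 by (metis Arg2pi_cis_frac atLeastAtMost_iff order_refl zero_le_one)
  then have h1: "h 1 = h 0 + of_int d" by (simp add: d_def frac_def)

  obtain K :: "real \<times> real \<Rightarrow> real^2"
    where K: "continuous_on ({0..1} \<times> UNIV) K" "\<And>u t. u \<in> {0..1} \<Longrightarrow> K (u, t) \<notin> Z2"
    "\<And>t. K (0, t) = q + (2 * t) *\<^sub>R w" "\<And>u t. u \<in> {0..1} \<Longrightarrow> K (u, t + 1) = K (u, t) + 2 *\<^sub>R w"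
    "\<And>t. p2 (K (1, t)) = \<gamma> (frac t)"
    by (rule o2.lift_line_homotopy[OF homotopic_loops_sym[OF hom] w q]) (rule that)

  obtain \<delta>' where \<delta>': "continuous_on {0..1} \<delta>'" "\<delta>' \<in> {0..1} \<rightarrow> - L1" "\<And>t. t \<in> {0..1} \<Longrightarrow> p1 (\<delta>' t) = \<delta> t"
  proof (rule covering_space_lift[OF o1.covering])
    show "simply_connected {0..1::real}" by (simp add: convex_imp_simply_connected)
    show "locally path_connected {0..1::real}" by (simp add: convex_imp_locally_path_connected)
    show "continuous_on {0..1} \<delta>" using \<delta>(1) by (simp add: path_def)
    show "\<delta> \<in> {0..1} \<rightarrow> S2 - p1 ` L1"
    proof
      fix t :: real assume t: "t \<in> {0..1}"
      have "\<delta> t \<notin> p1 ` L1"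
      proof
        assume "\<delta> t \<in> p1 ` L1"
        then have "f (\<delta> t) \<in> P" using f_p1 o1.L_Z2 by auto
        then show False using f\<delta>[OF t] \<gamma>P by blast
      qed
      then show "\<delta> t \<in> S2 - p1 ` L1" using \<delta>S[OF t] by blast
    qed
  qed blast
  have p2\<delta>': "p2 (\<delta>' t) = \<gamma> (frac (h t))" if "t \<in> {0..1}" for t
    using f\<delta>h[OF that] \<delta>'(3)[OF that] f_p1 by metis
  have \<delta>'Z: "\<delta>' t \<notin> Z2" if t: "t \<in> {0..1}" for t
  proof
    assume "\<delta>' t \<in> Z2"
    then have "f (\<delta> t) \<in> P" using \<delta>'(3)[OF t] f_p1 by (metis imageI)
    then show False using f\<delta>[OF t] \<gamma>P by blast
  qed
  have "p2 (K (1, h 0)) = p2 (\<delta>' 0)" using K(5) p2\<delta>'[of 0] by simp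
  then obtain \<epsilon> c where c: "c \<in> Z2" "\<epsilon> = 1 \<or> \<epsilon> = - 1" "\<delta>' 0 = \<epsilon> *\<^sub>R K (1, h 0) + 2 *\<^sub>R c"
    by (rule o2.fibre_cases)
  \<comment> \<open>The lift \<open>\<delta>'\<close> and the lifted homotopy were chosen
    independently; a deck transformation of \<open>p2\<close> moves the latter so that the two start
    at the same point.\<close>
  define G where "G = (\<lambda>z. \<epsilon> *\<^sub>R K z + 2 *\<^sub>R c)"
  define v where "v = \<epsilon> *\<^sub>R w"
  define x where "x = \<epsilon> *\<^sub>R q + 2 *\<^sub>R c"
  have v: "v = w \<or> v = - w" "v \<in> Z2" using c(2) w Z2_minus by (auto simp: v_def)
  have G: "continuous_on ({0..1} \<times> UNIV) G" unfolding G_def by (intro continuous_intros K(1))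
  have p2G: "p2 (G z) = p2 (K z)" for z unfolding G_def using o2.same_deck c by blast
  have GZ: "G (u, t) \<notin> Z2" if "u \<in> {0..1}" for u t
    using p2G[of "(u, t)"] K(2)[OF that] o2.image_L_iff by metis
  have G0: "G (0, t) = x + (2 * t) *\<^sub>R v" for t
    by (simp add: G_def K(3) x_def v_def algebra_simps)
  have Gper: "G (u, t + of_int d) = G (u, t) + 2 *\<^sub>R (of_int d *\<^sub>R v)" if "u \<in> {0..1}" for u t
    using periodic_add_int[of "\<lambda>t. G (u, t)" "2 *\<^sub>R v" t d] K(4)[OF that]
    by (simp add: G_def v_def algebra_simps)
  have \<delta>'G: "\<delta>' t = G (1, h t)" if "t \<in> {0..1}" for t
  proof (rule o2.lift_unique[of "{0..1}" 0 t])
    show "continuous_on {0..1} (\<lambda>t. G (1, h t))"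
      by (intro continuous_on_compose2[OF G] continuous_intros conth) auto
    show "p2 (\<delta>' t) = p2 (G (1, h t))" if "t \<in> {0..1}" for t
      using p2\<delta>'[OF that] p2G K(5) by simp
    show "\<delta>' 0 = G (1, h 0)" using c(3) by (simp add: G_def)
  qed (use that \<delta>' \<delta>'Z GZ in auto)
  \<comment> \<open>Since \<open>\<delta>\<close> closes up, the endpoints of
    \<open>\<delta>'\<close> lie in one fibre of \<open>p1\<close>. If a translation relates them,
    this is the claim; if a half turn does, \<open>\<delta>' 0\<close> would be a lattice
    point.\<close>
  have dv: "of_int d *\<^sub>R v \<in> L1"
  proof -
    have eq: "\<delta>' 1 = \<delta>' 0 + 2 *\<^sub>R (of_int d *\<^sub>R v)"
      using \<delta>'G[of 0] \<delta>'G[of 1] Gper[of 1 "h 0"] h1 by simp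
    have "p1 (\<delta>' 0) = p1 (\<delta>' 1)" using \<delta>'(3) \<delta>01 by simp
    then obtain m where m: "m \<in> L1" "\<delta>' 1 = 2 *\<^sub>R m + \<delta>' 0 \<or> \<delta>' 1 = 2 *\<^sub>R m - \<delta>' 0"
      using o1.eq_iff by blast
    from m(2) show ?thesis
    proof
      assume "\<delta>' 1 = 2 *\<^sub>R m + \<delta>' 0"
      then have "2 *\<^sub>R m = 2 *\<^sub>R (of_int d *\<^sub>R v)" using eq by (simp add: algebra_simps)
      then have "m = of_int d *\<^sub>R v" by (simp del: scaleR_scaleR)
      then show ?thesis using m(1) by simp
    next
      assume "\<delta>' 1 = 2 *\<^sub>R m - \<delta>' 0"
      then have "2 *\<^sub>R \<delta>' 0 = 2 *\<^sub>R (m - of_int d *\<^sub>R v)" using eq by (simp add: algebra_simps scaleR_2)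
      then have "\<delta>' 0 = m - of_int d *\<^sub>R v" by (simp del: scaleR_scaleR)
      moreover have "of_int d *\<^sub>R v \<in> Z2" using v(2) by (intro Z2_scaleR_int) auto
      ultimately have "\<delta>' 0 \<in> Z2" using m(1) o1.L_Z2 Z2_diff by auto
      then show ?thesis using \<delta>'Z[of 0] by simp
    qed
  qed
  \<comment> \<open>At time \<open>u\<close> the lifted homotopy is taken at level
    \<open>1 - u\<close> and the phase is interpolated between \<open>h\<close> and the linear one.
    Both phases grow by \<open>d\<close> over the interval, so by \<open>dv\<close> every
    intermediate curve closes up under \<open>p1\<close>.\<close>
  have "homotopic_loops (S2 - P) \<delta> (\<lambda>t. p1 (x + (2 * (of_int d * t)) *\<^sub>R v))"
    unfolding homotopic_loops
  proof (intro exI[of _ "\<lambda>z. p1 (G (1 - fst z, (1 - fst z) * h (snd z) + fst z * (of_int d * snd z)))"] conjI ballI)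
    show "continuous_on ({0..1} \<times> {0..1})
        (\<lambda>z. p1 (G (1 - fst z, (1 - fst z) * h (snd z) + fst z * (of_int d * snd z))))"
      by (intro continuous_on_compose2[OF o1.continuous] continuous_on_compose2[OF G]
          continuous_on_compose2[OF conth] continuous_intros) auto
    show "(\<lambda>z. p1 (G (1 - fst z, (1 - fst z) * h (snd z) + fst z * (of_int d * snd z))))
        \<in> {0..1} \<times> {0..1} \<rightarrow> S2 - P"
      using GZ by (intro Pi_I p1_not_in_P) auto
    show "p1 (G (1 - fst (0, t), (1 - fst (0, t)) * h (snd (0, t)) + fst (0, t) * (of_int d * snd (0, t)))) = \<delta> t"
      if "t \<in> {0..1}" for t
      using \<delta>'G[OF that] \<delta>'(3)[OF that] by simp
    show "p1 (G (1 - fst (1, t), (1 - fst (1, t)) * h (snd (1, t)) + fst (1, t) * (of_int d * snd (1, t)))) =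
        p1 (x + (2 * (of_int d * t)) *\<^sub>R v)" for t
      by (simp add: G0)
    show "pathfinish ((\<lambda>z. p1 (G (1 - fst z, (1 - fst z) * h (snd z) + fst z * (of_int d * snd z)))) \<circ> Pair u) =
        pathstart ((\<lambda>z. p1 (G (1 - fst z, (1 - fst z) * h (snd z) + fst z * (of_int d * snd z)))) \<circ> Pair u)"
      if u: "u \<in> {0..1}" for u
    proof -
      have "(1 - u) * h 1 + u * of_int d = (1 - u) * h 0 + of_int d"
        by (simp add: h1 algebra_simps)
      then show ?thesis using o1.translate[OF dv] Gper[of "1 - u" "(1 - u) * h 0"] u
        by (simp add: pathfinish_def pathstart_def)
    qed
  qed
  moreover have "x + \<tau> *\<^sub>R v \<notin> Z2" for \<tau> using G0[of "\<tau> / 2"] GZ[of 0 "\<tau> / 2"] by simp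
  ultimately show ?thesis using that v(1) dv by blast
qed

text \<open>Here the \<open>p1\<close>-image of a line is lifted through \<open>p2\<close>. The lift
  \<open>k\<close> need not be straight, but the homotopy to a \<open>p2\<close>-line of direction
  \<open>w\<close> dictates its displacement over one period.\<close>

lemma lift_pullback:
  assumes hom: "homotopic_loops (S2 - P) (\<lambda>t. p2 (q + (2 * t) *\<^sub>R w)) (\<lambda>t. p1 (x + (2 * (of_int d * t)) *\<^sub>R v))"
    and w: "w \<in> Z2" and q: "\<And>\<tau>. q + \<tau> *\<^sub>R w \<notin> Z2" and dv: "of_int d *\<^sub>R v \<in> L1"
  obtains k where "continuous_on UNIV k" "\<And>t. k t \<notin> Z2" "\<And>t. k (t + 1) = k t + 2 *\<^sub>R w"
    "\<And>t. p2 (k t) = p1 (x + (2 * (of_int d * t)) *\<^sub>R v)"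
proof -
  obtain K :: "real \<times> real \<Rightarrow> real^2"
    where K: "continuous_on ({0..1} \<times> UNIV) K" "\<And>u t. u \<in> {0..1} \<Longrightarrow> K (u, t) \<notin> Z2"
    "\<And>t. K (0, t) = q + (2 * t) *\<^sub>R w" "\<And>u t. u \<in> {0..1} \<Longrightarrow> K (u, t + 1) = K (u, t) + 2 *\<^sub>R w"
    "\<And>t. p2 (K (1, t)) = p1 (x + (2 * (of_int d * frac t)) *\<^sub>R v)"
    by (rule o2.lift_line_homotopy[OF hom w q]) (rule that)
  have "p1 (x + (2 * (of_int d * frac t)) *\<^sub>R v) = p1 (x + (2 * (of_int d * t)) *\<^sub>R v)" for t
  proof -
    have per: "p1 (x + (2 * (of_int d * (s + 1))) *\<^sub>R v) = p1 (x + (2 * (of_int d * s)) *\<^sub>R v)" for s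
      using o1.translate[OF dv, of "x + (2 * (of_int d * s)) *\<^sub>R v"] by (simp add: algebra_simps)
    have "p1 (x + (2 * (of_int d * (frac t + of_int n))) *\<^sub>R v) = p1 (x + (2 * (of_int d * frac t)) *\<^sub>R v)" for n
      using periodic_add_int[of "\<lambda>s. p1 (x + (2 * (of_int d * s)) *\<^sub>R v)" 0 "frac t" n] per by simp
    from this[of "\<lfloor>t\<rfloor>"] show ?thesis by (simp add: frac_def)
  qed
  moreover have "continuous_on UNIV (\<lambda>t. K (1, t))"
    by (intro continuous_on_compose2[OF K(1)] continuous_intros) auto
  ultimately show ?thesis using that[of "\<lambda>t. K (1, t)"] K by simp
qed

text \<open>
  Non-parallel lifted curves would cross; by unique lifting they would then coincide up to
  reparametrization, so that they are parallel after all.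
\<close>

lemma pullback_parallel:
  assumes hom1: "homotopic_loops (S2 - P) (\<lambda>t. p2 (q1 + (2 * t) *\<^sub>R w1)) (\<lambda>t. p1 (x1 + (2 * (of_int d1 * t)) *\<^sub>R v))"
    and w1: "w1 \<in> Z2" and q1: "\<And>\<tau>. q1 + \<tau> *\<^sub>R w1 \<notin> Z2" and dv1: "of_int d1 *\<^sub>R v \<in> L1"
    and hom2: "homotopic_loops (S2 - P) (\<lambda>t. p2 (q2 + (2 * t) *\<^sub>R w2)) (\<lambda>t. p1 (x2 + (2 * (of_int d2 * t)) *\<^sub>R v))"
    and w2: "w2 \<in> Z2" and q2: "\<And>\<tau>. q2 + \<tau> *\<^sub>R w2 \<notin> Z2" and dv2: "of_int d2 *\<^sub>R v \<in> L1"
  shows "det2 w1 w2 = 0"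
proof (rule ccontr)
  assume D: "det2 w1 w2 \<noteq> 0"
  obtain k1 where k1: "continuous_on UNIV k1" "\<And>t. k1 t \<notin> Z2" "\<And>t. k1 (t + 1) = k1 t + 2 *\<^sub>R w1"
    "\<And>t. p2 (k1 t) = p1 (x1 + (2 * (of_int d1 * t)) *\<^sub>R v)"
    using lift_pullback[OF hom1 w1 q1 dv1] by blast
  obtain k2 where k2: "continuous_on UNIV k2" "\<And>t. k2 t \<notin> Z2" "\<And>t. k2 (t + 1) = k2 t + 2 *\<^sub>R w2"
    "\<And>t. p2 (k2 t) = p1 (x2 + (2 * (of_int d2 * t)) *\<^sub>R v)"
    using lift_pullback[OF hom2 w2 q2 dv2] by blast
  have "det2 (2 *\<^sub>R w1) (2 *\<^sub>R w2) \<noteq> 0" using D by (simp add: det2_def)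
  then obtain t1 t2 where t: "k1 t1 = k2 t2"
    using periodic_curves_meet[OF k1(1,3) k2(1,3)] by blast
  define y1 y2 where "y1 = x1 + (2 * (of_int d1 * t1)) *\<^sub>R v" and "y2 = x2 + (2 * (of_int d2 * t2)) *\<^sub>R v"
  have "p1 y1 = p1 y2" using t k1(4)[of t1] k2(4)[of t2] by (simp add: y1_def y2_def)
  then obtain \<epsilon> l where l: "l \<in> L1" "\<epsilon> = 1 \<or> \<epsilon> = - 1" "y2 = \<epsilon> *\<^sub>R y1 + 2 *\<^sub>R l"
    by (rule o1.fibre_cases)
  have \<epsilon>\<epsilon>: "\<epsilon> * \<epsilon> = 1" using l(2) by auto
  \<comment> \<open>The speeds \<open>\<epsilon> * of_int d2\<close> and \<open>of_int d1\<close>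
    make the points of the two underlying lines correspond under one deck transformation of
    \<open>p1\<close> for all \<open>s\<close>; at \<open>s = 1\<close> both curves have gone
    through whole periods.\<close>
  have "k1 (t1 + \<epsilon> * of_int d2 * 1) = k2 (t2 + of_int d1 * 1)"
  proof (rule o2.lift_unique[where T = UNIV and a = 0 and g = "\<lambda>s. k1 (t1 + \<epsilon> * of_int d2 * s)"
        and h = "\<lambda>s. k2 (t2 + of_int d1 * s)" and x = 1])
    show "continuous_on UNIV (\<lambda>s. k1 (t1 + \<epsilon> * of_int d2 * s))"
      "continuous_on UNIV (\<lambda>s. k2 (t2 + of_int d1 * s))"
      by (intro continuous_on_compose2[OF k1(1)] continuous_on_compose2[OF k2(1)] continuous_intros; simp)+
    fix s
    have "\<epsilon> *\<^sub>R (x1 + (2 * (of_int d1 * (t1 + \<epsilon> * of_int d2 * s))) *\<^sub>R v) + 2 *\<^sub>R l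
        = y2 + ((\<epsilon> * \<epsilon>) * (2 * of_int d1 * of_int d2 * s)) *\<^sub>R v"
      by (simp add: l(3) y1_def algebra_simps)
    also have "\<dots> = x2 + (2 * (of_int d2 * (t2 + of_int d1 * s))) *\<^sub>R v"
      by (simp add: \<epsilon>\<epsilon> y2_def algebra_simps)
    finally show "p2 (k1 (t1 + \<epsilon> * of_int d2 * s)) = p2 (k2 (t2 + of_int d1 * s))"
      unfolding k1(4) k2(4) using o1.same_deck[OF l(1,2)] by metis
  qed (use t k1(2) k2(2) in auto)
  moreover have "k1 (t1 + \<epsilon> * of_int d2) = k1 t1 + (\<epsilon> * of_int d2) *\<^sub>R (2 *\<^sub>R w1)"
    using l(2) periodic_add_int[of k1 "2 *\<^sub>R w1" t1 d2] periodic_add_int[of k1 "2 *\<^sub>R w1" t1 "- d2"] k1(3)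
    by auto
  moreover have "k2 (t2 + of_int d1) = k2 t2 + of_int d1 *\<^sub>R (2 *\<^sub>R w2)"
    using periodic_add_int[of k2 "2 *\<^sub>R w2" t2 d1] k2(3) by auto
  ultimately have "(\<epsilon> * of_int d2) *\<^sub>R (2 *\<^sub>R w1) = of_int d1 *\<^sub>R (2 *\<^sub>R w2)" using t by simp
  then have "2 *\<^sub>R ((\<epsilon> * of_int d2) *\<^sub>R w1) = 2 *\<^sub>R (of_int d1 *\<^sub>R w2)" by (simp add: mult.commute)
  then have eq: "(\<epsilon> * of_int d2) *\<^sub>R w1 = of_int d1 *\<^sub>R w2" by (simp del: scaleR_scaleR)
  have "det2 w1 ((\<epsilon> * of_int d2) *\<^sub>R w1) = 0" by (simp add: det2_def)
  then have "of_int d1 * det2 w1 w2 = 0" unfolding eq by (simp add: det2_def algebra_simps)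
  then have "d1 = 0" using D by simp
  \<comment> \<open>For \<open>d1 = 0\<close> the loop below is constant, hence so is its lift,
    whose displacement then vanishes.\<close>
  have "k1 1 = k1 0"
  proof (rule o2.lift_unique[where T = UNIV and a = 0 and g = k1 and h = "\<lambda>_. k1 0" and x = 1])
    show "p2 (k1 t) = p2 (k1 0)" for t unfolding k1(4) using \<open>d1 = 0\<close> by simp
  qed (use k1 in auto)
  then have "w1 = 0" using k1(3)[of 0] by simp
  then show False using D by (simp add: det2_def)
qed

end

section \<open>Winding numbers and orientation\<close>

lemma winding_number_homotopy:
  fixes G :: "real \<Rightarrow> real \<Rightarrow> complex"
  assumes "continuous_on ({0..1} \<times> {0..1}) (\<lambda>z. G (fst z) (snd z))"
    and "\<And>u t. u \<in> {0..1} \<Longrightarrow> t \<in> {0..1} \<Longrightarrow> G u t \<noteq> 0"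
    and "\<And>u. u \<in> {0..1} \<Longrightarrow> G u 1 = G u 0"
  shows "winding_number (G 0) 0 = winding_number (G 1) 0"
proof (rule winding_number_homotopic_loops)
  show "homotopic_loops (- {0}) (G 0) (G 1)"
    unfolding homotopic_loops
    using assms by (intro exI[of _ "\<lambda>z. G (fst z) (snd z)"]) (auto simp: pathfinish_def pathstart_def)
qed

text \<open>
  An \<open>\<real>\<close>-linear map of the plane is \<open>z \<mapsto> a z + b cnj z\<close>; its determinant is
  \<open>|a|\<^sup>2 - |b|\<^sup>2\<close>.
\<close>

lemma real_linear_nonzero:
  fixes a b z :: complex
  assumes "cmod a \<noteq> cmod b" "z \<noteq> 0"
  shows "a * z + b * cnj z \<noteq> 0"
proof
  assume "a * z + b * cnj z = 0"
  then have "a * z = - (b * cnj z)" by (simp add: eq_neg_iff_add_eq_0)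
  then have "cmod (a * z) = cmod (b * cnj z)" by simp
  then show False using assms by (simp add: norm_mult)
qed

text \<open>The condition \<open>cmod a \<noteq> cmod b\<close> says that the determinant does not
  vanish, so the path runs through invertible real-linear maps and ends at the identity or at
  conjugation. The norm bound keeps the images of small circles inside a fixed disc.\<close>

lemma real_linear_path:
  fixes a b :: complex
  assumes "cmod a \<noteq> cmod b"
  obtains \<alpha> \<beta> :: "real \<Rightarrow> complex"
  where "continuous_on {0..1} \<alpha>" "continuous_on {0..1} \<beta>" "\<alpha> 0 = a" "\<beta> 0 = b"
    "\<And>u. u \<in> {0..1} \<Longrightarrow> cmod (\<alpha> u) \<noteq> cmod (\<beta> u)"
    "\<And>u. u \<in> {0..1} \<Longrightarrow> cmod (\<alpha> u) + cmod (\<beta> u) \<le> 2 * (cmod a + cmod b + 1)"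
    "cmod b < cmod a \<Longrightarrow> \<alpha> 1 = 1 \<and> \<beta> 1 = 0" "cmod a < cmod b \<Longrightarrow> \<alpha> 1 = 0 \<and> \<beta> 1 = 1"
proof -
  have main: "\<exists>\<alpha> \<beta> :: real \<Rightarrow> complex. continuous_on {0..1} \<alpha> \<and> continuous_on {0..1} \<beta> \<and> \<alpha> 0 = a \<and> \<beta> 0 = b \<and>
    (\<forall>u\<in>{0..1}. cmod (\<beta> u) < cmod (\<alpha> u)) \<and>
    (\<forall>u\<in>{0..1}. cmod (\<alpha> u) + cmod (\<beta> u) \<le> 2 * (cmod a + cmod b + 1)) \<and> \<alpha> 1 = 1 \<and> \<beta> 1 = 0"
    if ab: "cmod b < cmod a" for a b :: complex
  proof -
    have a: "a \<noteq> 0" using ab by auto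
    \<comment> \<open>A power of \<open>a\<close> with exponent \<open>1 - u\<close>, of modulus at
      most \<open>max (cmod a) 1\<close>; the ratio of \<open>\<beta> u\<close> to
      \<open>\<alpha> u\<close> is \<open>1 - u\<close> times \<open>b / a\<close>, hence of modulus
      below 1.\<close>
    define \<alpha> where "\<alpha> = (\<lambda>u :: real. exp (of_real (1 - u) * Ln a))"
    define \<beta> where "\<beta> = (\<lambda>u :: real. of_real (1 - u) * b * \<alpha> u / a)"
    have lt: "cmod (\<beta> u) < cmod (\<alpha> u)" if u: "u \<in> {0..1}" for u
    proof -
      have eq: "cmod (\<beta> u) = (1 - u) * (cmod b / cmod a) * cmod (\<alpha> u)"
        using u by (simp add: \<beta>_def norm_mult norm_divide flip: of_real_diff)
      moreover have "(1 - u) * (cmod b / cmod a) \<le> 1 * (cmod b / cmod a)"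
        using u by (intro mult_right_mono) auto
      moreover have "cmod b / cmod a < 1" using ab a by simp
      ultimately have "(1 - u) * (cmod b / cmod a) < 1" "cmod (\<alpha> u) > 0" by (simp_all add: \<alpha>_def)
      then have "(1 - u) * (cmod b / cmod a) * cmod (\<alpha> u) < 1 * cmod (\<alpha> u)"
        by (rule mult_strict_right_mono)
      then show ?thesis using eq by simp
    qed
    moreover have "cmod (\<alpha> u) \<le> cmod a + 1" if u: "u \<in> {0..1}" for u
    proof -
      have "cmod (\<alpha> u) = exp ((1 - u) * ln (cmod a))"
        using a by (simp add: \<alpha>_def)
      also have "\<dots> \<le> exp (max (ln (cmod a)) 0)"
      proof (cases "ln (cmod a) \<ge> 0")
        case True
        then have "(1 - u) * ln (cmod a) \<le> 1 * ln (cmod a)" using u by (intro mult_right_mono) auto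
        then show ?thesis by simp
      next
        case False
        then have "(1 - u) * ln (cmod a) \<le> 0" using u by (intro mult_nonneg_nonpos) auto
        then show ?thesis by simp
      qed
      also have "\<dots> \<le> cmod a + 1" using a by (simp add: max_def)
      finally show ?thesis .
    qed
    ultimately have "\<forall>u\<in>{0..1}. cmod (\<alpha> u) + cmod (\<beta> u) \<le> 2 * (cmod a + cmod b + 1)"
      by (smt (verit) norm_ge_zero)
    moreover have "continuous_on {0..1} \<alpha>" unfolding \<alpha>_def by (intro continuous_intros)
    moreover from this have "continuous_on {0..1} \<beta>" unfolding \<beta>_def by (intro continuous_intros) (use a in auto)
    ultimately show ?thesis using lt a by (intro exI[of _ \<alpha>] exI[of _ \<beta>]) (simp add: \<alpha>_def \<beta>_def)
  qed
  show thesis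
  proof (cases "cmod b < cmod a")
    case True
    from main[OF this] obtain \<alpha> \<beta> :: "real \<Rightarrow> complex"
      where p: "continuous_on {0..1} \<alpha>" "continuous_on {0..1} \<beta>" "\<alpha> 0 = a" "\<beta> 0 = b"
        "\<forall>u\<in>{0..1}. cmod (\<beta> u) < cmod (\<alpha> u)"
        "\<forall>u\<in>{0..1}. cmod (\<alpha> u) + cmod (\<beta> u) \<le> 2 * (cmod a + cmod b + 1)" "\<alpha> 1 = 1" "\<beta> 1 = 0"
      by (elim exE conjE) (rule that)
    moreover have "cmod (\<alpha> u) \<noteq> cmod (\<beta> u)" if "u \<in> {0..1}" for u
      using bspec[OF p(5) that] by simp
    ultimately show thesis using True by (intro that[of \<alpha> \<beta>]) auto
  next
    case False
    then have "cmod a < cmod b" using assms by simp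
    from main[OF this] obtain \<beta> \<alpha> :: "real \<Rightarrow> complex"
      where p: "continuous_on {0..1} \<beta>" "continuous_on {0..1} \<alpha>" "\<beta> 0 = b" "\<alpha> 0 = a"
        "\<forall>u\<in>{0..1}. cmod (\<alpha> u) < cmod (\<beta> u)"
        "\<forall>u\<in>{0..1}. cmod (\<beta> u) + cmod (\<alpha> u) \<le> 2 * (cmod b + cmod a + 1)" "\<beta> 1 = 1" "\<alpha> 1 = 0"
      by (elim exE conjE) (rule that)
    moreover have "cmod (\<alpha> u) \<noteq> cmod (\<beta> u)" if "u \<in> {0..1}" for u
      using bspec[OF p(5) that] by simp
    ultimately show thesis using False by (intro that[of \<alpha> \<beta>]) (auto simp: add.commute)
  qed
qed

text \<open>The sign of a nonzero determinant, taken as a complex number because winding numbers are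
  complex.\<close>

definition real_linear_sign :: "complex \<Rightarrow> complex \<Rightarrow> complex" where
  "real_linear_sign a b = (if cmod b < cmod a then 1 else - 1)"

lemma winding_number_real_linear:
  assumes ab: "cmod a \<noteq> cmod b"
    and \<gamma>: "path \<gamma>" "pathfinish \<gamma> = pathstart \<gamma>" "0 \<notin> path_image \<gamma>"
  shows "winding_number (\<lambda>t. a * \<gamma> t + b * cnj (\<gamma> t)) 0 = real_linear_sign a b * winding_number \<gamma> 0"
proof -
  obtain \<alpha> \<beta> :: "real \<Rightarrow> complex"
  where p: "continuous_on {0..1} \<alpha>" "continuous_on {0..1} \<beta>" "\<alpha> 0 = a" "\<beta> 0 = b"
    "\<And>u. u \<in> {0..1} \<Longrightarrow> cmod (\<alpha> u) \<noteq> cmod (\<beta> u)"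
    "\<And>u. u \<in> {0..1} \<Longrightarrow> cmod (\<alpha> u) + cmod (\<beta> u) \<le> 2 * (cmod a + cmod b + 1)"
    "cmod b < cmod a \<Longrightarrow> \<alpha> 1 = 1 \<and> \<beta> 1 = 0" "cmod a < cmod b \<Longrightarrow> \<alpha> 1 = 0 \<and> \<beta> 1 = 1"
    by (rule real_linear_path[OF ab]) (rule that)
  have cont: "continuous_on {0..1} \<gamma>" using \<gamma>(1) by (simp add: path_def)
  have "winding_number (\<lambda>t. \<alpha> 0 * \<gamma> t + \<beta> 0 * cnj (\<gamma> t)) 0 =
      winding_number (\<lambda>t. \<alpha> 1 * \<gamma> t + \<beta> 1 * cnj (\<gamma> t)) 0"
  proof (rule winding_number_homotopy)
    show "continuous_on ({0..1} \<times> {0..1}) (\<lambda>z. \<alpha> (fst z) * \<gamma> (snd z) + \<beta> (fst z) * cnj (\<gamma> (snd z)))"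
      by (intro continuous_intros continuous_on_compose2[OF p(1)] continuous_on_compose2[OF p(2)]
          continuous_on_compose2[OF cont]) auto
    show "\<alpha> u * \<gamma> t + \<beta> u * cnj (\<gamma> t) \<noteq> 0" if "u \<in> {0..1}" "t \<in> {0..1}" for u t
      using \<gamma>(3) that by (intro real_linear_nonzero p(5)) (auto simp: path_image_def)
    show "\<alpha> u * \<gamma> 1 + \<beta> u * cnj (\<gamma> 1) = \<alpha> u * \<gamma> 0 + \<beta> u * cnj (\<gamma> 0)" for u
      using \<gamma>(2) by (simp add: pathfinish_def pathstart_def)
  qed
  \<comment> \<open>Conjugating a loop negates and conjugates its winding number, and conjugation
    has no effect on an integer.\<close>
  moreover have "winding_number (\<lambda>t. cnj (\<gamma> t)) 0 = - winding_number \<gamma> 0"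
  proof -
    have "winding_number \<gamma> 0 \<in> \<int>" using \<gamma> by (intro integer_winding_number)
    then have "cnj (winding_number \<gamma> 0) = winding_number \<gamma> 0" by (auto elim!: Ints_cases)
    then show ?thesis using winding_number_cnj[OF \<gamma>(1,3)] by (simp add: o_def)
  qed
  ultimately show ?thesis
    using p ab by (cases "cmod b < cmod a") (auto simp: real_linear_sign_def)
qed

text \<open>Now the linear map acts before \<open>F\<close>, which is merely continuous. The path of
  linear maps moves the circle through ellipses around \<open>0\<close> inside the disc of radius
  \<open>\<rho>\<close>; at the end the circle is unchanged or, if conjugated, reversed.\<close>

lemma winding_number_inner_real_linear:
  fixes F :: "complex \<Rightarrow> complex"
  assumes ab: "cmod a \<noteq> cmod b"
    and F: "continuous_on (cball 0 \<rho>) F" "\<And>z. z \<in> cball 0 \<rho> \<Longrightarrow> z \<noteq> 0 \<Longrightarrow> F z \<noteq> F 0"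
    and r: "r > 0" "2 * (cmod a + cmod b + 1) * r \<le> \<rho>"
  shows "winding_number (\<lambda>t. F (a * circlepath 0 r t + b * cnj (circlepath 0 r t)) - F 0) 0 =
    real_linear_sign a b * winding_number (\<lambda>t. F (circlepath 0 r t) - F 0) 0"
proof -
  obtain \<alpha> \<beta> :: "real \<Rightarrow> complex"
  where p: "continuous_on {0..1} \<alpha>" "continuous_on {0..1} \<beta>" "\<alpha> 0 = a" "\<beta> 0 = b"
    "\<And>u. u \<in> {0..1} \<Longrightarrow> cmod (\<alpha> u) \<noteq> cmod (\<beta> u)"
    "\<And>u. u \<in> {0..1} \<Longrightarrow> cmod (\<alpha> u) + cmod (\<beta> u) \<le> 2 * (cmod a + cmod b + 1)"
    "cmod b < cmod a \<Longrightarrow> \<alpha> 1 = 1 \<and> \<beta> 1 = 0" "cmod a < cmod b \<Longrightarrow> \<alpha> 1 = 0 \<and> \<beta> 1 = 1"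
    by (rule real_linear_path[OF ab]) (rule that)
  let ?c = "circlepath 0 r"
  have c: "cmod (?c t) = r" "?c t \<noteq> 0" for t
    using r by (auto simp: circlepath norm_mult)
  have cont: "continuous_on {0..1} ?c" unfolding circlepath by (intro continuous_intros)
  have in_ball: "\<alpha> u * ?c t + \<beta> u * cnj (?c t) \<in> cball 0 \<rho>" if "u \<in> {0..1}" for u t
  proof -
    have "cmod (\<alpha> u * ?c t + \<beta> u * cnj (?c t)) \<le> (cmod (\<alpha> u) + cmod (\<beta> u)) * r"
      using norm_triangle_ineq[of "\<alpha> u * ?c t" "\<beta> u * cnj (?c t)"] c(1)
      by (simp add: norm_mult distrib_right)
    also have "\<dots> \<le> 2 * (cmod a + cmod b + 1) * r"
      using p(6)[OF that] r(1) by (intro mult_right_mono) auto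
    also have "\<dots> \<le> \<rho>" by (rule r(2))
    finally show ?thesis by simp
  qed
  have "\<rho> > 0" using r by (smt (verit) mult_pos_pos norm_ge_zero)
  have "winding_number (\<lambda>t. F (\<alpha> 0 * ?c t + \<beta> 0 * cnj (?c t)) - F 0) 0 =
      winding_number (\<lambda>t. F (\<alpha> 1 * ?c t + \<beta> 1 * cnj (?c t)) - F 0) 0"
  proof (rule winding_number_homotopy)
    show "continuous_on ({0..1} \<times> {0..1})
        (\<lambda>z. F (\<alpha> (fst z) * ?c (snd z) + \<beta> (fst z) * cnj (?c (snd z))) - F 0)"
      using in_ball
      by (intro continuous_intros continuous_on_compose2[OF F(1)] continuous_on_compose2[OF p(1)]
          continuous_on_compose2[OF p(2)] continuous_on_compose2[OF cont]) (auto simp del: mem_cball_0)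
    show "F (\<alpha> u * ?c t + \<beta> u * cnj (?c t)) - F 0 \<noteq> 0" if u: "u \<in> {0..1}" for u t
      using F(2)[OF in_ball[OF u] real_linear_nonzero[OF p(5)[OF u] c(2)]] by simp
    show "F (\<alpha> u * ?c 1 + \<beta> u * cnj (?c 1)) - F 0 = F (\<alpha> u * ?c 0 + \<beta> u * cnj (?c 0)) - F 0" for u
      by (simp add: circlepath mult.commute)
  qed
  moreover have "winding_number (\<lambda>t. F (cnj (?c t)) - F 0) 0 = - winding_number (\<lambda>t. F (?c t) - F 0) 0"
  proof -
    have "cnj (?c t) = ?c (1 - t)" for t
      by (simp add: circlepath exp_cnj left_diff_distrib right_diff_distrib exp_diff mult_ac
          exp_minus divide_inverse)
    then have "(\<lambda>t. F (cnj (?c t)) - F 0) = reversepath (\<lambda>t. F (?c t) - F 0)"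
      by (simp add: reversepath_def)
    moreover have r\<rho>: "r \<le> \<rho>"
    proof -
      have "1 * r \<le> 2 * (cmod a + cmod b + 1) * r" using r(1) by (intro mult_right_mono) auto
      then show ?thesis using r(2) by simp
    qed
    moreover have "path (\<lambda>t. F (?c t) - F 0)"
      unfolding path_def using c(1) r\<rho>
      by (intro continuous_intros continuous_on_compose2[OF F(1)] cont) auto
    moreover have "0 \<notin> path_image (\<lambda>t. F (?c t) - F 0)"
      using F(2) c r\<rho> by (force simp: path_image_def)
    ultimately show ?thesis by (simp add: winding_number_reversepath)
  qed
  ultimately show ?thesis
    using p ab by (cases "cmod b < cmod a") (auto simp: real_linear_sign_def)
qed

text \<open>By invariance of domain the image of the open disc is open, so the frontier of the image
  of the closed disc lies on the image of the circle. Hence \<open>F 0\<close> is inside a simple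
  closed curve, where the winding number has modulus 1.\<close>

lemma winding_number_injective_nonzero:
  fixes F :: "complex \<Rightarrow> complex"
  assumes F: "continuous_on (cball 0 r) F" "inj_on F (cball 0 r)" and r: "r > 0"
  shows "winding_number (\<lambda>t. F (circlepath 0 r t) - F 0) 0 \<noteq> 0"
proof -
  let ?\<gamma> = "F \<circ> circlepath 0 r"
  have img: "path_image (circlepath 0 r) = sphere 0 r" using r by simp
  have "simple_path ?\<gamma>"
    using r F img by (intro simple_path_continuous_image simple_path_circlepath[THEN iffD2])
      (auto intro: continuous_on_subset inj_on_subset)
  moreover have "F 0 \<in> inside (path_image ?\<gamma>)"
  proof -
    have eq: "path_image ?\<gamma> = F ` sphere 0 r" by (simp only: path_image_compose img)
    have op: "open (F ` ball 0 r)" using invariance_of_domain_ball[OF F(1) r F(2)] .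
    have comp: "compact (F ` cball 0 r)" using F(1) compact_continuous_image compact_cball by blast
    have sub: "F ` ball 0 r \<subseteq> interior (F ` cball 0 r)"
      using op by (intro interior_maximal image_mono) auto
    have "frontier (F ` cball 0 r) \<subseteq> F ` sphere 0 r"
    proof
      fix y assume y: "y \<in> frontier (F ` cball 0 r)"
      then have "y \<in> F ` cball 0 r" using comp by (metis compact_imp_closed frontier_subset_closed subsetD)
      then obtain z where z: "z \<in> cball 0 r" "y = F z" by blast
      have "F z \<notin> F ` ball 0 r" using y sub z(2) by (auto simp: frontier_def)
      then have "z \<notin> ball 0 r" by blast
      then show "y \<in> F ` sphere 0 r" using z by auto
    qed
    then have "inside (frontier (F ` cball 0 r)) - F ` sphere 0 r \<subseteq> inside (F ` sphere 0 r)"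
      by (rule inside_mono)
    moreover have "F 0 \<in> inside (frontier (F ` cball 0 r))"
    proof -
      have "F 0 \<in> F ` ball 0 r" using r by (intro imageI) simp
      then show ?thesis using sub interior_inside_frontier[OF compact_imp_bounded[OF comp]] by blast
    qed
    moreover have "F 0 \<notin> F ` sphere 0 r"
    proof
      assume "F 0 \<in> F ` sphere 0 r"
      then obtain z where "z \<in> sphere 0 r" "F 0 = F z" by blast
      then show False using inj_onD[OF F(2), of 0 z] r by auto
    qed
    ultimately show ?thesis unfolding eq by blast
  qed
  ultimately have "cmod (winding_number ?\<gamma> (F 0)) = 1"
    by (rule simple_closed_path_norm_winding_number_inside)
  then show ?thesis by (subst (asm) winding_number_offset) (auto simp: o_def)
qed

section \<open>Complex coordinates of the plane and the sign of a determinant\<close>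

definition to_complex :: "real^2 \<Rightarrow> complex" where
  "to_complex x = Complex (x $ 1) (x $ 2)"

lemma to_complex_linear: "linear to_complex"
  by (rule linearI) (simp_all add: to_complex_def complex_eq_iff)

lemma continuous_on_to_complex [continuous_intros]:
  "continuous_on S g \<Longrightarrow> continuous_on S (\<lambda>x. to_complex (g x))"
  using to_complex_linear by (simp add: linear_conv_bounded_linear bounded_linear.continuous_on)

lemma to_complex_eq_iff: "to_complex x = to_complex y \<longleftrightarrow> x = y"
  by (auto simp: to_complex_def vec_eq_iff forall_2)

lemma plane_param_linear: "linear plane_param"
  by (rule linearI) (simp_all add: plane_param_def vec_eq_iff forall_2)

lemma continuous_on_plane_param [continuous_intros]:
  "continuous_on S g \<Longrightarrow> continuous_on S (\<lambda>x. plane_param (g x))"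
  using plane_param_linear by (simp add: linear_conv_bounded_linear bounded_linear.continuous_on)

lemma norm_plane_param: "norm (plane_param z) = cmod z"
  by (simp add: plane_param_def norm_vec_def L2_set_def sum_2 cmod_def)

text \<open>This and \<open>antihol_part\<close> are the Wirtinger derivatives of the linear map of
  \<open>A\<close>, its coefficients at \<open>z\<close> and \<open>cnj z\<close>.\<close>

definition hol_part :: "real^2^2 \<Rightarrow> complex" where
  "hol_part A = Complex ((A $ 1 $ 1 + A $ 2 $ 2) / 2) ((A $ 2 $ 1 - A $ 1 $ 2) / 2)"

definition antihol_part :: "real^2^2 \<Rightarrow> complex" where
  "antihol_part A = Complex ((A $ 1 $ 1 - A $ 2 $ 2) / 2) ((A $ 2 $ 1 + A $ 1 $ 2) / 2)"

lemma to_complex_matrix: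
  "to_complex (A *v x) = hol_part A * to_complex x + antihol_part A * cnj (to_complex x)"
  by (simp add: to_complex_def hol_part_def antihol_part_def matrix_vector_mult_def sum_2
      complex_eq_iff field_simps)

lemma det_hol_parts: "det A = (cmod (hol_part A))\<^sup>2 - (cmod (antihol_part A))\<^sup>2"
  unfolding cmod_power2 by (simp add: det_2 hol_part_def antihol_part_def field_simps power2_eq_square)

lemma hol_parts_distinct: "det A \<noteq> 0 \<Longrightarrow> cmod (hol_part A) \<noteq> cmod (antihol_part A)"
  by (auto simp: det_hol_parts)

lemma hol_parts_sign:
  "real_linear_sign (hol_part A) (antihol_part A) = (if det A > 0 then 1 else - 1)"
  unfolding real_linear_sign_def det_hol_parts
  by (simp add: power_mono_iff[of _ _ 2] flip: not_le)

text \<open>Injectivity on the sphere only puts two points with equal image under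
  \<open>K (u, _)\<close> in one fibre. Equivariance then shows that the deck transformation
  relating them is trivial, or else that their common image lies in \<open>L\<close>.\<close>

lemma (in orbifold_covering) lift_isotopy:
  fixes H :: "real \<times> (real^3) \<Rightarrow> real^3" and A :: "real^2^2" and c :: "real^2"
  assumes H: "continuous_on ({0..1} \<times> S2) H"
    and H0: "\<And>x. H (0, p x) = p (A *v x + c)"
    and Him: "\<And>u y. u \<in> {0..1} \<Longrightarrow> y \<in> S2 - p ` L \<Longrightarrow> H (u, y) \<in> S2 - p ` L"
    and Hinj: "\<And>u. u \<in> {0..1} \<Longrightarrow> inj_on (\<lambda>y. H (u, y)) S2"
    and A: "\<And>x. A *v x = 0 \<Longrightarrow> x = 0" and AL: "\<And>l. l \<in> L \<Longrightarrow> A *v l \<in> L" and c: "c \<in> L"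
    and Ac: "\<And>x. A *v x + c \<in> L \<Longrightarrow> x \<in> L"
  obtains K :: "real \<times> (real^2) \<Rightarrow> real^2"
  where "continuous_on ({0..1} \<times> (- L)) K" "\<And>u x. u \<in> {0..1} \<Longrightarrow> x \<notin> L \<Longrightarrow> K (u, x) \<notin> L"
    "\<And>x. x \<notin> L \<Longrightarrow> K (0, x) = A *v x + c"
    "\<And>u x. u \<in> {0..1} \<Longrightarrow> x \<notin> L \<Longrightarrow> p (K (u, x)) = H (u, p x)"
    "\<And>u. u \<in> {0..1} \<Longrightarrow> inj_on (\<lambda>x. K (u, x)) (- L)"
proof -
  have pS: "p x \<in> S2" for x using surj by blast
  let ?h = "\<lambda>z. H (fst z, p (snd z))"
  have h1: "continuous_on ({0..1} \<times> (- L)) ?h"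
    by (intro continuous_on_compose2[OF H] continuous_intros continuous_on_compose2[OF continuous])
      (use pS in auto)
  have h2: "?h \<in> {0..1} \<times> (- L) \<rightarrow> S2 - p ` L"
    by (intro Pi_I Him p_in) auto
  have h3: "?h (0, y) = p (A *v y + c)" for y using H0 by simp
  have cont: "continuous_on (- L) (\<lambda>x. A *v x + c)"
    by (intro continuous_intros)
  have im: "(\<lambda>x. A *v x + c) \<in> - L \<rightarrow> - L" using Ac by auto
  obtain K :: "real \<times> (real^2) \<Rightarrow> real^2" where K: "continuous_on ({0..1} \<times> (- L)) K"
    "K \<in> {0..1} \<times> (- L) \<rightarrow> - L" "\<And>y. y \<in> - L \<Longrightarrow> K (0, y) = A *v y + c"
    "\<And>z. z \<in> {0..1} \<times> (- L) \<Longrightarrow> ?h z = p (K z)"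
    by (rule covering_space_lift_homotopy[OF covering h1 h2 h3 cont im]) (rule that)
  have KL: "K (u, x) \<notin> L" if "u \<in> {0..1}" "x \<notin> L" for u x
    using funcset_mem[OF K(2), of "(u, x)"] that by auto
  have pK: "p (K (u, x)) = H (u, p x)" if "u \<in> {0..1}" "x \<notin> L" for u x
    using K(4)[of "(u, x)"] that by simp
  have contK: "continuous_on {0..1} (\<lambda>u. K (u, x))" if "x \<notin> L" for x
    by (intro continuous_on_compose2[OF K(1)] continuous_intros) (use that in auto)
  have inj: "inj_on (\<lambda>x. K (u, x)) (- L)" if u: "u \<in> {0..1}" for u
  proof
    fix x y assume x: "x \<in> - L" and y: "y \<in> - L" and eq: "K (u, x) = K (u, y)"
    have "H (u, p x) = H (u, p y)" using pK[OF u] x y eq by (metis ComplD)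
    then have pxy: "p x = p y" using inj_onD[OF Hinj[OF u] _ pS pS] by blast
    then obtain \<epsilon> l where l: "l \<in> L" "\<epsilon> = 1 \<or> \<epsilon> = - 1" "y = \<epsilon> *\<^sub>R x + 2 *\<^sub>R l"
      by (rule fibre_cases)
    \<comment> \<open>Chosen so that the affine map takes
      \<open>\<epsilon> *\<^sub>R x + 2 *\<^sub>R l\<close> to
      \<open>\<epsilon> *\<^sub>R (A *v x + c) + 2 *\<^sub>R m\<close>; for a half turn the sign
      change of \<open>c\<close> contributes the extra \<open>c\<close>.\<close>
    define m where "m = (if \<epsilon> = 1 then A *v l else c + A *v l)"
    have m: "m \<in> L" using l AL c L_add by (auto simp: m_def)
    \<comment> \<open>The lifted isotopy is equivariant, because it is so at time 0.\<close>
    have equiv: "K (v, y) = \<epsilon> *\<^sub>R K (v, x) + 2 *\<^sub>R m" if v: "v \<in> {0..1}" for v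
    proof (rule lift_unique[where T = "{0..1}" and a = 0 and g = "\<lambda>v. K (v, y)"
          and h = "\<lambda>v. \<epsilon> *\<^sub>R K (v, x) + 2 *\<^sub>R m"])
      show "p (K (v, y)) = p (\<epsilon> *\<^sub>R K (v, x) + 2 *\<^sub>R m)" if v: "v \<in> {0..1}" for v
        using pK[OF v] x y pxy same_deck[OF m l(2)] by simp
      show "K (0, y) = \<epsilon> *\<^sub>R K (0, x) + 2 *\<^sub>R m"
        using K(3)[OF x] K(3)[OF y] l(2)
        by (auto simp: l(3) m_def matrix_vector_right_distrib matrix_vector_mult_diff_distrib
            matrix_vector_mult_scaleR scaleR_add_right scaleR_2[of c])
      show "\<epsilon> *\<^sub>R K (v, x) + 2 *\<^sub>R m \<notin> L" if v: "v \<in> {0..1}" for v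
        using KL[OF v, of x] x same_deck[OF m l(2), of "K (v, x)"] image_L_iff by (metis ComplD)
      show "continuous_on {0..1} (\<lambda>v. \<epsilon> *\<^sub>R K (v, x) + 2 *\<^sub>R m)"
        using contK x by (intro continuous_intros) auto
    qed (use v contK KL y in auto)
    show "x = y"
      using l(2)
    proof
      assume \<epsilon>: "\<epsilon> = 1"
      then have "A *v l = 0" using equiv[OF u] eq by (simp add: m_def)
      then have "l = 0" by (rule A)
      then show ?thesis using l(3) \<epsilon> by simp
    next
      assume \<epsilon>: "\<epsilon> = - 1"
      then have "2 *\<^sub>R K (u, x) = 2 *\<^sub>R m" using equiv[OF u] eq by (simp add: scaleR_2)
      then have "K (u, x) \<in> L" using m by simp
      then show ?thesis using KL[OF u] x by blast
    qed
  qed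
  show thesis by (rule that[OF K(1)]) (use KL K(3) pK inj in auto)
qed

section \<open>Comparison of orientations through lifted discs\<close>

context orbifold_pair
begin

text \<open>The track of a disc moved along \<open>g\<close> is parametrized by a contractible set,
  so \<open>p1\<close> lifts through \<open>p2\<close> there. Each \<open>S (u, _)\<close>
  translates locally between the two coordinate systems and inherits injectivity from
  \<open>p1\<close> on small discs.\<close>

lemma lift_disc_along_path:
  assumes g: "path g" "path_image g \<inter> Z2 = {}"
  obtains \<rho> S where "\<rho> > 0" "continuous_on ({0..1} \<times> cball 0 \<rho>) S"
    "\<And>u z. u \<in> {0..1} \<Longrightarrow> z \<in> cball 0 \<rho> \<Longrightarrow> S (u, z) \<notin> Z2"
    "\<And>u z. u \<in> {0..1} \<Longrightarrow> z \<in> cball 0 \<rho> \<Longrightarrow> p2 (S (u, z)) = p1 (g u + plane_param z)"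
    "\<And>u. u \<in> {0..1} \<Longrightarrow> inj_on (\<lambda>z. S (u, z)) (cball 0 \<rho>)"
proof -
  obtain e where e: "e > 0" "\<And>x y. x \<in> path_image g \<Longrightarrow> y \<in> Z2 \<Longrightarrow> e \<le> dist x y"
    using separate_compact_closed[OF compact_path_image[OF g(1)] closed_subset_Z2[OF subset_refl] g(2)]
    by blast
  \<comment> \<open>Being less than \<open>e\<close> keeps the moving disc off \<open>Z2\<close> and
    excludes half turns between its points; being less than 1 excludes translations.\<close>
  define \<rho> where "\<rho> = min (e / 2) (1 / 2)"
  have \<rho>: "\<rho> > 0" "\<rho> < e" "\<rho> < 1" using e(1) by (auto simp: \<rho>_def)
  have gu: "g u \<in> path_image g" if "u \<in> {0..1}" for u using that by (simp add: path_image_def)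
  have off: "g u + plane_param z \<notin> Z2" if "u \<in> {0..1}" "z \<in> cball 0 \<rho>" for u z
  proof
    assume "g u + plane_param z \<in> Z2"
    then have "e \<le> dist (g u) (g u + plane_param z)" using e(2)[OF gu[OF that(1)]] by blast
    then show False using \<rho>(2) that(2) by (simp add: dist_norm norm_plane_param)
  qed
  let ?U = "{0..1::real} \<times> cball (0::complex) \<rho>"
  let ?F = "\<lambda>z. p1 (g (fst z) + plane_param (snd z))"
  have U: "convex ?U" by (intro convex_Times) auto
  have "continuous_on ?U (\<lambda>z. g (fst z))"
    using g(1) unfolding path_def
    by (rule continuous_on_compose2[where t = "{0..1}"]) (auto intro: continuous_intros)
  then have "continuous_on ?U (\<lambda>z. g (fst z) + plane_param (snd z))"
    by (intro continuous_intros)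
  then have contF: "continuous_on ?U ?F"
    by (rule continuous_on_compose2[OF o1.continuous]) simp
  have imF: "?F \<in> ?U \<rightarrow> S2 - P" using off by (intro Pi_I p1_not_in_P) auto
  obtain S where S: "continuous_on ?U S" "S \<in> ?U \<rightarrow> - Z2" "\<And>y. y \<in> ?U \<Longrightarrow> p2 (S y) = ?F y"
    by (rule covering_space_lift[OF o2.covering convex_imp_simply_connected[OF U]
          convex_imp_locally_path_connected[OF U] contF imF]) (rule that)
  have SZ: "S (u, z) \<notin> Z2" if "u \<in> {0..1}" "z \<in> cball 0 \<rho>" for u z
    using funcset_mem[OF S(2), of "(u, z)"] that by auto
  have inj: "inj_on (\<lambda>z. S (u, z)) (cball 0 \<rho>)" if u: "u \<in> {0..1}" for u
  proof
    fix z w assume z: "z \<in> cball 0 \<rho>" and w: "w \<in> cball 0 \<rho>" and eq: "S (u, z) = S (u, w)"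
    have "p1 (g u + plane_param z) = p1 (g u + plane_param w)"
      using S(3)[of "(u, z)"] S(3)[of "(u, w)"] u z w eq by simp
    then obtain l where l: "l \<in> L1" "g u + plane_param w = 2 *\<^sub>R l + (g u + plane_param z)
        \<or> g u + plane_param w = 2 *\<^sub>R l - (g u + plane_param z)"
      using o1.eq_iff by blast
    have n: "norm (plane_param z) \<le> \<rho>" "norm (plane_param w) \<le> \<rho>"
      using z w by (simp_all add: norm_plane_param)
    from l(2) have "plane_param w = plane_param z"
    proof
      assume "g u + plane_param w = 2 *\<^sub>R l + (g u + plane_param z)"
      then have "2 *\<^sub>R l = plane_param w - plane_param z" by (simp add: algebra_simps)
      then have "norm (2 *\<^sub>R l) \<le> 2 * \<rho>"
        using n norm_triangle_ineq4[of "plane_param w" "plane_param z"] by simp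
      then have "norm l < 1" using \<rho>(3) by simp
      then have "l = 0" using l(1) o1.L_Z2 Z2_norm_less_1 by blast
      then show ?thesis using \<open>2 *\<^sub>R l = _\<close> by simp
    next
      assume "g u + plane_param w = 2 *\<^sub>R l - (g u + plane_param z)"
      then have "2 *\<^sub>R (l - g u) = plane_param w + plane_param z" by (simp add: algebra_simps scaleR_2)
      then have "norm (2 *\<^sub>R (l - g u)) \<le> 2 * \<rho>"
        using n norm_triangle_ineq[of "plane_param w" "plane_param z"] by simp
      then have "dist (g u) l \<le> \<rho>" by (simp add: dist_norm norm_minus_commute)
      moreover have "e \<le> dist (g u) l" using e(2)[OF gu[OF u]] l(1) o1.L_Z2 by blast
      ultimately show ?thesis using \<rho>(2) by simp
    qed
    then have "norm (plane_param (w - z)) = 0"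
      using linear_diff[OF plane_param_linear, of w z] by simp
    then show "z = w" by (simp add: norm_plane_param)
  qed
  show thesis by (rule that[OF \<rho>(1) S(1)]) (use SZ S(3) inj in auto)
qed

text \<open>
  Local lifts \<open>\<sigma>\<close>, \<open>\<sigma>'\<close> of \<open>p1\<close> through \<open>p2\<close> near a point and near its image have the
  same local degree, since the disc can be moved from one point to the other.  The lifted
  isotopy carries \<open>\<sigma>\<close>, composed with the affine map of \<open>A\<close>, to \<open>\<sigma>'\<close>, precomposed with the
  one of \<open>B\<close>.
\<close>

lemma same_orientation:
  fixes H :: "real \<times> (real^3) \<Rightarrow> real^3" and A B :: "real^2^2" and b c :: "real^2"
  assumes H: "continuous_on ({0..1} \<times> S2) H"
    and H0: "\<And>x. H (0, p2 x) = p2 (A *v x + c)"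
    and H1: "\<And>x. H (1, p1 x) = p1 (B *v x + b)"
    and Him: "\<And>u y. u \<in> {0..1} \<Longrightarrow> y \<in> S2 - P \<Longrightarrow> H (u, y) \<in> S2 - P"
    and Hinj: "\<And>u. u \<in> {0..1} \<Longrightarrow> inj_on (\<lambda>y. H (u, y)) S2"
    and A: "det A \<noteq> 0" and AZ: "\<And>l. l \<in> Z2 \<Longrightarrow> A *v l \<in> Z2" and c: "c \<in> Z2"
    and Ac: "\<And>x. A *v x + c \<in> Z2 \<Longrightarrow> x \<in> Z2"
    and B: "det B \<noteq> 0" and Bb: "\<And>x. B *v x + b \<in> Z2 \<Longrightarrow> x \<in> Z2"
  shows "det A > 0 \<longleftrightarrow> det B > 0"
proof -
  have A0: "x = 0" if "A *v x = 0" for x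
    using that A by (metis invertible_det_nz invertible_def matrix_left_invertible_ker)
  obtain K where K: "continuous_on ({0..1} \<times> (- Z2)) K"
    "\<And>u x. u \<in> {0..1} \<Longrightarrow> x \<notin> Z2 \<Longrightarrow> K (u, x) \<notin> Z2"
    "\<And>x. x \<notin> Z2 \<Longrightarrow> K (0, x) = A *v x + c"
    "\<And>u x. u \<in> {0..1} \<Longrightarrow> x \<notin> Z2 \<Longrightarrow> p2 (K (u, x)) = H (u, p2 x)"
    "\<And>u. u \<in> {0..1} \<Longrightarrow> inj_on (\<lambda>x. K (u, x)) (- Z2)"
    by (rule o2.lift_isotopy[OF H H0 Him Hinj A0 AZ c Ac]) (assumption+, rule that)
  have "path_connected (- Z2)"
    using countable_Z2 by (intro path_connected_complement_countable) auto
  define x0 where "x0 = (1 / 2) *\<^sub>R e1"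
  have "norm x0 = 1 / 2" by (simp add: x0_def e1_def)
  then have x0: "x0 \<notin> Z2" using Z2_norm_less_1[of x0] by auto
  define x1 where "x1 = B *v x0 + b"
  have "x1 \<notin> Z2" using x0 Bb unfolding x1_def by blast
  then obtain g where g: "path g" "path_image g \<inter> Z2 = {}" "g 0 = x0" "g 1 = x1"
    using \<open>path_connected (- Z2)\<close> x0 unfolding path_connected_def pathstart_def pathfinish_def by blast
  obtain \<rho> S where \<rho>: "\<rho> > 0" and S: "continuous_on ({0..1} \<times> cball 0 \<rho>) S"
    "\<And>u z. u \<in> {0..1} \<Longrightarrow> z \<in> cball 0 \<rho> \<Longrightarrow> S (u, z) \<notin> Z2"
    "\<And>u z. u \<in> {0..1} \<Longrightarrow> z \<in> cball 0 \<rho> \<Longrightarrow> p2 (S (u, z)) = p1 (g u + plane_param z)"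
    "\<And>u. u \<in> {0..1} \<Longrightarrow> inj_on (\<lambda>z. S (u, z)) (cball 0 \<rho>)"
    by (rule lift_disc_along_path[OF g(1,2)]) (rule that)
  define \<sigma> where "\<sigma> = (\<lambda>z. S (0, z))"
  define \<sigma>' where "\<sigma>' = (\<lambda>z. S (1, z))"
  have cont\<sigma>: "continuous_on (cball 0 \<rho>) \<sigma>" "continuous_on (cball 0 \<rho>) \<sigma>'"
    unfolding \<sigma>_def \<sigma>'_def by (intro continuous_on_compose2[OF S(1)] continuous_intros; auto)+
  \<comment> \<open>The linear map of \<open>B\<close> in complex coordinates. \<open>M\<close>
    bounds its norm and is the constant that \<open>winding_number_inner_real_linear\<close> asks
    for.\<close>
  define LB where "LB = (\<lambda>z. hol_part B * z + antihol_part B * cnj z)"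
  define M where "M = 2 * (cmod (hol_part B) + cmod (antihol_part B) + 1)"
  have M: "M \<ge> 1" by (simp add: M_def)
  define r where "r = \<rho> / M"
  have r: "r > 0" "M * r \<le> \<rho>" using \<rho> M by (simp_all add: r_def)
  have "1 * r \<le> M * r" using M r by (intro mult_right_mono) auto
  then have r\<rho>: "r \<le> \<rho>" using r by linarith
  have LB: "LB z \<in> cball 0 \<rho>" if "z \<in> cball 0 r" for z
  proof -
    have "cmod (LB z) \<le> cmod (hol_part B) * cmod z + cmod (antihol_part B) * cmod z"
      using norm_triangle_ineq[of "hol_part B * z" "antihol_part B * cnj z"]
      by (simp add: LB_def norm_mult)
    also have "\<dots> \<le> M * cmod z" by (simp add: M_def algebra_simps)
    also have "\<dots> \<le> M * r" using that M by (intro mult_left_mono) auto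
    finally show ?thesis using r by simp
  qed
  have ppLB: "B *v plane_param z = plane_param (LB z)" for z
    by (simp add: plane_param_def LB_def hol_part_def antihol_part_def matrix_vector_mult_def sum_2
      vec_eq_iff forall_2 field_simps)
  \<comment> \<open>Both sides lie over the same point: \<open>H (1, _)\<close> acts through
    \<open>p1\<close> as the affine map of \<open>B\<close>, while \<open>\<sigma>\<close> and
    \<open>\<sigma>'\<close> translate between \<open>p1\<close> and \<open>p2\<close> near
    \<open>x0\<close> and \<open>x1\<close>.\<close>
  have p2K: "p2 (K (1, \<sigma> z)) = p2 (\<sigma>' (LB z))" if z: "z \<in> cball 0 r" for z
  proof -
    have z\<rho>: "z \<in> cball 0 \<rho>" using z r\<rho> by simp
    have "p2 (K (1, \<sigma> z)) = H (1, p2 (\<sigma> z))" unfolding \<sigma>_def using S(2) z\<rho> by (intro K(4)) auto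
    also have "\<dots> = p1 (B *v (x0 + plane_param z) + b)"
      unfolding \<sigma>_def using S(3)[of 0 z] z\<rho> g(3) H1 by simp
    also have "B *v (x0 + plane_param z) + b = x1 + plane_param (LB z)"
      by (simp add: x1_def matrix_vector_right_distrib ppLB)
    also have "p1 \<dots> = p2 (\<sigma>' (LB z))"
      unfolding \<sigma>'_def using S(3)[of 1 "LB z"] LB[OF z] g(4) by simp
    finally show ?thesis .
  qed
  have LB0: "LB 0 = 0" by (simp add: LB_def)
  have "p2 (K (1, \<sigma> 0)) = p2 (\<sigma>' 0)" using p2K[of 0] r LB0 by simp
  then obtain \<epsilon> l where l: "l \<in> Z2" "\<epsilon> = 1 \<or> \<epsilon> = - 1" "\<sigma>' 0 = \<epsilon> *\<^sub>R K (1, \<sigma> 0) + 2 *\<^sub>R l"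
    by (rule o2.fibre_cases)
  have \<sigma>Z: "\<sigma> z \<notin> Z2" "\<sigma>' z \<notin> Z2" if "z \<in> cball 0 \<rho>" for z
    using S(2)[OF _ that] by (auto simp: \<sigma>_def \<sigma>'_def)
  have contK: "continuous_on T (\<lambda>z. K (k z, s z))"
    if "continuous_on T k" "continuous_on T s" "\<And>z. z \<in> T \<Longrightarrow> k z \<in> {0..1}" "\<And>z. z \<in> T \<Longrightarrow> s z \<notin> Z2"
    for T and k :: "'c::topological_space \<Rightarrow> real" and s
    using that by (intro continuous_on_compose2[OF K(1)] continuous_intros) auto
  have \<sigma>'K: "\<sigma>' (LB z) = \<epsilon> *\<^sub>R K (1, \<sigma> z) + 2 *\<^sub>R l" if z: "z \<in> cball 0 r" for z
  proof (rule o2.lift_unique[where T = "cball 0 r" and a = 0 and g = "\<lambda>z. \<sigma>' (LB z)"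
        and h = "\<lambda>z. \<epsilon> *\<^sub>R K (1, \<sigma> z) + 2 *\<^sub>R l"])
    show "continuous_on (cball 0 r) (\<lambda>z. \<sigma>' (LB z))"
    proof (rule continuous_on_compose2[OF cont\<sigma>(2)])
      show "continuous_on (cball 0 r) LB" unfolding LB_def by (intro continuous_intros)
    qed (use LB in blast)
    show "continuous_on (cball 0 r) (\<lambda>z. \<epsilon> *\<^sub>R K (1, \<sigma> z) + 2 *\<^sub>R l)"
      using r\<rho> \<sigma>Z by (intro continuous_intros contK continuous_on_subset[OF cont\<sigma>(1)]) auto
    show "p2 (\<sigma>' (LB z)) = p2 (\<epsilon> *\<^sub>R K (1, \<sigma> z) + 2 *\<^sub>R l)" if "z \<in> cball 0 r" for z
      using p2K[OF that] o2.same_deck[OF l(1,2)] by simp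
    show "\<epsilon> *\<^sub>R K (1, \<sigma> z) + 2 *\<^sub>R l \<notin> Z2" if "z \<in> cball 0 r" for z
    proof -
      have "K (1, \<sigma> z) \<notin> Z2" using that r\<rho> by (intro K(2) \<sigma>Z) auto
      then show ?thesis using o2.same_deck[OF l(1,2), of "K (1, \<sigma> z)"] o2.image_L_iff by metis
    qed
    show "\<sigma>' (LB z) \<notin> Z2" if "z \<in> cball 0 r" for z using \<sigma>Z(2) LB that by blast
  qed (use z r l(3) LB0 in auto)

  let ?c = "circlepath 0 r"
  let ?C = "to_complex"
  have circ: "?c t \<in> cball 0 \<rho>" "?c t \<in> cball 0 r" "?c t \<noteq> 0" for t
    using r r\<rho> by (auto simp: circlepath norm_mult)
  have contc: "continuous_on T (\<lambda>z. ?c (k z))" if "continuous_on T k"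
    for T and k :: "'c::topological_space \<Rightarrow> real"
    using that unfolding circlepath by (intro continuous_intros)
  have c01: "?c 1 = ?c 0" by (simp add: circlepath mult.commute)
  have z0: "0 \<in> cball (0::complex) \<rho>" using \<rho> by simp
  have \<sigma>c: "\<sigma> (?c t) \<noteq> \<sigma> 0" for t
    using inj_onD[OF S(4)[of 0], of "?c t" 0] circ z0 by (auto simp: \<sigma>_def simp del: mem_cball_0)
  define \<beta> where "\<beta> = (\<lambda>t. ?C (\<sigma> (?c t)) - ?C (\<sigma> 0))"
  have cont\<sigma>c: "continuous_on T (\<lambda>z. \<sigma> (?c (k z)))" if "continuous_on T k"
    for T and k :: "'c::topological_space \<Rightarrow> real"
    using circ by (intro continuous_on_compose2[OF cont\<sigma>(1)] contc that) (auto simp del: mem_cball_0)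
  have \<beta>: "path \<beta>" "pathfinish \<beta> = pathstart \<beta>" "0 \<notin> path_image \<beta>"
    unfolding \<beta>_def path_def using c01 \<sigma>c
    by (auto intro!: continuous_intros cont\<sigma>c simp: pathfinish_def pathstart_def path_image_def to_complex_eq_iff)
  \<comment> \<open>The value itself never matters: the chain below equates the sign of
    \<open>det A\<close> times this number with the sign of \<open>det B\<close> times it, and a
    nonzero factor cancels.\<close>
  have N0: "winding_number \<beta> 0 \<noteq> 0"
    unfolding \<beta>_def
  proof (rule winding_number_injective_nonzero)
    show "continuous_on (cball 0 r) (\<lambda>z. ?C (\<sigma> z))"
      using r\<rho> by (intro continuous_intros continuous_on_subset[OF cont\<sigma>(1)]) auto
    show "inj_on (\<lambda>z. ?C (\<sigma> z)) (cball 0 r)"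
      using inj_on_subset[OF S(4)[of 0] subset_cball[OF r\<rho>]]
      by (auto simp: inj_on_def to_complex_eq_iff \<sigma>_def)
  qed (fact r(1))

  have "winding_number (\<lambda>t. ?C (K (0, \<sigma> (?c t))) - ?C (K (0, \<sigma> 0))) 0
      = real_linear_sign (hol_part A) (antihol_part A) * winding_number \<beta> 0"
  proof -
    have "?C (K (0, \<sigma> (?c t))) - ?C (K (0, \<sigma> 0)) = hol_part A * \<beta> t + antihol_part A * cnj (\<beta> t)" for t
      using K(3)[OF \<sigma>Z(1)[OF circ(1)]] K(3)[OF \<sigma>Z(1)[OF z0]]
      by (simp add: \<beta>_def linear_add[OF to_complex_linear] to_complex_matrix algebra_simps)
    then show ?thesis using winding_number_real_linear[OF hol_parts_distinct[OF A] \<beta>] by simp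
  qed
  moreover have "winding_number (\<lambda>t. ?C (K (0, \<sigma> (?c t))) - ?C (K (0, \<sigma> 0))) 0 =
      winding_number (\<lambda>t. ?C (K (1, \<sigma> (?c t))) - ?C (K (1, \<sigma> 0))) 0"
  proof (rule winding_number_homotopy)
    show "continuous_on ({0..1} \<times> {0..1}) (\<lambda>z. ?C (K (fst z, \<sigma> (?c (snd z)))) - ?C (K (fst z, \<sigma> 0)))"
      using \<sigma>Z circ z0 by (intro continuous_intros contK cont\<sigma>c) auto
    show "?C (K (u, \<sigma> (?c t))) - ?C (K (u, \<sigma> 0)) \<noteq> 0" if u: "u \<in> {0..1}" for u t
      using inj_onD[OF K(5)[OF u]] \<sigma>Z(1)[OF circ(1)] \<sigma>Z(1)[OF z0] \<sigma>c by (auto simp: to_complex_eq_iff)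
    show "?C (K (u, \<sigma> (?c 1))) - ?C (K (u, \<sigma> 0)) = ?C (K (u, \<sigma> (?c 0))) - ?C (K (u, \<sigma> 0))" for u
      by (simp only: c01)
  qed
  moreover have "winding_number (\<lambda>t. ?C (\<sigma>' (LB (?c t))) - ?C (\<sigma>' 0)) 0 =
      winding_number (\<lambda>t. ?C (K (1, \<sigma> (?c t))) - ?C (K (1, \<sigma> 0))) 0"
  proof -
    let ?\<gamma> = "\<lambda>t. ?C (K (1, \<sigma> (?c t))) - ?C (K (1, \<sigma> 0))"
    \<comment> \<open>A half turn is multiplication by \<open>-1\<close>, a real-linear map of
      positive determinant, so the deck transformation leaves the winding number unchanged.\<close>
    have "?C (\<sigma>' (LB (?c t))) - ?C (\<sigma>' 0) = of_real \<epsilon> * ?\<gamma> t + 0 * cnj (?\<gamma> t)" for t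
      by (simp add: \<sigma>'K[OF circ(2)] l(3) linear_add[OF to_complex_linear]
          linear_scale[OF to_complex_linear] scaleR_conv_of_real[where 'a = complex] algebra_simps)
    moreover have "cmod (of_real \<epsilon>) \<noteq> cmod 0" "real_linear_sign (of_real \<epsilon>) 0 = 1"
      using l(2) by (auto simp: real_linear_sign_def)
    moreover have "path ?\<gamma>" unfolding path_def
      using \<sigma>Z circ z0 by (intro continuous_intros contK cont\<sigma>c) auto
    moreover have "pathfinish ?\<gamma> = pathstart ?\<gamma>"
      by (simp add: pathfinish_def pathstart_def c01)
    moreover have "0 \<notin> path_image ?\<gamma>"
    proof -
      have "K (1, \<sigma> (?c t)) \<noteq> K (1, \<sigma> 0)" for t
        using inj_onD[OF K(5)[of 1], of "\<sigma> (?c t)" "\<sigma> 0"] \<sigma>Z(1)[OF circ(1)] \<sigma>Z(1)[OF z0] \<sigma>c by auto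
      then show ?thesis by (auto simp: to_complex_eq_iff path_image_def)
    qed
    ultimately show ?thesis using winding_number_real_linear[of "of_real \<epsilon>" 0 ?\<gamma>] by simp
  qed
  moreover have "winding_number (\<lambda>t. ?C (\<sigma>' (LB (?c t))) - ?C (\<sigma>' 0)) 0 =
      real_linear_sign (hol_part B) (antihol_part B) * winding_number (\<lambda>t. ?C (\<sigma>' (?c t)) - ?C (\<sigma>' 0)) 0"
    unfolding LB_def
  proof (rule winding_number_inner_real_linear[OF hol_parts_distinct[OF B]])
    show "continuous_on (cball 0 \<rho>) (\<lambda>z. ?C (\<sigma>' z))" by (intro continuous_intros cont\<sigma>)
    show "?C (\<sigma>' z) \<noteq> ?C (\<sigma>' 0)" if "z \<in> cball 0 \<rho>" "z \<noteq> 0" for z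
      using inj_onD[OF S(4)[of 1] _ that(1) z0] that(2) by (auto simp: \<sigma>'_def to_complex_eq_iff)
  qed (use r M_def in auto)
  moreover have "winding_number \<beta> 0 = winding_number (\<lambda>t. ?C (\<sigma>' (?c t)) - ?C (\<sigma>' 0)) 0"
    unfolding \<beta>_def \<sigma>_def \<sigma>'_def
  proof (rule winding_number_homotopy)
    show "continuous_on ({0..1} \<times> {0..1}) (\<lambda>z. ?C (S (fst z, ?c (snd z))) - ?C (S (fst z, 0)))"
      using circ z0 by (intro continuous_intros continuous_on_compose2[OF S(1)] contc)
        (auto simp del: mem_cball_0)
    show "?C (S (u, ?c t)) - ?C (S (u, 0)) \<noteq> 0" if u: "u \<in> {0..1}" for u t
      using inj_onD[OF S(4)[OF u] _ circ(1) z0] circ(3) by (auto simp: to_complex_eq_iff)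
    show "?C (S (u, ?c 1)) - ?C (S (u, 0)) = ?C (S (u, ?c 0)) - ?C (S (u, 0))" for u
      by (simp only: c01)
  qed
  ultimately have "real_linear_sign (hol_part A) (antihol_part A) =
      real_linear_sign (hol_part B) (antihol_part B)"
    using N0 by simp
  then show ?thesis unfolding hol_parts_sign by (auto split: if_splits)
qed

end

section \<open>Curves under homeomorphisms of the marked sphere\<close>

lemma homeomorphism_complement:
  assumes h: "homeomorphism X X h k" and P: "P \<subseteq> X" "h ` P = P"
  shows "homeomorphism (X - P) (X - P) h k"
proof (rule homeomorphism_of_subsets[OF h])
  have "inj_on h X" using homeomorphism_apply1[OF h] by (rule inj_on_inverseI)
  then show "h ` (X - P) = X - P"
    using inj_on_image_set_diff[of h X X P] homeomorphism_image1[OF h] P by simp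
qed auto

lemma simple_closed_curve_in_homeomorphism:
  assumes h: "homeomorphism X X h k" and \<gamma>: "simple_closed_curve_in X \<gamma>"
  shows "simple_closed_curve_in X (h \<circ> \<gamma>)"
proof -
  have sub: "path_image \<gamma> \<subseteq> X" using \<gamma> by (simp add: simple_closed_curve_in_def)
  have "inj_on h X" using homeomorphism_apply1[OF h] by (rule inj_on_inverseI)
  then have "simple_path (h \<circ> \<gamma>)"
    using \<gamma> continuous_on_subset[OF homeomorphism_cont1[OF h] sub] inj_on_subset[OF _ sub]
    by (intro simple_path_continuous_image) (simp_all add: simple_closed_curve_in_def)
  moreover have "path_image (h \<circ> \<gamma>) \<subseteq> X"
    using image_mono[OF sub, of h] homeomorphism_image1[OF h] by (simp add: path_image_compose)
  ultimately show ?thesis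
    using \<gamma> by (simp add: simple_closed_curve_in_def pathfinish_compose pathstart_compose)
qed

lemma homotopic_loops_inverse_homeomorphism:
  assumes h: "homeomorphism X X h k" and \<gamma>: "path \<gamma>" "pathfinish \<gamma> = pathstart \<gamma>" "path_image \<gamma> \<subseteq> X"
    and hom: "homotopic_loops X (h \<circ> \<gamma>) \<delta>"
  shows "homotopic_loops X \<gamma> (k \<circ> \<delta>)"
proof (rule homotopic_loops_trans)
  show "homotopic_loops X \<gamma> (k \<circ> (h \<circ> \<gamma>))"
  proof (rule homotopic_loops_eq[OF \<gamma>(1,3,2)])
    fix t :: real assume t: "t \<in> {0..1}"
    have "\<gamma> t \<in> X" using subsetD[OF \<gamma>(3)[unfolded path_image_def] imageI[OF t]] .
    then show "\<gamma> t = (k \<circ> (h \<circ> \<gamma>)) t" using homeomorphism_apply1[OF h] by simp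
  qed
  have "k \<in> X \<rightarrow> X" using homeomorphism_image2[OF h] by (intro funcsetI) blast
  then show "homotopic_loops X (k \<circ> (h \<circ> \<gamma>)) (k \<circ> \<delta>)"
    using homotopic_loops_continuous_image[OF hom homeomorphism_cont2[OF h]] by simp
qed

lemma essential_homeomorphism:
  assumes h: "homeomorphism S2 S2 h k" and P: "P \<subseteq> S2" "h ` P = P"
    and \<gamma>: "path \<gamma>" "pathfinish \<gamma> = pathstart \<gamma>" "path_image \<gamma> \<subseteq> S2 - P"
    and ess: "essential P \<gamma>"
  shows "essential P (h \<circ> \<gamma>)"
  unfolding essential_def
proof (intro allI notI)
  fix a assume "homotopic_loops (S2 - P) (h \<circ> \<gamma>) (\<lambda>t. a)"
  from homotopic_loops_inverse_homeomorphism[OF homeomorphism_complement[OF h P] \<gamma> this]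
  have "homotopic_loops (S2 - P) \<gamma> (\<lambda>t. k a)" by (simp add: o_def)
  then show False using ess unfolding essential_def by blast
qed

lemma peripheral_homeomorphism:
  assumes h: "homeomorphism S2 S2 h k" and P: "P \<subseteq> S2" "h ` P = P"
    and \<gamma>: "path \<gamma>" "pathfinish \<gamma> = pathstart \<gamma>" "path_image \<gamma> \<subseteq> S2 - P"
    and per: "peripheral P (h \<circ> \<gamma>)"
  shows "peripheral P \<gamma>"
proof -
  obtain p where p: "p \<in> P"
    and W: "\<And>W. open W \<Longrightarrow> p \<in> W \<Longrightarrow>
      \<exists>\<delta>. path_image \<delta> \<subseteq> W \<and> homotopic_loops (S2 - P) (h \<circ> \<gamma>) \<delta>"
    using per unfolding peripheral_def by metis
  obtain q where q: "q \<in> P" "p = h q" using p P(2) by (metis imageE)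
  have kp: "k p = q" using homeomorphism_apply1[OF h subsetD[OF P(1) q(1)]] q(2) by simp
  have "\<exists>\<delta>. path_image \<delta> \<subseteq> V \<and> homotopic_loops (S2 - P) \<gamma> \<delta>" if V: "open V" "q \<in> V" for V
  proof -
    \<comment> \<open>Peripherality is tested on open sets of the ambient space, so the relatively
      open preimage of \<open>V\<close> is extended to an open set \<open>W'\<close>.\<close>
    have "openin (top_of_set S2) (S2 \<inter> k -` V)"
      using homeomorphism_cont2[OF h] V(1) by (rule continuous_openin_preimage_gen)
    then obtain W' where W': "open W'" "S2 \<inter> k -` V = S2 \<inter> W'" by (auto simp: openin_open)
    have "p \<in> S2 \<inter> k -` V" using kp V(2) subsetD[OF P(1) p] by simp
    then have "p \<in> W'" using W'(2) by simp
    then obtain \<delta> where \<delta>: "path_image \<delta> \<subseteq> W'" "homotopic_loops (S2 - P) (h \<circ> \<gamma>) \<delta>"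
      using W[OF W'(1)] by metis
    have sub: "path_image \<delta> \<subseteq> S2 - P" using homotopic_loops_imp_subset[OF \<delta>(2)] by simp
    have "path_image (k \<circ> \<delta>) \<subseteq> V"
    proof
      fix y assume "y \<in> path_image (k \<circ> \<delta>)"
      then obtain x where x: "x \<in> path_image \<delta>" "y = k x" by (auto simp: path_image_compose)
      then have "x \<in> S2 \<inter> W'" using \<delta>(1) sub by fast
      then have "x \<in> S2 \<inter> k -` V" using W'(2) by simp
      then show "y \<in> V" using x(2) by simp
    qed
    moreover have "homotopic_loops (S2 - P) \<gamma> (k \<circ> \<delta>)"
      using homotopic_loops_inverse_homeomorphism[OF homeomorphism_complement[OF h P] \<gamma> \<delta>(2)] .
    ultimately show ?thesis by blast
  qed
  then show ?thesis using q(1) unfolding peripheral_def by blast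
qed

lemma components_homeomorphism:
  assumes h: "homeomorphism A B h k" and C: "C \<in> components A"
  shows "h ` C \<in> components B"
proof -
  obtain x where x: "x \<in> A" "C = connected_component_set A x"
    using C unfolding components_iff by (elim exE conjE) (rule that)
  have "h x \<in> B" using homeomorphism_image1[OF h] imageI[OF x(1)] by metis
  moreover have "h ` C = connected_component_set B (h x)"
    using connected_component_set_homeomorphism[OF h x(1)] x(2) by simp
  ultimately show ?thesis unfolding components_iff by (intro exI conjI)
qed

text \<open>The relation \<open>f (h x) = g (f x)\<close> makes \<open>h\<close> map one full
  preimage homeomorphically onto the other, and homeomorphisms carry components to
  components.\<close>

lemma components_semiconjugacy:
  assumes h: "homeomorphism X X h k" and g: "homeomorphism X X g l"
    and f: "\<And>x. x \<in> X \<Longrightarrow> f x \<in> X" and fh: "\<And>x. x \<in> X \<Longrightarrow> f (h x) = g (f x)"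
    and \<Gamma>: "\<Gamma> \<subseteq> X" and C: "C \<in> components {x\<in>X. f x \<in> \<Gamma>}"
  shows "h ` C \<in> components {x\<in>X. f x \<in> g ` \<Gamma>}"
proof -
  have im: "h ` {x\<in>X. f x \<in> \<Gamma>} = {x\<in>X. f x \<in> g ` \<Gamma>}"
  proof (intro equalityI subsetI)
    fix y assume "y \<in> h ` {x\<in>X. f x \<in> \<Gamma>}"
    then obtain x where x: "x \<in> X" "f x \<in> \<Gamma>" "y = h x" by auto
    have "h x \<in> X" using homeomorphism_image1[OF h] imageI[OF x(1)] by metis
    then show "y \<in> {x\<in>X. f x \<in> g ` \<Gamma>}" using x fh[OF x(1)] by simp
  next
    fix y assume "y \<in> {x\<in>X. f x \<in> g ` \<Gamma>}"
    then obtain z where z: "y \<in> X" "z \<in> \<Gamma>" "f y = g z" by auto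
    have ky: "k y \<in> X" using homeomorphism_image2[OF h] imageI[OF z(1)] by metis
    have hk: "h (k y) = y" using homeomorphism_apply2[OF h z(1)] .
    have "g (f (k y)) = g z" using fh[OF ky] hk z(3) by simp
    then have "l (g (f (k y))) = l (g z)" by simp
    then have "f (k y) = z"
      using homeomorphism_apply1[OF g f[OF ky]] homeomorphism_apply1[OF g subsetD[OF \<Gamma> z(2)]] by simp
    then show "y \<in> h ` {x\<in>X. f x \<in> \<Gamma>}" using ky hk z(2) by (intro image_eqI[of _ _ "k y"]) auto
  qed
  have "homeomorphism {x\<in>X. f x \<in> \<Gamma>} {x\<in>X. f x \<in> g ` \<Gamma>} h k"
    by (rule homeomorphism_of_subsets[OF h]) (use im in auto)
  then show ?thesis using C by (rule components_homeomorphism)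
qed

text \<open>Orientation is absorbed in the sign of \<open>w\<close>, which leaves one oriented
  homotopy to handle instead of two alternatives.\<close>

lemma has_slope_iff:
  "has_slope P p2 \<gamma> r \<longleftrightarrow> simple_closed_curve_in (S2 - P) \<gamma> \<and>
    (\<exists>q w. (w = slope_dir r \<or> w = - slope_dir r) \<and> (\<forall>\<tau>. q + \<tau> *\<^sub>R w \<notin> Z2) \<and>
      homotopic_loops (S2 - P) \<gamma> (\<lambda>t. p2 (q + (2 * t) *\<^sub>R w)))"
proof -
  have line: "line_through q r \<inter> Z2 = {} \<longleftrightarrow> (\<forall>\<tau>. q + \<tau> *\<^sub>R slope_dir r \<notin> Z2)" for q
    unfolding line_through_def by auto
  \<comment> \<open>Traversed backwards, the loop starts one period later, whence the shift of the
    base point by twice the direction vector.\<close>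
  have rev: "reversepath (line_loop p2 q r) =
      (\<lambda>t. p2 ((q + 2 *\<^sub>R slope_dir r) + (2 * t) *\<^sub>R (- slope_dir r)))" for q
    by (simp add: reversepath_def line_loop_def algebra_simps)
  have rev': "(\<lambda>t. p2 (q + (2 * t) *\<^sub>R (- slope_dir r))) =
      reversepath (line_loop p2 (q - 2 *\<^sub>R slope_dir r) r)" for q
    by (simp add: reversepath_def line_loop_def algebra_simps)
  have "(\<exists>q. line_through q r \<inter> Z2 = {} \<and> unoriented_homotopic (S2 - P) \<gamma> (line_loop p2 q r)) \<longleftrightarrow>
    (\<exists>q w. (w = slope_dir r \<or> w = - slope_dir r) \<and> (\<forall>\<tau>. q + \<tau> *\<^sub>R w \<notin> Z2) \<and>
      homotopic_loops (S2 - P) \<gamma> (\<lambda>t. p2 (q + (2 * t) *\<^sub>R w)))" (is "?l \<longleftrightarrow> ?r")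
  proof
    assume ?l
    then obtain q where q: "\<And>\<tau>. q + \<tau> *\<^sub>R slope_dir r \<notin> Z2"
      and hom: "homotopic_loops (S2 - P) \<gamma> (line_loop p2 q r) \<or>
        homotopic_loops (S2 - P) \<gamma> (reversepath (line_loop p2 q r))"
      unfolding line unoriented_homotopic_def by metis
    from hom show ?r
    proof
      assume "homotopic_loops (S2 - P) \<gamma> (line_loop p2 q r)"
      then show ?r using q unfolding line_loop_def by (intro exI[of _ q] exI[of _ "slope_dir r"]) simp
    next
      assume "homotopic_loops (S2 - P) \<gamma> (reversepath (line_loop p2 q r))"
      moreover have "q + 2 *\<^sub>R slope_dir r + \<tau> *\<^sub>R (- slope_dir r) \<notin> Z2" for \<tau>
        using q[of "2 - \<tau>"] by (simp add: algebra_simps)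
      ultimately show ?r unfolding rev
        by (intro exI[of _ "q + 2 *\<^sub>R slope_dir r"] exI[of _ "- slope_dir r"]) simp
    qed
  next
    assume ?r
    then obtain q w where w: "w = slope_dir r \<or> w = - slope_dir r" and q: "\<And>\<tau>. q + \<tau> *\<^sub>R w \<notin> Z2"
      and hom: "homotopic_loops (S2 - P) \<gamma> (\<lambda>t. p2 (q + (2 * t) *\<^sub>R w))"
      by metis
    from w show ?l
    proof
      assume "w = slope_dir r"
      then show ?l using q hom unfolding line unoriented_homotopic_def line_loop_def
        by (intro exI[of _ q]) simp
    next
      assume w: "w = - slope_dir r"
      have "q - 2 *\<^sub>R slope_dir r + \<tau> *\<^sub>R slope_dir r \<notin> Z2" for \<tau>
        using q[of "2 - \<tau>"] by (simp add: w algebra_simps)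
      then show ?l using hom unfolding line unoriented_homotopic_def w rev'
        by (intro exI[of _ "q - 2 *\<^sub>R slope_dir r"]) simp
    qed
  qed
  then show ?thesis unfolding has_slope_def by simp
qed

lemma homotopic_to_line_image:
  assumes hom: "homotopic_loops (S2 - P) \<gamma> (\<lambda>t. p2 (q + (2 * t) *\<^sub>R w))"
    and w: "w = slope_dir r \<or> w = - slope_dir r" and q: "\<And>\<tau>. q + \<tau> *\<^sub>R w \<notin> Z2"
    and h: "homeomorphism S2 S2 h k" and P: "P \<subseteq> S2" "h ` P = P"
    and hp: "\<And>x. h (p2 x) = p2 (A *v x + b)"
    and Ab: "\<And>x. A *v x + b \<in> Z2 \<Longrightarrow> x \<in> Z2"
    and A: "A *v slope_dir r = slope_dir r' \<or> A *v slope_dir r = - slope_dir r'"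
  shows "\<exists>q w. (w = slope_dir r' \<or> w = - slope_dir r') \<and> (\<forall>\<tau>. q + \<tau> *\<^sub>R w \<notin> Z2) \<and>
      homotopic_loops (S2 - P) (h \<circ> \<gamma>) (\<lambda>t. p2 (q + (2 * t) *\<^sub>R w))"
proof (intro exI conjI)
  have eq: "A *v (q + \<tau> *\<^sub>R w) + b = (A *v q + b) + \<tau> *\<^sub>R (A *v w)" for \<tau>
    by (simp add: matrix_vector_right_distrib matrix_vector_mult_scaleR)
  show "A *v w = slope_dir r' \<or> A *v w = - slope_dir r'"
    using w A linear_neg[OF matrix_vector_mul_linear, of A "slope_dir r"] by auto
  show "\<forall>\<tau>. (A *v q + b) + \<tau> *\<^sub>R (A *v w) \<notin> Z2"
    using q Ab unfolding eq[symmetric] by blast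
  have h': "homeomorphism (S2 - P) (S2 - P) h k" by (rule homeomorphism_complement[OF h P])
  have "h \<in> (S2 - P) \<rightarrow> (S2 - P)" using homeomorphism_image1[OF h'] by (intro funcsetI) blast
  from homotopic_loops_continuous_image[OF hom homeomorphism_cont1[OF h'] this]
  show "homotopic_loops (S2 - P) (h \<circ> \<gamma>) (\<lambda>t. p2 ((A *v q + b) + (2 * t) *\<^sub>R (A *v w)))"
    by (simp add: o_def hp eq)
qed

text \<open>The component \<open>\<delta>\<close> is homotopic to a \<open>p2\<close>-line of slope
  \<open>r\<close> by assumption and to a \<open>p1\<close>-line of slope \<open>s\<close> by
  \<open>pullback_line\<close>; eliminating it leaves a relation between straight lines.\<close>

lemma (in orbifold_pair) pullback_slope_line:
  assumes P: "postcritical_set f = P" and ps: "pullback_slope f p2 s r"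
  obtains q w x d where "w = slope_dir r \<or> w = - slope_dir r" "\<And>\<tau>. q + \<tau> *\<^sub>R w \<notin> Z2"
    "of_int d *\<^sub>R slope_dir s \<in> L1"
    "homotopic_loops (S2 - P) (\<lambda>t. p2 (q + (2 * t) *\<^sub>R w))
      (\<lambda>t. p1 (x + (2 * (of_int d * t)) *\<^sub>R slope_dir s))"
proof -
  obtain \<gamma> \<delta> where \<gamma>: "has_slope P p2 \<gamma> s" and \<delta>: "has_slope P p2 \<delta> r"
    and comp: "path_image \<delta> \<in> components {x\<in>S2. f x \<in> path_image \<gamma>}"
    using ps unfolding pullback_slope_def P by (elim exE conjE) (rule that)
  obtain q' w' where w': "w' = slope_dir s \<or> w' = - slope_dir s" "\<And>\<tau>. q' + \<tau> *\<^sub>R w' \<notin> Z2"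
    and hom': "homotopic_loops (S2 - P) \<gamma> (\<lambda>t. p2 (q' + (2 * t) *\<^sub>R w'))"
    and sc': "simple_closed_curve_in (S2 - P) \<gamma>"
    using \<gamma> unfolding has_slope_iff by metis
  obtain q w where w: "w = slope_dir r \<or> w = - slope_dir r" "\<And>\<tau>. q + \<tau> *\<^sub>R w \<notin> Z2"
    and hom: "homotopic_loops (S2 - P) \<delta> (\<lambda>t. p2 (q + (2 * t) *\<^sub>R w))"
    and sc: "simple_closed_curve_in (S2 - P) \<delta>"
    using \<delta> unfolding has_slope_iff by metis
  have w'Z: "w' \<in> Z2" using w'(1) slope_dir_Z2 Z2_minus by auto
  have sub: "path_image \<delta> \<subseteq> {x\<in>S2. f x \<in> path_image \<gamma>}" using comp by (rule in_components_subset)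
  have f\<delta>: "f (\<delta> t) \<in> path_image \<gamma>" if "t \<in> {0..1}" for t
    using subsetD[OF sub[unfolded path_image_def] imageI[OF that]] by (simp add: path_image_def)
  have \<delta>S: "path_image \<delta> \<subseteq> S2" using sub Collect_subset by (rule subset_trans)
  obtain x v d where v: "v = w' \<or> v = - w'" and dv: "of_int d *\<^sub>R v \<in> L1"
    and hom1: "homotopic_loops (S2 - P) \<delta> (\<lambda>t. p1 (x + (2 * (of_int d * t)) *\<^sub>R v))"
  proof (rule pullback_line[OF _ _ hom' w'Z w'(2) _ _ \<delta>S f\<delta>])
    show "simple_path \<gamma>" "pathfinish \<gamma> = pathstart \<gamma>" "path \<delta>" "pathfinish \<delta> = pathstart \<delta>"
      using sc sc' by (simp_all add: simple_closed_curve_in_def simple_path_imp_path)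
  qed
  have hom2: "homotopic_loops (S2 - P) (\<lambda>t. p2 (q + (2 * t) *\<^sub>R w)) (\<lambda>t. p1 (x + (2 * (of_int d * t)) *\<^sub>R v))"
    by (rule homotopic_loops_trans[OF homotopic_loops_sym[OF hom] hom1])
  have "v = slope_dir s \<or> v = - slope_dir s" using v w'(1) by auto
  then show thesis
  proof
    assume v: "v = slope_dir s"
    show thesis by (rule that[OF w]) (use dv hom2 v in auto)
  next
    \<comment> \<open>The sign of the direction is moved into the multiplicity
      \<open>d\<close>.\<close>
    assume v: "v = - slope_dir s"
    show thesis
      by (rule that[OF w, of "- d" x]) (use dv hom2 in \<open>simp_all add: v\<close>)
  qed
qed

text \<open>Other curves of slope \<open>s\<close> and other components may change \<open>x\<close>
  and \<open>d\<close>, but not the direction \<open>slope_dir s\<close> of the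
  \<open>p1\<close>-line, which is all that \<open>pullback_parallel\<close> requires.\<close>

lemma (in orbifold_pair) pullback_slope_unique:
  assumes P: "postcritical_set f = P" and "pullback_slope f p2 s r1" "pullback_slope f p2 s r2"
  shows "r1 = r2"
proof -
  obtain q1 w1 x1 d1 where 1: "w1 = slope_dir r1 \<or> w1 = - slope_dir r1" "\<And>\<tau>. q1 + \<tau> *\<^sub>R w1 \<notin> Z2"
    "of_int d1 *\<^sub>R slope_dir s \<in> L1"
    "homotopic_loops (S2 - P) (\<lambda>t. p2 (q1 + (2 * t) *\<^sub>R w1))
      (\<lambda>t. p1 (x1 + (2 * (of_int d1 * t)) *\<^sub>R slope_dir s))"
    by (rule pullback_slope_line[OF assms(1,2)]) (rule that)
  obtain q2 w2 x2 d2 where 2: "w2 = slope_dir r2 \<or> w2 = - slope_dir r2" "\<And>\<tau>. q2 + \<tau> *\<^sub>R w2 \<notin> Z2"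
    "of_int d2 *\<^sub>R slope_dir s \<in> L1"
    "homotopic_loops (S2 - P) (\<lambda>t. p2 (q2 + (2 * t) *\<^sub>R w2))
      (\<lambda>t. p1 (x2 + (2 * (of_int d2 * t)) *\<^sub>R slope_dir s))"
    by (rule pullback_slope_line[OF assms(1,3)]) (rule that)
  have "w1 \<in> Z2" "w2 \<in> Z2" using 1(1) 2(1) slope_dir_Z2 Z2_minus by auto
  then have "det2 w1 w2 = 0" using pullback_parallel[OF 1(4) _ 1(2,3) 2(4) _ 2(2,3)] by blast
  then have "det2 (slope_dir r1) (slope_dir r2) = 0" using 1(1) 2(1) by (auto simp: det2_def)
  then show ?thesis by (rule slope_dir_parallel)
qed

section \<open>Affine maps of the integer lattice\<close>

lemma linear_part_affine: "linear_part (\<lambda>x. A *v x + b) = A"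
  by (simp add: linear_part_def)

lemma det_nonzero_cancel:
  fixes A :: "real^2^2"
  assumes "det A \<noteq> 0" "A *v x = A *v y"
  shows "x = y"
proof -
  have "inj ((*v) A)" using assms(1) by (simp add: invertible_det_nz[symmetric] inj_matrix_vector_mult)
  then show ?thesis using assms(2) by (rule injD)
qed

lemma affine_Z2:
  assumes A: "invertible A" and im: "(\<lambda>x. A *v x + b) ` Z2 = Z2"
  shows "b \<in> Z2" "A \<in> GL2Z" "A *v x + b \<in> Z2 \<longleftrightarrow> x \<in> Z2"
proof -
  have maps: "A *v x + b \<in> Z2" if "x \<in> Z2" for x using imageI[OF that, of "\<lambda>x. A *v x + b"] im by simp
  show b: "b \<in> Z2" using maps[OF Z2_zero] by simp
  have lin: "A *v x \<in> Z2" if "x \<in> Z2" for x using Z2_diff[OF maps[OF that] b] by simp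
  have det: "det A \<noteq> 0" using A by (simp add: invertible_det_nz)
  have axis: "axis j 1 \<in> Z2" for j :: 2 by (simp add: Z2_def axis_def)
  have int: "integer_matrix A"
    unfolding integer_matrix_def
  proof (intro allI)
    fix i j
    have "A *v axis j 1 \<in> Z2" by (rule lin[OF axis])
    then show "A $ i $ j \<in> \<int>" by (simp add: matrix_vector_mul_component Z2_def inner_axis)
  qed
  have "\<exists>v\<in>Z2. A *v v = axis j 1" for j
  proof -
    have "axis j 1 + b \<in> (\<lambda>x. A *v x + b) ` Z2" unfolding im by (rule Z2_add[OF axis b])
    then show ?thesis by auto
  qed
  then obtain v where v: "\<And>j. v j \<in> Z2" "\<And>j. A *v v j = axis j 1" by metis
  \<comment> \<open>Its columns are lattice vectors that \<open>A\<close> maps to the standard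
    basis, so it is an integral inverse of \<open>A\<close>.\<close>
  define B :: "real^2^2" where "B = (\<chi> i j. v j $ i)"
  have "integer_matrix B" using v(1) by (simp add: integer_matrix_def B_def Z2_def)
  moreover have AB: "A ** B = mat 1"
  proof -
    have "(A ** B) $ i $ j = (A *v v j) $ i" for i j
      by (simp add: matrix_matrix_mult_def matrix_vector_mult_def B_def)
    then show ?thesis by (simp add: v(2) vec_eq_iff mat_def axis_def)
  qed
  moreover have "B ** A = mat 1" using AB by (simp add: matrix_left_right_inverse)
  ultimately show "A \<in> GL2Z" using int unfolding GL2Z_def by blast
  show "A *v x + b \<in> Z2 \<longleftrightarrow> x \<in> Z2"
  proof
    assume "A *v x + b \<in> Z2"
    then have "A *v x + b \<in> (\<lambda>x. A *v x + b) ` Z2" using im by simp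
    then obtain y where y: "y \<in> Z2" "A *v x + b = A *v y + b" by auto
    then show "x \<in> Z2" using det_nonzero_cancel[OF det, of x y] by simp
  qed (rule maps)
qed

lemma GL2Z_det:
  assumes "A \<in> GL2Z"
  shows "det A = 1 \<or> det A = - 1"
proof -
  obtain B where A: "integer_matrix A" and B: "integer_matrix B" "A ** B = mat 1"
    using assms by (auto simp: GL2Z_def)
  have "det A \<in> \<int>" "det B \<in> \<int>" using A B(1) by (auto simp: det_2 integer_matrix_def)
  then obtain m n :: int where mn: "det A = of_int m" "det B = of_int n" by (auto elim!: Ints_cases)
  have "det A * det B = 1" using B(2) by (metis det_I det_mul)
  then have "of_int (m * n) = (1 :: real)" using mn by simp
  then have "m * n = 1" by (simp only: of_int_eq_1_iff)
  then show ?thesis using mn by (auto simp: zmult_eq_1_iff)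
qed

lemma GL2Z_uminus: "A \<in> GL2Z \<Longrightarrow> - A \<in> GL2Z"
proof -
  assume "A \<in> GL2Z"
  then obtain B where A: "integer_matrix A" and B: "integer_matrix B" "A ** B = mat 1" "B ** A = mat 1"
    by (auto simp: GL2Z_def)
  have "integer_matrix (- A)" "integer_matrix (- B)" using A B by (auto simp: integer_matrix_def)
  moreover have "(- A) ** (- B) = A ** B" "(- B) ** (- A) = B ** A"
    by (simp_all add: matrix_matrix_mult_def vec_eq_iff)
  ultimately show "- A \<in> GL2Z" using B unfolding GL2Z_def by auto
qed

lemma det2_matrix: "det2 (A *v u) (A *v v) = det A * det2 u v"
  by (simp add: det2_def det_2 matrix_vector_mult_def sum_2 algebra_simps)

lemma matrix_eq_on_basis:
  assumes "det2 u v \<noteq> 0" "A *v u = B *v u" "A *v v = B *v v"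
  shows "A = B"
proof -
  have "A $ i $ j = B $ i $ j" for i j
  proof -
    define m n where "m = A $ i $ 1 - B $ i $ 1" and "n = A $ i $ 2 - B $ i $ 2"
    have mn: "m * u $ 1 + n * u $ 2 = 0" "m * v $ 1 + n * v $ 2 = 0"
      using arg_cong[OF assms(2), of "\<lambda>x. x $ i"] arg_cong[OF assms(3), of "\<lambda>x. x $ i"]
      by (simp_all add: m_def n_def matrix_vector_mult_def sum_2 algebra_simps)
    have "m * det2 u v = (m * u $ 1 + n * u $ 2) * v $ 2 - (m * v $ 1 + n * v $ 2) * u $ 2"
      by (simp add: det2_def algebra_simps)
    also have "\<dots> = 0" by (simp only: mn mult_zero_left diff_self)
    finally have "m = 0" using assms(1) by simp
    have "n * det2 u v = (m * v $ 1 + n * v $ 2) * u $ 1 - (m * u $ 1 + n * u $ 2) * v $ 1"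
      by (simp add: det2_def algebra_simps)
    also have "\<dots> = 0" by (simp only: mn mult_zero_left diff_self)
    finally have "n = 0" using assms(1) by simp
    then show ?thesis using \<open>m = 0\<close> exhaust_2[of j] by (auto simp: m_def n_def)
  qed
  then show ?thesis by (simp add: vec_eq_iff)
qed

lemma matrix_determined_by_slopes:
  assumes A: "A \<in> GL2Z" and ab: "a \<noteq> b"
    and a: "A *v slope_dir a = slope_dir a' \<or> A *v slope_dir a = - slope_dir a'"
    and b: "A *v slope_dir b = slope_dir b' \<or> A *v slope_dir b = - slope_dir b'"
  shows "Q \<in> GL2Z \<and> det Q = det A \<and> takes_slope_to ((*v) Q) a a' \<and> takes_slope_to ((*v) Q) b b'
    \<longleftrightarrow> Q = A \<or> Q = - A"
proof -
  have takes: "takes_slope_to ((*v) M) r r' \<longleftrightarrow>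
      M *v slope_dir r = slope_dir r' \<or> M *v slope_dir r = - slope_dir r'" if "M \<in> GL2Z" for M r r'
    using takes_slope_to_GL2Z[OF that, of 0 r r'] by simp
  have neg: "(- A) *v x = - (A *v x)" for x
    by (simp add: vec_eq_iff matrix_vector_mult_def sum_negf)
  have D: "det2 (slope_dir a) (slope_dir b) \<noteq> 0" using ab slope_dir_parallel by blast
  have d: "det A \<noteq> 0" using GL2Z_det[OF A] by auto
  show ?thesis
  proof
    assume "Q = A \<or> Q = - A"
    moreover have "det (- A) = det A" by (simp add: det_2)
    ultimately show "Q \<in> GL2Z \<and> det Q = det A \<and> takes_slope_to ((*v) Q) a a' \<and> takes_slope_to ((*v) Q) b b'"
      using A GL2Z_uminus[OF A] a b takes neg by auto
  next
    assume *: "Q \<in> GL2Z \<and> det Q = det A \<and> takes_slope_to ((*v) Q) a a' \<and> takes_slope_to ((*v) Q) b b'"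
    then have "Q *v slope_dir a = A *v slope_dir a \<or> Q *v slope_dir a = - (A *v slope_dir a)"
      "Q *v slope_dir b = A *v slope_dir b \<or> Q *v slope_dir b = - (A *v slope_dir b)"
      using a b takes by auto
    then obtain \<epsilon> \<eta> :: real where \<epsilon>: "\<epsilon> = 1 \<or> \<epsilon> = - 1" "Q *v slope_dir a = \<epsilon> *\<^sub>R (A *v slope_dir a)"
      and \<eta>: "\<eta> = 1 \<or> \<eta> = - 1" "Q *v slope_dir b = \<eta> *\<^sub>R (A *v slope_dir b)"
      by (metis scaleR_one scaleR_minus1_left)
    have "det A * det2 (slope_dir a) (slope_dir b) = det2 (Q *v slope_dir a) (Q *v slope_dir b)"
      using * by (simp add: det2_matrix)
    also have "\<dots> = \<epsilon> * \<eta> * det2 (A *v slope_dir a) (A *v slope_dir b)"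
      by (simp add: \<epsilon>(2) \<eta>(2) det2_def algebra_simps)
    also have "\<dots> = \<epsilon> * \<eta> * (det A * det2 (slope_dir a) (slope_dir b))" by (simp add: det2_matrix)
    finally have "\<epsilon> * \<eta> = 1" using D d by simp
    then have "\<epsilon> = \<eta>" using \<epsilon>(1) \<eta>(1) by auto
    show "Q = A \<or> Q = - A"
      using \<epsilon>(1)
    proof
      assume "\<epsilon> = 1"
      then have "Q = A" using \<epsilon>(2) \<eta>(2) \<open>\<epsilon> = \<eta>\<close> by (intro matrix_eq_on_basis[OF D]) auto
      then show ?thesis by blast
    next
      assume "\<epsilon> = - 1"
      then have "Q = - A" using \<epsilon>(2) \<eta>(2) \<open>\<epsilon> = \<eta>\<close> neg by (intro matrix_eq_on_basis[OF D]) auto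
      then show ?thesis by blast
    qed
  qed
qed

text \<open>\<open>L\<close> is the set of points near which \<open>p\<close> fails to be injective,
  and an affine isomorphism covering an injective map preserves this property in both
  directions.\<close>

lemma (in orbifold_cover) affine_lift_preserves_L:
  assumes A: "invertible A" and h: "inj_on h S2" and hp: "\<And>x. h (p x) = p (A *v x + c)"
  shows "(\<lambda>x. A *v x + c) ` L = L"
proof -
  have pS: "p x \<in> S2" for x using surj by blast
  obtain B where B: "A ** B = mat 1" "B ** A = mat 1" using A by (auto simp: invertible_def)
  have AB: "A *v (B *v x) = x" "B *v (A *v x) = x" for x by (simp_all add: matrix_vector_mul_assoc B)
  have iff: "p x = p y \<longleftrightarrow> p (A *v x + c) = p (A *v y + c)" for x y
    using inj_onD[OF h _ pS pS, of x y] hp by metis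
  have mem: "A *v x + c \<in> L \<longleftrightarrow> x \<in> L" for x
  proof
    assume *: "A *v x + c \<in> L"
    show "x \<in> L"
    proof (rule ccontr)
      assume "x \<notin> L"
      then obtain r where r: "r > 0" "inj_on p (ball x r)" by (rule locally_injective)
      let ?U = "(\<lambda>y. B *v (y - c)) -` ball x r"
      have "open ?U" unfolding matrix_vector_mult_diff_distrib
        by (intro open_vimage open_ball continuous_intros)
      moreover have "A *v x + c \<in> ?U" using r(1) by (simp add: AB)
      moreover have "inj_on p ?U"
      proof
        fix u v assume uv: "u \<in> ?U" "v \<in> ?U" "p u = p v"
        have "A *v (B *v (y - c)) + c = y" for y by (simp add: AB)
        then have "p (B *v (u - c)) = p (B *v (v - c))" 
          using iff[of "B *v (u - c)" "B *v (v - c)"] uv(3) by simp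
        then have "B *v (u - c) = B *v (v - c)" using inj_onD[OF r(2)] uv by simp
        then have "A *v (B *v (u - c)) = A *v (B *v (v - c))" by simp
        then show "u = v" by (simp add: AB)
      qed
      ultimately show False using not_locally_injective[OF *] by blast
    qed
  next
    assume *: "x \<in> L"
    show "A *v x + c \<in> L"
    proof (rule ccontr)
      assume "A *v x + c \<notin> L"
      then obtain r where r: "r > 0" "inj_on p (ball (A *v x + c) r)" by (rule locally_injective)
      let ?U = "(\<lambda>y. A *v y + c) -` ball (A *v x + c) r"
      have "open ?U" by (intro open_vimage open_ball continuous_intros)
      moreover have "x \<in> ?U" using r(1) by simp
      moreover have "inj_on p ?U"
      proof
        fix u v assume uv: "u \<in> ?U" "v \<in> ?U" "p u = p v"
        have "p (A *v u + c) = p (A *v v + c)" using iff uv(3) by blast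
        then have "A *v u + c = A *v v + c" by (rule inj_onD[OF r(2)]) (use uv in auto)
        then have "B *v (A *v u) = B *v (A *v v)" by simp
        then show "u = v" by (simp add: AB)
      qed
      ultimately show False using not_locally_injective[OF *] by blast
    qed
  qed
  show ?thesis
  proof (intro equalityI subsetI)
    fix y assume y: "y \<in> L"
    have "A *v (B *v (y - c)) + c = y" by (simp add: AB)
    then show "y \<in> (\<lambda>x. A *v x + c) ` L" using y mem[of "B *v (y - c)"]
      by (intro image_eqI[of _ _ "B *v (y - c)"]) auto
  qed (use mem in auto)
qed

lemma NET_presentation_orbifold_pair:
  assumes f: "NET_map f" and pres: "NET_presentation f L1 Z2 p1 p2"
  shows "orbifold_pair L1 p1 p2 f"
proof -
  have P: "p2 ` Z2 = postcritical_set f" using pres by (simp add: NET_presentation_def)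
  interpret o1: orbifold_covering L1 p1
    using pres by (intro orbifold_coveringI) (simp_all add: NET_presentation_def)
  interpret o2: orbifold_covering Z2 p2
    using pres by (intro orbifold_coveringI) (simp_all add: NET_presentation_def)
  show ?thesis
  proof
    have "f \<circ> p1 = p2" using pres by (simp add: NET_presentation_def)
    then show "f (p1 x) = p2 x" for x by (metis comp_apply)
    show "continuous_on S2 f"
      using f by (simp add: NET_map_def Thurston_map_def oriented_branched_covering_def)
    show "f ` p2 ` Z2 \<subseteq> p2 ` Z2"
      unfolding P
    proof
      fix y assume "y \<in> f ` postcritical_set f"
      then obtain k x where "k \<ge> 1" "x \<in> critical_points f" "y = f ((f ^^ k) x)"
        by (auto simp: postcritical_set_def)
      then have "Suc k \<in> {1..}" "y \<in> (f ^^ Suc k) ` critical_points f" by auto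
      then show "y \<in> postcritical_set f" unfolding postcritical_set_def by blast
    qed
  qed
qed

section \<open>Equivariance of the slope function\<close>

text \<open>\<open>B\<close> and \<open>b\<close> give \<open>\<Psi>\<close>, which induces
  \<open>h\<close> through \<open>p1\<close> and \<open>h'\<close> through \<open>p2\<close>.
  \<open>A\<close> and \<open>c\<close> give the lift through \<open>p2\<close> of the start of an
  isotopy that ends at \<open>h\<close>. Invariance of \<open>Z2\<close> is assumed for the former
  and derived for the latter.\<close>

locale affine_symmetry = orbifold_pair +
  fixes H :: "real \<times> (real^3) \<Rightarrow> real^3" and h h' k k' :: "real^3 \<Rightarrow> real^3"
    and A B :: "real^2^2" and b c :: "real^2"
  assumes P_post: "postcritical_set f = p2 ` Z2"
    and B: "invertible B" "(\<lambda>x. B *v x + b) ` Z2 = Z2"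
    and A: "invertible A"
    and h: "homeomorphism S2 S2 h k" and h_p1: "h (p1 x) = p1 (B *v x + b)"
    and h': "homeomorphism S2 S2 h' k'" and h'_p2: "h' (p2 x) = p2 (B *v x + b)"
    and H_cont: "continuous_on ({0..1} \<times> S2) H"
    and H_homeo: "u \<in> {0..1} \<Longrightarrow> \<exists>k. homeomorphism S2 S2 (\<lambda>x. H (u, x)) k"
    and H_P: "u \<in> {0..1} \<Longrightarrow> y \<in> P \<Longrightarrow> H (u, y) = H (0, y)"
    and H0: "H (0, p2 x) = p2 (A *v x + c)"
    and H1: "y \<in> S2 \<Longrightarrow> H (1, y) = h y"
begin

lemma P_S2: "P \<subseteq> S2"
  using o2.surj by blast

lemma H_inj: "u \<in> {0..1} \<Longrightarrow> inj_on (\<lambda>x. H (u, x)) S2"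
  using H_homeo homeomorphism_apply1 by (metis inj_on_inverseI)

lemma A_Z2: "(\<lambda>x. A *v x + c) ` Z2 = Z2"
  using H_inj[of 0] H0 by (intro o2.affine_lift_preserves_L[OF A, of "\<lambda>y. H (0, y)"]) auto

lemmas A_facts = affine_Z2[OF A A_Z2]
lemmas B_facts = affine_Z2[OF B]

lemma H_image_P:
  assumes "u \<in> {0..1}"
  shows "(\<lambda>y. H (u, y)) ` P = P"
proof -
  have "(\<lambda>y. H (u, y)) ` P = (\<lambda>y. H (0, y)) ` P" using H_P[OF assms] by (rule image_cong[OF refl])
  also have "\<dots> = p2 ` (\<lambda>x. A *v x + c) ` Z2" by (simp add: image_image H0)
  finally show ?thesis using A_Z2 by simp
qed

lemma H_complement:
  assumes u: "u \<in> {0..1}" and y: "y \<in> S2 - P"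
  shows "H (u, y) \<in> S2 - P"
proof -
  obtain k where "homeomorphism S2 S2 (\<lambda>x. H (u, x)) k" using H_homeo[OF u] by blast
  from homeomorphism_image1[OF homeomorphism_complement[OF this P_S2 H_image_P[OF u]]]
  show ?thesis using y by blast
qed

lemma h_image_P: "h ` P = P"
proof -
  have "h ` P = (\<lambda>y. H (1, y)) ` P" using H1 P_S2 by (intro image_cong) auto
  then show ?thesis using H_image_P[of 1] by simp
qed

lemma h'_image_P: "h' ` P = P"
proof -
  have "h' ` P = p2 ` (\<lambda>x. B *v x + b) ` Z2" by (simp add: image_image h'_p2)
  then show ?thesis using B(2) by simp
qed

text \<open>Both determinants are \<open>1\<close> or \<open>-1\<close>, so comparing orientations
  is enough.\<close>

lemma det_eq: "det A = det B"
proof -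
  have "det A > 0 \<longleftrightarrow> det B > 0"
  proof (rule same_orientation[OF H_cont H0])
    show "H (1, p1 x) = p1 (B *v x + b)" for x
    proof -
      have "p1 x \<in> S2" using o1.surj by blast
      then show ?thesis using H1 h_p1 by simp
    qed
    show "A *v l \<in> Z2" if "l \<in> Z2" for l
      using A_facts(2) that integer_matrix_Z2 by (auto simp: GL2Z_def)
    show "det A \<noteq> 0" "det B \<noteq> 0" using A B(1) by (simp_all add: invertible_det_nz)
  qed (use H_complement H_inj A_facts B_facts in auto)
  then show ?thesis using GL2Z_det[OF A_facts(2)] GL2Z_det[OF B_facts(2)] by auto
qed

text \<open>The witnesses are the curve \<open>h' \<circ> \<gamma>\<close> and the component
  \<open>h \<circ> \<delta>\<close>, matched by the relation \<open>f (h y) = h' (f y)\<close> on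
  the sphere.\<close>

lemma pullback_slope_image:
  assumes ps: "pullback_slope f p2 s r"
    and s: "B *v slope_dir s = slope_dir s' \<or> B *v slope_dir s = - slope_dir s'"
    and r: "A *v slope_dir r = slope_dir r' \<or> A *v slope_dir r = - slope_dir r'"
  shows "pullback_slope f p2 s' r'"
proof -
  obtain \<gamma> \<delta> where \<gamma>: "has_slope P p2 \<gamma> s" and \<delta>: "has_slope P p2 \<delta> r"
    and comp: "path_image \<delta> \<in> components {x\<in>S2. f x \<in> path_image \<gamma>}"
    and ess: "essential P \<delta>" and per: "\<not> peripheral P \<delta>"
    using ps unfolding pullback_slope_def P_post by (elim exE conjE) (rule that)
  obtain q w where w: "w = slope_dir s \<or> w = - slope_dir s" "\<And>\<tau>. q + \<tau> *\<^sub>R w \<notin> Z2"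
    and hom: "homotopic_loops (S2 - P) \<gamma> (\<lambda>t. p2 (q + (2 * t) *\<^sub>R w))"
    and sc: "simple_closed_curve_in (S2 - P) \<gamma>"
    using \<gamma> unfolding has_slope_iff by metis
  obtain q1 w1 where w1: "w1 = slope_dir r \<or> w1 = - slope_dir r" "\<And>\<tau>. q1 + \<tau> *\<^sub>R w1 \<notin> Z2"
    and hom1: "homotopic_loops (S2 - P) \<delta> (\<lambda>t. p2 (q1 + (2 * t) *\<^sub>R w1))"
    and sc1: "simple_closed_curve_in (S2 - P) \<delta>"
    using \<delta> unfolding has_slope_iff by metis
  have \<delta>: "path \<delta>" "pathfinish \<delta> = pathstart \<delta>" "path_image \<delta> \<subseteq> S2 - P"
    using sc1 by (simp_all add: simple_closed_curve_in_def simple_path_imp_path)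
  note hc = homeomorphism_complement[OF h P_S2 h_image_P]
  note h'c = homeomorphism_complement[OF h' P_S2 h'_image_P]
  have 1: "has_slope P p2 (h' \<circ> \<gamma>) s'"
    unfolding has_slope_iff
    using simple_closed_curve_in_homeomorphism[OF h'c sc]
      homotopic_to_line_image[OF hom w h' P_S2 h'_image_P h'_p2 B_facts(3)[THEN iffD1] s]
    by (rule conjI)
  obtain k0 where k0: "homeomorphism S2 S2 (\<lambda>x. H (0, x)) k0" using H_homeo[of 0] by auto
  \<comment> \<open>\<open>h\<close> is affine through \<open>p1\<close>, whereas slopes refer to
    \<open>p2\<close>; the isotopy replaces it by \<open>H (0, _)\<close>, which is affine through
    \<open>p2\<close>.\<close>
  have move: "homotopic_loops (S2 - P) (h \<circ> \<delta>) ((\<lambda>x. H (0, x)) \<circ> \<delta>)"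
  proof -
    have \<delta>t: "\<delta> t \<in> S2 - P" if "t \<in> {0..1}" for t
      using subsetD[OF \<delta>(3)[unfolded path_image_def] imageI[OF that]] .
    have "homotopic_loops (S2 - P) ((\<lambda>x. H (0, x)) \<circ> \<delta>) (h \<circ> \<delta>)"
      unfolding homotopic_loops
    proof (intro exI[of _ "\<lambda>z. H (fst z, \<delta> (snd z))"] conjI ballI)
      show "continuous_on ({0..1} \<times> {0..1}) (\<lambda>z. H (fst z, \<delta> (snd z)))"
      proof (rule continuous_on_compose2[OF H_cont])
        have "continuous_on ({0..1} \<times> {0..1}) (\<lambda>z :: real \<times> real. \<delta> (snd z))"
          using \<delta>(1) unfolding path_def
          by (rule continuous_on_compose2[where t = "{0..1}"]) (auto intro: continuous_intros)
        then show "continuous_on ({0..1} \<times> {0..1}) (\<lambda>z :: real \<times> real. (fst z, \<delta> (snd z)))"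
          by (intro continuous_intros)
        show "(\<lambda>z :: real \<times> real. (fst z, \<delta> (snd z))) ` ({0..1} \<times> {0..1}) \<subseteq> {0..1} \<times> S2"
          using \<delta>t by auto
      qed
      show "(\<lambda>z. H (fst z, \<delta> (snd z))) \<in> {0..1} \<times> {0..1} \<rightarrow> S2 - P"
        by (intro Pi_I H_complement \<delta>t) auto
      show "H (fst (1, t), \<delta> (snd (1, t))) = (h \<circ> \<delta>) t" if "t \<in> {0..1}" for t
        using H1 \<delta>t[OF that] by simp
      show "pathfinish ((\<lambda>z. H (fst z, \<delta> (snd z))) \<circ> Pair u) =
          pathstart ((\<lambda>z. H (fst z, \<delta> (snd z))) \<circ> Pair u)" for u
        using \<delta>(2) by (simp add: pathfinish_def pathstart_def)
    qed auto
    then show ?thesis by (rule homotopic_loops_sym)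
  qed
  obtain q2 w2 where w2: "w2 = slope_dir r' \<or> w2 = - slope_dir r'" "\<forall>\<tau>. q2 + \<tau> *\<^sub>R w2 \<notin> Z2"
    and hom2: "homotopic_loops (S2 - P) ((\<lambda>x. H (0, x)) \<circ> \<delta>) (\<lambda>t. p2 (q2 + (2 * t) *\<^sub>R w2))"
    using homotopic_to_line_image[OF hom1 w1 k0 P_S2 H_image_P[of 0] H0 A_facts(3)[THEN iffD1] r]
    by auto
  have 2: "has_slope P p2 (h \<circ> \<delta>) r'"
    unfolding has_slope_iff
    using simple_closed_curve_in_homeomorphism[OF hc sc1] w2 homotopic_loops_trans[OF move hom2]
    by blast
  have 3: "path_image (h \<circ> \<delta>) \<in> components {x\<in>S2. f x \<in> path_image (h' \<circ> \<gamma>)}"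
    unfolding path_image_compose
  proof (rule components_semiconjugacy[OF h h' _ _ _ comp])
    fix y assume "y \<in> S2"
    then obtain x where x: "y = p1 x" using o1.surj by (metis imageE)
    show "f y \<in> S2" using o2.surj by (metis f_p1 rangeI x)
    show "f (h y) = h' (f y)" by (simp add: x h_p1 f_p1 h'_p2)
  next
    show "path_image \<gamma> \<subseteq> S2" using sc unfolding simple_closed_curve_in_def
      by (elim conjE) (rule subset_trans, assumption, rule Diff_subset)
  qed
  have 4: "essential P (h \<circ> \<delta>)" by (rule essential_homeomorphism[OF h P_S2 h_image_P \<delta> ess])
  have 5: "\<not> peripheral P (h \<circ> \<delta>)"
    using peripheral_homeomorphism[OF h P_S2 h_image_P \<delta>] per by blast
  show ?thesis
    unfolding pullback_slope_def P_post
    using 1 2 3 4 5 simple_closed_curve_in_homeomorphism[OF hc sc1] by blast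
qed

text \<open>Uniqueness of the pulled back slope makes the definite description in
  \<open>slope_function\<close> return the transported slope.\<close>

lemma slope_function_image:
  assumes sf: "slope_function f p2 s = Some r"
    and s: "takes_slope_to (\<lambda>x. B *v x + b) s s'"
  obtains r' where "slope_function f p2 s' = Some r'"
    "A *v slope_dir r = slope_dir r' \<or> A *v slope_dir r = - slope_dir r'"
proof -
  have the: "(THE r. pullback_slope f p2 s r) = r" if "pullback_slope f p2 s r" for s r
    using that pullback_slope_unique[OF P_post] by blast
  have "pullback_slope f p2 s r"
  proof -
    have ex: "\<exists>r. pullback_slope f p2 s r" using sf by (auto simp: slope_function_def split: if_splits)
    then obtain r0 where r0: "pullback_slope f p2 s r0" by blast
    then have "slope_function f p2 s = Some r0" using the[OF r0] by (auto simp: slope_function_def)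
    then show ?thesis using r0 sf by simp
  qed
  moreover have "B *v slope_dir s = slope_dir s' \<or> B *v slope_dir s = - slope_dir s'"
    using s takes_slope_to_GL2Z[OF B_facts(2)] by simp
  moreover obtain r' where r': "A *v slope_dir r = slope_dir r' \<or> A *v slope_dir r = - slope_dir r'"
    using GL2Z_slope_image[OF A_facts(2)] .
  ultimately have "pullback_slope f p2 s' r'" by (rule pullback_slope_image)
  then have "slope_function f p2 s' = Some r'" using the by (auto simp: slope_function_def)
  then show thesis using r' that by blast
qed

lemma fibre_image: "(\<lambda>x. B *v x + b) ` (p1 -` {y}) = p1 -` {h y}" if "y \<in> S2"
proof (intro equalityI subsetI)
  fix z assume "z \<in> p1 -` {h y}"
  then have z: "p1 z = h y" by simp
  obtain C where "B ** C = mat 1" using B(1) by (auto simp: invertible_def)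
  then have BC: "B *v (C *v (z - b)) + b = z" by (simp add: matrix_vector_mul_assoc)
  have "h (p1 (C *v (z - b))) = h y" using h_p1[of "C *v (z - b)"] BC z by simp
  moreover have "p1 (C *v (z - b)) \<in> S2" using o1.surj by blast
  ultimately have "p1 (C *v (z - b)) = y" using homeomorphism_apply1[OF h] that by metis
  then show "z \<in> (\<lambda>x. B *v x + b) ` (p1 -` {y})" using BC by (intro image_eqI[of _ _ "C *v (z - b)"]) auto
qed (auto simp: h_p1[symmetric])

end

text \<open>For \<open>x\<close> in \<open>L\<close> the half turn about \<open>l\<close> moves
  \<open>x\<close> by \<open>2 *\<^sub>R (l - x)\<close>, which is again twice an element of
  \<open>L\<close>.\<close>

lemma (in orbifold_covering) fibre_eq_iff:
  assumes "x \<in> L" "y \<in> L"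
  shows "p x = p y \<longleftrightarrow> (\<exists>l\<in>L. y = x + 2 *\<^sub>R l)"
proof
  assume "p x = p y"
  then obtain l where l: "l \<in> L" "y = 2 *\<^sub>R l + x \<or> y = 2 *\<^sub>R l - x" using eq_iff by blast
  from l(2) show "\<exists>l\<in>L. y = x + 2 *\<^sub>R l"
  proof
    assume "y = 2 *\<^sub>R l - x"
    then have "y = x + 2 *\<^sub>R (l - x)" by (simp add: algebra_simps scaleR_2)
    then show ?thesis using L_diff[OF l(1) assms(1)] by blast
  qed (use l in \<open>auto simp: add.commute\<close>)
qed (use translate in auto)

text \<open>The four points represent the quotient of the lattice by twice itself, so each names one
  translation term modulo \<open>2 Z2\<close>.\<close>

lemma Z2_mod_2:
  assumes "x \<in> Z2"
  shows "\<exists>!\<tau>. \<tau> \<in> {0, e1, e2, e1 + e2} \<and> (\<exists>v\<in>Z2. x = \<tau> + 2 *\<^sub>R v)"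
proof -
  obtain m n where x: "x = vector [of_int m, of_int n]" using assms Z2_vector by blast
  have T: "{0, e1, e2, e1 + e2} = {vector [of_int i, of_int j] | i j. i \<in> {0, 1 :: int} \<and> j \<in> {0, 1 :: int}}"
    (is "_ = ?T")
  proof -
    have "?T = {vector [of_int 0, of_int 0], vector [of_int 1, of_int 0],
        vector [of_int 0, of_int 1], vector [of_int 1, of_int 1]}" by blast
    moreover have "(vector [of_int 0, of_int 0] :: real^2) = 0" "vector [of_int 1, of_int 0] = e1"
      "vector [of_int 0, of_int 1] = e2" "vector [of_int 1, of_int 1] = e1 + e2"
      by (simp_all add: vec_eq_iff forall_2 e1_def e2_def axis_def)
    ultimately show ?thesis by (simp only:)
  qed
  have mod: "(\<exists>v\<in>Z2. x = vector [of_int i, of_int j] + 2 *\<^sub>R v) \<longleftrightarrow> i = m mod 2 \<and> j = n mod 2"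
    if "i \<in> {0, 1}" "j \<in> {0, 1}" for i j :: int
  proof
    assume "\<exists>v\<in>Z2. x = vector [of_int i, of_int j] + 2 *\<^sub>R v"
    then obtain k l where "x = vector [of_int i, of_int j] + 2 *\<^sub>R vector [of_int k, of_int l]"
      using Z2_vector by auto
    then have "real_of_int m = of_int (i + 2 * k)" "real_of_int n = of_int (j + 2 * l)"
      unfolding x by (simp_all add: vec_eq_iff forall_2)
    then have "m = i + 2 * k" "n = j + 2 * l" by (simp_all only: of_int_eq_iff)
    then show "i = m mod 2 \<and> j = n mod 2" using that by auto
  next
    assume ij: "i = m mod 2 \<and> j = n mod 2"
    have "real_of_int k = of_int (k mod 2) + 2 * of_int (k div 2)" for k :: int
      by (metis mod_mult_div_eq of_int_add of_int_mult of_int_numeral)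
    from this[of m] this[of n]
    have "x = vector [of_int i, of_int j] + 2 *\<^sub>R vector [of_int (m div 2), of_int (n div 2)]"
      unfolding vec_eq_iff forall_2 x using ij by simp
    then show "\<exists>v\<in>Z2. x = vector [of_int i, of_int j] + 2 *\<^sub>R v" using Z2_vector by blast
  qed
  show ?thesis
    unfolding T
  proof (rule ex1I[of _ "vector [of_int (m mod 2), of_int (n mod 2)]"])
    have mn: "m mod 2 \<in> {0, 1}" "n mod 2 \<in> {0, 1}" by auto
    then have "vector [of_int (m mod 2), of_int (n mod 2)] \<in> ?T"
      by (intro CollectI exI[of _ "m mod 2"] exI[of _ "n mod 2"] conjI refl)
    moreover have "\<exists>v\<in>Z2. x = vector [of_int (m mod 2), of_int (n mod 2)] + 2 *\<^sub>R v"
      using mod[OF mn] by (rule iffD2) simp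
    ultimately show "vector [of_int (m mod 2), of_int (n mod 2)] \<in> ?T \<and>
        (\<exists>v\<in>Z2. x = vector [of_int (m mod 2), of_int (n mod 2)] + 2 *\<^sub>R v)" ..
  next
    fix \<tau> assume *: "\<tau> \<in> ?T \<and> (\<exists>v\<in>Z2. x = \<tau> + 2 *\<^sub>R v)"
    note \<tau> = conjunct1[OF *] conjunct2[OF *]
    from \<tau>(1) obtain i j :: int where ij: "i \<in> {0, 1}" "j \<in> {0, 1}" "\<tau> = vector [of_int i, of_int j]"
      by (elim CollectE exE conjE) (rule that)
    then show "\<tau> = vector [of_int (m mod 2), of_int (n mod 2)]" using \<tau>(2) mod[OF ij(1,2)] by simp
  qed
qed

text \<open>Uniqueness up to sign is expressed by the equivalence listing all admissible
  \<open>Q\<close>. That the translation matters only modulo twice the lattice is the conjunct that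
  all shifted lifts induce the same \<open>\<psi>'\<close>.\<close>

theorem theorem5p2:
  fixes f \<psi>t \<psi> \<psi>' :: "real^3 \<Rightarrow> real^3"
    and \<pi>1 \<pi>2 :: "real^2 \<Rightarrow> real^3"
    and \<Lambda>1 :: "(real^2) set"
    and \<Psi> \<Psi>t :: "real^2 \<Rightarrow> real^2"
    and s t a b :: slope
    and T :: "(real^2) set"
  defines "T \<equiv> {0, e1, e2, e1 + e2}"
  assumes "NET_map f"
    and "NET_presentation f \<Lambda>1 Z2 \<pi>1 \<pi>2"
    and "slope_function f \<pi>2 s = Some a" and "slope_function f \<pi>2 t = Some b" and "a \<noteq> b"
    and "\<Psi> \<in> Aff f \<Lambda>1 Z2 \<pi>1"
    and "\<exists>g. homeomorphism S2 S2 \<psi>t g" and "\<pi>1 \<circ> \<Psi> = \<psi>t \<circ> \<pi>1"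
    and "\<exists>g. homeomorphism S2 S2 \<psi> g" and "\<pi>2 \<circ> \<Psi> = \<psi> \<circ> \<pi>2"
    and "affine_iso \<Psi>t"
    and "\<exists>g. homeomorphism S2 S2 \<psi>' g" and "\<pi>2 \<circ> \<Psi>t = \<psi>' \<circ> \<pi>2"
    and "isotopic_rel S2 (postcritical_set f) \<psi>' \<psi>t"
  shows
    "(\<forall>s' t'. takes_slope_to \<Psi> s s' \<and> takes_slope_to \<Psi> t t' \<longrightarrow>
        (\<exists>a' b'. slope_function f \<pi>2 s' = Some a' \<and> slope_function f \<pi>2 t' = Some b' \<and>
          (\<forall>Q. Q \<in> GL2Z \<and> det Q = det (linear_part \<Psi>) \<and>
               takes_slope_to ((*v) Q) a a' \<and> takes_slope_to ((*v) Q) b b'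
             \<longleftrightarrow> Q = linear_part \<Psi>t \<or> Q = - linear_part \<Psi>t))) \<and>
     postcritical_set f = \<pi>2 ` T \<and>
     (\<forall>v\<in>Z2. \<pi>2 \<circ> (\<lambda>x. \<Psi>t x + 2 *\<^sub>R v) = \<psi>' \<circ> \<pi>2) \<and>
     (\<exists>!\<tau>. \<tau> \<in> T \<and> \<Psi> ` (\<pi>1 -` {\<pi>2 0}) = \<pi>1 -` {\<pi>2 \<tau>}) \<and>
     (\<forall>\<tau>\<in>T. \<Psi> ` (\<pi>1 -` {\<pi>2 0}) = \<pi>1 -` {\<pi>2 \<tau>} \<longrightarrow>
        (\<exists>v\<in>Z2. \<Psi>t 0 = \<tau> + 2 *\<^sub>R v))"
proof -
  have P: "postcritical_set f = \<pi>2 ` Z2" using assms(3) by (simp add: NET_presentation_def)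
  obtain B d where B0: "invertible B" "\<Psi> = (\<lambda>x. B *v x + d)" and \<Psi>Z: "\<Psi> ` Z2 = Z2"
    using assms(7) by (auto simp: Aff_def affine_iso_def)
  obtain A c where A0: "invertible A" "\<Psi>t = (\<lambda>x. A *v x + c)"
    using assms(12) by (auto simp: affine_iso_def)
  obtain k where k: "homeomorphism S2 S2 \<psi>t k" using assms(8) by blast
  obtain k' where k': "homeomorphism S2 S2 \<psi> k'" using assms(10) by blast
  obtain H :: "real \<times> (real^3) \<Rightarrow> real^3" where H: "continuous_on ({0..1} \<times> S2) H"
    "\<forall>x\<in>S2. H (0, x) = \<psi>' x \<and> H (1, x) = \<psi>t x"
    "\<forall>t\<in>{0..1}. \<exists>k. homeomorphism S2 S2 (\<lambda>x. H (t, x)) k"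
    "\<forall>t\<in>{0..1}. \<forall>y\<in>postcritical_set f. H (t, y) = \<psi>' y"
    using assms(15) unfolding isotopic_rel_def by (elim exE conjE) (rule that)
  interpret orbifold_pair \<Lambda>1 \<pi>1 \<pi>2 f
    using NET_presentation_orbifold_pair assms(2,3) by blast
  have \<pi>2S: "\<pi>2 x \<in> S2" for x using o2.surj by blast
  have \<psi>': "\<psi>' (\<pi>2 x) = \<pi>2 (A *v x + c)" for x
    using fun_cong[OF assms(14), of x] A0(2) by simp
  have H_0: "H (0, \<pi>2 x) = \<pi>2 (A *v x + c)" for x
    using bspec[OF H(2) \<pi>2S] \<psi>' by simp
  interpret affine_symmetry \<Lambda>1 \<pi>1 \<pi>2 f H \<psi>t \<psi> k k' A B d c
  proof
    show "(\<lambda>x. B *v x + d) ` Z2 = Z2" using \<Psi>Z B0(2) by simp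
    show "\<psi>t (\<pi>1 x) = \<pi>1 (B *v x + d)" for x using fun_cong[OF assms(9), of x] B0(2) by simp
    show "\<psi> (\<pi>2 x) = \<pi>2 (B *v x + d)" for x using fun_cong[OF assms(11), of x] B0(2) by simp
    show "\<exists>k. homeomorphism S2 S2 (\<lambda>x. H (u, x)) k" if "u \<in> {0..1}" for u
      using H(3) that by blast
    show "H (u, y) = H (0, y)" if "u \<in> {0..1}" "y \<in> \<pi>2 ` Z2" for u y
    proof -
      have "0 \<in> {0..1 :: real}" by simp
      then show ?thesis using H(4) that unfolding P by metis
    qed
    show "H (1, y) = \<psi>t y" if "y \<in> S2" for y using H(2) that by blast
  qed (use P B0(1) A0(1) k k' H(1) H_0 in auto)
  have c: "c \<in> Z2" by (rule A_facts(1))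
  have T: "T \<subseteq> Z2" by (auto simp: T_def Z2_def e1_def e2_def axis_def)
  have lin: "linear_part \<Psi> = B" "linear_part \<Psi>t = A"
    by (simp_all add: A0(2) B0(2) linear_part_affine)

  have 1: "\<exists>a' b'. slope_function f \<pi>2 s' = Some a' \<and> slope_function f \<pi>2 t' = Some b' \<and>
      (\<forall>Q. Q \<in> GL2Z \<and> det Q = det (linear_part \<Psi>) \<and>
           takes_slope_to ((*v) Q) a a' \<and> takes_slope_to ((*v) Q) b b'
         \<longleftrightarrow> Q = linear_part \<Psi>t \<or> Q = - linear_part \<Psi>t)"
    if slopes: "takes_slope_to \<Psi> s s'" "takes_slope_to \<Psi> t t'" for s' t'
  proof -
    obtain a' where a': "slope_function f \<pi>2 s' = Some a'"
      "A *v slope_dir a = slope_dir a' \<or> A *v slope_dir a = - slope_dir a'"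
      using slope_function_image[OF assms(4) slopes(1)[unfolded B0(2)]] .
    obtain b' where b': "slope_function f \<pi>2 t' = Some b'"
      "A *v slope_dir b = slope_dir b' \<or> A *v slope_dir b = - slope_dir b'"
      using slope_function_image[OF assms(5) slopes(2)[unfolded B0(2)]] .
    show ?thesis
      using a'(1) b'(1) matrix_determined_by_slopes[OF A_facts(2) assms(6) a'(2) b'(2)]
      unfolding lin det_eq[symmetric] by (intro exI[of _ a'] exI[of _ b']) simp
  qed

  have 2: "postcritical_set f = \<pi>2 ` T"
    unfolding P
  proof
    show "\<pi>2 ` T \<subseteq> \<pi>2 ` Z2" using T by (rule image_mono)
    show "\<pi>2 ` Z2 \<subseteq> \<pi>2 ` T"
    proof
      fix y assume "y \<in> \<pi>2 ` Z2"
      then obtain x where x: "x \<in> Z2" "y = \<pi>2 x" by auto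
      then obtain \<tau> v where \<tau>: "\<tau> \<in> T" "v \<in> Z2" "x = \<tau> + 2 *\<^sub>R v"
        using Z2_mod_2[OF x(1)] unfolding T_def by metis
      then have "y = \<pi>2 \<tau>" using x(2) o2.translate by simp
      then show "y \<in> \<pi>2 ` T" using \<tau>(1) by (intro image_eqI)
    qed
  qed

  have 3: "\<pi>2 \<circ> (\<lambda>x. \<Psi>t x + 2 *\<^sub>R v) = \<psi>' \<circ> \<pi>2" if "v \<in> Z2" for v
    using o2.translate[OF that] \<psi>' by (simp add: fun_eq_iff A0(2))

  have fibre: "\<Psi> ` (\<pi>1 -` {\<pi>2 0}) = \<pi>1 -` {\<pi>2 \<tau>} \<longleftrightarrow> (\<exists>v\<in>Z2. c = \<tau> + 2 *\<^sub>R v)" if \<tau>: "\<tau> \<in> Z2" for \<tau>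
  proof -
    \<comment> \<open>The isotopy is constant on marked points, so at \<open>\<pi>2 0\<close> the
      map \<open>\<psi>t\<close>, which permutes the fibres of \<open>\<pi>1\<close>, agrees with
      \<open>\<psi>'\<close>, whose value there is \<open>\<pi>2 c\<close>.\<close>
    have "\<pi>2 0 \<in> postcritical_set f" unfolding P using Z2_zero by (rule imageI)
    then have "\<psi>t (\<pi>2 0) = \<psi>' (\<pi>2 0)"
      using bspec[OF H(2) \<pi>2S, of 0] H(4) by (metis atLeastAtMost_iff order_refl zero_le_one)
    then have "\<Psi> ` (\<pi>1 -` {\<pi>2 0}) = \<pi>1 -` {\<pi>2 c}"
      using fibre_image[OF \<pi>2S, of 0] \<psi>'[of 0] by (simp add: B0(2))
    moreover have "\<pi>1 -` {\<pi>2 c} = \<pi>1 -` {\<pi>2 \<tau>} \<longleftrightarrow> \<pi>2 c = \<pi>2 \<tau>"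
    proof
      assume eq: "\<pi>1 -` {\<pi>2 c} = \<pi>1 -` {\<pi>2 \<tau>}"
      obtain x where "\<pi>1 x = \<pi>2 c" using \<pi>2S[of c] o1.surj by (metis imageE)
      then show "\<pi>2 c = \<pi>2 \<tau>" using eq by auto
    qed simp
    moreover have "\<pi>2 c = \<pi>2 \<tau> \<longleftrightarrow> \<pi>2 \<tau> = \<pi>2 c" by (rule eq_commute)
    ultimately show ?thesis using o2.fibre_eq_iff[OF \<tau> c] by simp
  qed
  have 4: "\<exists>!\<tau>. \<tau> \<in> T \<and> \<Psi> ` (\<pi>1 -` {\<pi>2 0}) = \<pi>1 -` {\<pi>2 \<tau>}"
  proof -
    have "\<tau> \<in> T \<and> \<Psi> ` (\<pi>1 -` {\<pi>2 0}) = \<pi>1 -` {\<pi>2 \<tau>} \<longleftrightarrow> \<tau> \<in> T \<and> (\<exists>v\<in>Z2. c = \<tau> + 2 *\<^sub>R v)" for \<tau>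
      using fibre[OF subsetD[OF T]] by (rule conj_cong[OF refl])
    then show ?thesis using Z2_mod_2[OF c] unfolding T_def by (simp only:)
  qed
  have 5: "\<exists>v\<in>Z2. \<Psi>t 0 = \<tau> + 2 *\<^sub>R v"
    if "\<tau> \<in> T" "\<Psi> ` (\<pi>1 -` {\<pi>2 0}) = \<pi>1 -` {\<pi>2 \<tau>}" for \<tau>
    using fibre[OF subsetD[OF T that(1)]] that(2) by (simp add: A0(2))
  from 1 have "\<forall>s' t'. takes_slope_to \<Psi> s s' \<and> takes_slope_to \<Psi> t t' \<longrightarrow>
        (\<exists>a' b'. slope_function f \<pi>2 s' = Some a' \<and> slope_function f \<pi>2 t' = Some b' \<and>
          (\<forall>Q. Q \<in> GL2Z \<and> det Q = det (linear_part \<Psi>) \<and>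
               takes_slope_to ((*v) Q) a a' \<and> takes_slope_to ((*v) Q) b b'
             \<longleftrightarrow> Q = linear_part \<Psi>t \<or> Q = - linear_part \<Psi>t))" by simp
  moreover note 2
  moreover from 3 have "\<forall>v\<in>Z2. \<pi>2 \<circ> (\<lambda>x. \<Psi>t x + 2 *\<^sub>R v) = \<psi>' \<circ> \<pi>2" by simp
  moreover note 4
  moreover from 5 have "\<forall>\<tau>\<in>T. \<Psi> ` (\<pi>1 -` {\<pi>2 0}) = \<pi>1 -` {\<pi>2 \<tau>} \<longrightarrow>
        (\<exists>v\<in>Z2. \<Psi>t 0 = \<tau> + 2 *\<^sub>R v)" by simp
  ultimately show ?thesis by (intro conjI)
qed

end
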